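(* For any instance of the Dial-a-Ride problem on an $n$-vertex metric, there is a 1-preemptive tour of length at most $O(\log^2 n)\cdot OPT_{pmt}$, where $OPT_{pmt}$ is the length of an optimal preemptive tour. Moreover, such a tour can be found in randomized polynomial time.
   Context: Dial-a-Ride: given an $n$-vertex metric $(V,d)$, a root $r$, $m$ demands $(s_i,t_i)$ and a vehicle capacity $k$, a tour starts and ends at $r$ and must move each object $i$ from $s_i$ to $t_i$ while carrying at most $k$ objects at any time; its length is the sum of $d$ over traversed edges. In a preemptive tour, an object after being picked up may be left at intermediate vertices and picked up again later, any number of times, before being delivered to its destination. A 1-preemptive tour is one in which each object is left at an intermediate vertex (other than its destination) at most once. *)

theory Defs
  imports
    "HOL-Analysis.Abstract_Metric_Spaces"
    "HOL-Probability.Probability_Mass_Function"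
    "HOL-Computational_Algebra.Polynomial"
    "HOL-Library.Log_Nat"
begin

section \<open>Dial-a-Ride\<close>

text \<open>
  The vertex set is \<open>{..<nverts I}\<close>. Objects are the positions in the list of demands, so
  several objects may share a source and a destination.
\<close>

record dial_a_ride =
  nverts :: nat
  dst :: "nat \<Rightarrow> nat \<Rightarrow> real"
  root_vertex :: nat
  demands :: "(nat \<times> nat) list"
  capacity :: nat

abbreviation nobjects :: "dial_a_ride \<Rightarrow> nat" where
  "nobjects I \<equiv> length (demands I)"

abbreviation src :: "dial_a_ride \<Rightarrow> nat \<Rightarrow> nat" where
  "src I i \<equiv> fst (demands I ! i)"

abbreviation dest :: "dial_a_ride \<Rightarrow> nat \<Rightarrow> nat" where
  "dest I i \<equiv> snd (demands I ! i)"

definition dar_instance :: "dial_a_ride \<Rightarrow> bool" where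
  "dar_instance I \<longleftrightarrow>
     Metric_space {..<nverts I} (dst I) \<and>
     root_vertex I < nverts I \<and>
     (\<forall>i < nobjects I. src I i < nverts I \<and> dest I i < nverts I) \<and>
     capacity I \<ge> 1"

datatype action = Move nat | Pickup nat | Drop nat

text \<open>
  A configuration is the vertex of the vehicle together with the place of every object:
  \<open>Some v\<close> if it lies at \<open>v\<close>, \<open>None\<close> if it is in the vehicle.
\<close>

type_synonym config = "nat \<times> (nat \<Rightarrow> nat option)"

fun act :: "dial_a_ride \<Rightarrow> config \<Rightarrow> action \<Rightarrow> config option" where
  "act I (u, loc) (Move v) = (if v < nverts I then Some (v, loc) else None)"
| "act I (u, loc) (Pickup i) =
     (if i < nobjects I \<and> loc i = Some u \<and> card {j. j < nobjects I \<and> loc j = None} < capacity I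
      then Some (u, loc(i := None)) else None)"
| "act I (u, loc) (Drop i) =
     (if i < nobjects I \<and> loc i = None then Some (u, loc(i := Some u)) else None)"

fun acts :: "dial_a_ride \<Rightarrow> config \<Rightarrow> action list \<Rightarrow> config option" where
  "acts I c [] = Some c"
| "acts I c (a # \<sigma>) = Option.bind (act I c a) (\<lambda>c'. acts I c' \<sigma>)"

definition preemptive_tour :: "dial_a_ride \<Rightarrow> action list \<Rightarrow> bool" where
  "preemptive_tour I \<sigma> \<longleftrightarrow>
     (\<exists>loc. acts I (root_vertex I, \<lambda>i. Some (src I i)) \<sigma> = Some (root_vertex I, loc) \<and>
            (\<forall>i < nobjects I. loc i = Some (dest I i)))"

fun length_from :: "dial_a_ride \<Rightarrow> nat \<Rightarrow> action list \<Rightarrow> real" where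
  "length_from I u [] = 0"
| "length_from I u (Move v # \<sigma>) = dst I u v + length_from I v \<sigma>"
| "length_from I u (Pickup i # \<sigma>) = length_from I u \<sigma>"
| "length_from I u (Drop i # \<sigma>) = length_from I u \<sigma>"

definition tour_length :: "dial_a_ride \<Rightarrow> action list \<Rightarrow> real" where
  "tour_length I \<sigma> = length_from I (root_vertex I) \<sigma>"

text \<open>The drops made along a tour that continues from \<open>u\<close>, as pairs (object, vertex).\<close>

fun drops_from :: "nat \<Rightarrow> action list \<Rightarrow> (nat \<times> nat) list" where
  "drops_from u [] = []"
| "drops_from u (Move v # \<sigma>) = drops_from v \<sigma>"
| "drops_from u (Pickup i # \<sigma>) = drops_from u \<sigma>"
| "drops_from u (Drop i # \<sigma>) = (i, u) # drops_from u \<sigma>"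

definition one_preemptive_tour :: "dial_a_ride \<Rightarrow> action list \<Rightarrow> bool" where
  "one_preemptive_tour I \<sigma> \<longleftrightarrow>
     preemptive_tour I \<sigma> \<and>
     (\<forall>i < nobjects I.
        length (filter (\<lambda>(j, v). j = i \<and> v \<noteq> dest I i) (drops_from (root_vertex I) \<sigma>)) \<le> 1)"

text \<open>
  For a \<open>dar_instance\<close> the set below is nonempty and bounded below by 0, and the infimum is
  attained: below any bound there are only finitely many tour lengths, as distances between
  distinct vertices are positive and there are finitely many of them.
\<close>

definition opt_pmt :: "dial_a_ride \<Rightarrow> real" where
  "opt_pmt I = Inf {tour_length I \<sigma> |\<sigma>. preemptive_tour I \<sigma>}"

section \<open>Randomized computation\<close>

text \<open>
  While programs over binary trees with natural numbers at the leaves, extended by fair coin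
  flips. Numbers are charged by their binary length. Evaluating an expression is charged the
  total size of the values of all its subexpressions; every primitive operation can be carried
  out by a Turing machine in time polynomial in the sizes of its operands, and the sizes of all
  values that arise are paid for, so that polynomial time here is polynomial time on
  (probabilistic) Turing machines.
\<close>

datatype val = Num nat | Pair val val

fun vsize :: "val \<Rightarrow> nat" where
  "vsize (Num n) = 1 + floorlog 2 n"
| "vsize (Pair a b) = 1 + vsize a + vsize b"

fun num_of :: "val \<Rightarrow> nat" where
  "num_of (Num n) = n"
| "num_of (Pair a b) = 0"

fun left_of :: "val \<Rightarrow> val" where
  "left_of (Num n) = Num 0"
| "left_of (Pair a b) = a"

fun right_of :: "val \<Rightarrow> val" where
  "right_of (Num n) = Num 0"
| "right_of (Pair a b) = b"

datatype unop = Left | Right | IsPair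

datatype binop = MkPair | Add | Sub | Mul | Div | Less | Eq

fun apply_unop :: "unop \<Rightarrow> val \<Rightarrow> val" where
  "apply_unop Left a = left_of a"
| "apply_unop Right a = right_of a"
| "apply_unop IsPair a = Num (case a of Num n \<Rightarrow> 0 | Pair b c \<Rightarrow> 1)"

fun apply_binop :: "binop \<Rightarrow> val \<Rightarrow> val \<Rightarrow> val" where
  "apply_binop MkPair a b = Pair a b"
| "apply_binop Add a b = Num (num_of a + num_of b)"
| "apply_binop Sub a b = Num (num_of a - num_of b)"
| "apply_binop Mul a b = Num (num_of a * num_of b)"
| "apply_binop Div a b = Num (num_of a div num_of b)"
| "apply_binop Less a b = Num (of_bool (num_of a < num_of b))"
| "apply_binop Eq a b = Num (of_bool (a = b))"

datatype expr = Const nat | Var nat | Unop unop expr | Binop binop expr expr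

type_synonym store = "nat \<Rightarrow> val"

fun eval_expr :: "expr \<Rightarrow> store \<Rightarrow> val" where
  "eval_expr (Const n) s = Num n"
| "eval_expr (Var x) s = s x"
| "eval_expr (Unop f e) s = apply_unop f (eval_expr e s)"
| "eval_expr (Binop f e e') s = apply_binop f (eval_expr e s) (eval_expr e' s)"

fun expr_cost :: "expr \<Rightarrow> store \<Rightarrow> nat" where
  "expr_cost (Const n) s = vsize (Num n)"
| "expr_cost (Var x) s = vsize (s x)"
| "expr_cost (Unop f e) s = vsize (eval_expr (Unop f e) s) + expr_cost e s"
| "expr_cost (Binop f e e') s =
     vsize (eval_expr (Binop f e e') s) + expr_cost e s + expr_cost e' s"

datatype com =
    Skip
  | Assign nat expr
  | Flip nat
  | Seq com com
  | Cond expr com com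
  | While expr com

text \<open>
  \<open>big_step c s w t s' w'\<close>: started in store \<open>s\<close> with the coin outcomes \<open>w\<close> still to come, \<open>c\<close>
  halts after time \<open>t\<close> in store \<open>s'\<close>, leaving the outcomes \<open>w'\<close> unread. A flip with no
  outcomes left does not halt. A condition counts as false iff it is \<open>Num 0\<close>.
\<close>

inductive big_step ::
  "com \<Rightarrow> store \<Rightarrow> bool list \<Rightarrow> nat \<Rightarrow> store \<Rightarrow> bool list \<Rightarrow> bool" where
  Skip: "big_step Skip s w 1 s w"
| Assign: "big_step (Assign x e) s w (1 + expr_cost e s) (s(x := eval_expr e s)) w"
| Flip: "big_step (Flip x) s (b # w) 1 (s(x := Num (of_bool b))) w"
| Seq: "big_step c s w t s' w' \<Longrightarrow> big_step c' s' w' t' s'' w'' \<Longrightarrow>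
     big_step (Seq c c') s w (t + t') s'' w''"
| CondTrue: "eval_expr e s \<noteq> Num 0 \<Longrightarrow> big_step c s w t s' w' \<Longrightarrow>
     big_step (Cond e c c') s w (1 + expr_cost e s + t) s' w'"
| CondFalse: "eval_expr e s = Num 0 \<Longrightarrow> big_step c' s w t s' w' \<Longrightarrow>
     big_step (Cond e c c') s w (1 + expr_cost e s + t) s' w'"
| WhileFalse: "eval_expr e s = Num 0 \<Longrightarrow>
     big_step (While e c) s w (1 + expr_cost e s) s w"
| WhileTrue: "eval_expr e s \<noteq> Num 0 \<Longrightarrow> big_step c s w t s' w' \<Longrightarrow>
     big_step (While e c) s' w' t' s'' w'' \<Longrightarrow>
     big_step (While e c) s w (1 + expr_cost e s + t + t') s'' w''"

text \<open>Variable 0 holds the input at the start and the output at the end.\<close>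

definition outputs :: "com \<Rightarrow> val \<Rightarrow> bool list \<Rightarrow> nat \<Rightarrow> val \<Rightarrow> bool" where
  "outputs c x w t y \<longleftrightarrow>
     (\<exists>s w'. big_step c ((\<lambda>_. Num 0)(0 := x)) w t s w' \<and> s 0 = y)"

definition halts_within :: "com \<Rightarrow> val \<Rightarrow> nat \<Rightarrow> bool" where
  "halts_within c x T \<longleftrightarrow> (\<forall>w. length w = T \<longrightarrow> (\<exists>t \<le> T. \<exists>y. outputs c x w t y))"

text \<open>
  A run of time at most \<open>T\<close> reads at most \<open>T\<close> coins, so under \<open>halts_within c x T\<close> the uniform
  distribution on the coin sequences of length \<open>T\<close> yields the output distribution.
\<close>

definition output_prob :: "com \<Rightarrow> val \<Rightarrow> nat \<Rightarrow> (val \<Rightarrow> bool) \<Rightarrow> real" where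
  "output_prob c x T P =
     measure_pmf.prob (pmf_of_set {w :: bool list. length w = T}) {w. \<exists>t y. outputs c x w t y \<and> P y}"

text \<open>
  A randomized polynomial-time algorithm that returns a feasible solution on every run, and a good
  one with probability at least 1/2.
\<close>

definition rand_poly_time_finds ::
  "'i set \<Rightarrow> ('i \<Rightarrow> val) \<Rightarrow> ('o \<Rightarrow> val) \<Rightarrow> ('i \<Rightarrow> 'o \<Rightarrow> bool) \<Rightarrow> ('i \<Rightarrow> 'o \<Rightarrow> bool) \<Rightarrow> bool" where
  "rand_poly_time_finds \<I> enc_in enc_out feasible good \<longleftrightarrow>
     (\<exists>(c :: com) (p :: nat poly). \<forall>I \<in> \<I>.
        let x = enc_in I; T = poly p (vsize x) in
          halts_within c x T \<and>
          output_prob c x T (\<lambda>y. \<exists>\<sigma>. y = enc_out \<sigma> \<and> feasible I \<sigma>) = 1 \<and>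
          output_prob c x T (\<lambda>y. \<exists>\<sigma>. y = enc_out \<sigma> \<and> feasible I \<sigma> \<and> good I \<sigma>) \<ge> 1/2)"

section \<open>Encoding of instances and tours\<close>

definition rational_distances :: "dial_a_ride \<Rightarrow> bool" where
  "rational_distances I \<longleftrightarrow> (\<forall>u < nverts I. \<forall>v < nverts I. dst I u v \<in> \<rat>)"

fun enc_list :: "val list \<Rightarrow> val" where
  "enc_list [] = Num 0"
| "enc_list (a # as) = Pair a (enc_list as)"

text \<open>Used for nonnegative rationals only: numerator and denominator in lowest terms.\<close>

definition enc_distance :: "real \<Rightarrow> val" where
  "enc_distance x =
     (let (a, b) = quotient_of (the_inv (of_rat :: rat \<Rightarrow> real) x) in Pair (Num (nat a)) (Num (nat b)))"

definition enc_instance :: "dial_a_ride \<Rightarrow> val" where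
  "enc_instance I = enc_list
     [Num (nverts I),
      enc_list (map (\<lambda>u. enc_list (map (\<lambda>v. enc_distance (dst I u v)) [0..<nverts I])) [0..<nverts I]),
      Num (root_vertex I),
      enc_list (map (\<lambda>(u, v). Pair (Num u) (Num v)) (demands I)),
      Num (capacity I)]"

fun enc_action :: "action \<Rightarrow> val" where
  "enc_action (Move v) = Pair (Num 0) (Num v)"
| "enc_action (Pickup i) = Pair (Num 1) (Num i)"
| "enc_action (Drop i) = Pair (Num 2) (Num i)"

definition enc_tour :: "action list \<Rightarrow> val" where
  "enc_tour \<sigma> = enc_list (map enc_action \<sigma>)"

end

theory Submission imports Defs begin

text \<open>
  A preemptive tour of length \<open>OPT\<close> visits all terminals, so Prim's algorithm yields a path through
  them of length at most \<open>2 * OPT\<close>; and as the vehicle carries at most \<open>k\<close> objects, the distances of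
  the objects from their destinations add up to at most \<open>k * OPT\<close>. The objects are split by the
  scale \<open>R = 2 ^ e\<close> of this distance. At scale \<open>R\<close> the path is cut into segments of length \<open>R\<close>, and
  region growing covers their representatives by clusters of radius \<open>O(R * log n)\<close> such that the
  two ends of every object lie in a common cluster and the total size of the clusters is at most
  twice the number of segments. Each object is moved in full batches from its segment to the center
  of its cluster, its only intermediate stop, and from there to the segment of its destination.
  The fully loaded trips are charged to the second lower bound. The remaining ones cost
  \<open>O(R * log n)\<close> per segment, hence \<open>O(log n * OPT)\<close> per scale, and apart from a geometric series
  of small scales there are \<open>O(log n)\<close> scales. No randomness is needed.
\<close>


section \<open>Polynomial time\<close>

text \<open>Clusters and scales use up one logarithm each, so all other steps may lose only
  constants, and the number of objects must not enter at all. Grouping the objects by scale, hub and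
  segment leaves at most one partly filled batch per group, and the groups of a scale are linear in
  the number of its segments only because region growing stops at a radius where one more step at
  most doubles the zone, while the zones that are removed are disjoint. All distances are natural
  numbers, as the program computes with them: rational ones are multiplied by a common denominator,
  and real ones, in the existence claim, are rounded up at the price of a factor 2. Polynomial time
  is shown by closure properties of the predicate \<open>pt\<close> on HOL functions. The obstacle
  there is that an iterated polynomial-time step may let sizes explode, so recursion needs bounds on
  intermediate results; and as numbers are binary, loops run over lists or bit lengths, never over
  numbers. In the final constant, \<open>3024 = 2 * 4 * 378\<close>: rounding, the passage from bit
  lengths to logarithms, and the count of trips.\<close>

lemma poly_nat_mono: "x \<le> y \<Longrightarrow> poly p x \<le> poly p y" for p :: "nat poly"
  by (induction p) (auto intro: add_mono mult_mono)

lemma vsize_pos: "0 < vsize v"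
  by (cases v) auto

lemma floorlog2_le_iff: "floorlog 2 n \<le> k \<longleftrightarrow> n < 2 ^ k"
  using floorlog_le_iff[of 2 n k] by auto

lemma less_power_floorlog2: "n < 2 ^ floorlog 2 n"
  using floorlog2_le_iff[of n] by blast

text \<open>A crude bound, but of the form that \<open>pt_binop\<close> asks for: the size of the
  value is at most the sum of the sizes of the operands.\<close>

lemma floorlog2_add_le: "floorlog 2 (a + b) \<le> floorlog 2 a + floorlog 2 b"
proof -
  let ?A = "2 ^ floorlog 2 a :: nat" and ?B = "2 ^ floorlog 2 b :: nat"
  have "a < ?A" "b < ?B" by (rule less_power_floorlog2)+
  then obtain i j where ij: "?A = a + Suc i" "?B = b + Suc j"
    by (metis add_Suc_right less_natE)
  have "a + b < ?A * ?B" unfolding ij by (simp add: algebra_simps)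
  then show ?thesis by (simp add: floorlog2_le_iff power_add)
qed

lemma floorlog2_mult_le: "floorlog 2 (a * b) \<le> floorlog 2 a + floorlog 2 b"
  by (simp add: floorlog2_le_iff power_add less_power_floorlog2 mult_strict_mono)

lemma floorlog2_mono: "a \<le> b \<Longrightarrow> floorlog 2 a \<le> floorlog 2 b"
  by (meson floorlog2_le_iff le_less_trans less_power_floorlog2)

lemma floorlog2_0 [simp]: "floorlog 2 0 = 0"
  by (simp add: floorlog_def)

section \<open>Encodable types and deterministic running time\<close>

class enc =
  fixes enc :: "'a \<Rightarrow> val"
  assumes enc_inject: "enc x = enc y \<longleftrightarrow> x = y"

abbreviation sz :: "'a::enc \<Rightarrow> nat" where
  "sz x \<equiv> vsize (enc x)"

instantiation nat :: enc begin
definition "enc n = Num n"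
instance by standard (simp add: enc_nat_def)
end

instantiation bool :: enc begin
definition "enc b = Num (of_bool b)"
instance by standard (simp add: enc_bool_def)
end

instantiation prod :: (enc, enc) enc begin
definition "enc p = Pair (enc (fst p)) (enc (snd p))"
instance by standard (auto simp add: enc_prod_def enc_inject prod_eq_iff)
end

lemma enc_list_inject: "enc_list xs = enc_list ys \<longleftrightarrow> xs = ys"
proof (induction xs arbitrary: ys)
  case Nil then show ?case by (cases ys) auto
next
  case (Cons x xs) then show ?case by (cases ys) auto
qed

instantiation list :: (enc) enc begin
definition "enc xs = enc_list (map enc xs)"
instance by standard (auto simp: enc_list_def enc_list_inject inj_map_eq_map inj_on_def enc_inject)
end

instantiation action :: enc begin
definition "enc a = enc_action a"
instance
proof
  fix x y :: action
  show "enc x = enc y \<longleftrightarrow> x = y" unfolding enc_action_def by (cases x; cases y) auto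
qed
end

lemma enc_simps [simp]:
  "enc n = Num n" "enc b = Num (of_bool b)" "enc (x, y) = Pair (enc x) (enc y)"
  "enc ([] :: 'a::enc list) = Num 0" "enc (z # zs) = Pair (enc z) (enc zs)"
  "enc (Move v) = Pair (Num 0) (Num v)" "enc (Pickup v) = Pair (Num 1) (Num v)"
  "enc (Drop v) = Pair (Num 2) (Num v)"
  by (simp_all add: enc_nat_def enc_bool_def enc_prod_def enc_list_def enc_action_def)

lemma left_of_enc [simp]: "left_of (enc p) = enc (fst p)" "right_of (enc p) = enc (snd p)"
  for p :: "'a::enc \<times> 'b::enc"
  by (simp_all add: enc_prod_def)

lemma sz_prod: "sz p = 1 + sz (fst p) + sz (snd p)"
  for p :: "'a::enc \<times> 'b::enc"
  by (simp add: enc_prod_def)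

lemma length_less_sz: "length xs < sz xs"
  by (induction xs) auto

lemma sz_mem_less: "x \<in> set xs \<Longrightarrow> sz x < sz xs"
  by (induction xs) auto

lemma sz_append: "sz (xs @ ys) + 1 = sz xs + sz ys"
  by (induction xs) auto

lemma sz_filter_le: "sz (filter P xs) \<le> sz xs"
  by (induction xs) auto

text \<open>The unread coins are arbitrary and left untouched, and one time \<open>t\<close> serves
  all of them: the program is deterministic. \<open>T\<close> is only an upper bound, so that costs
  may be rounded up to polynomials.\<close>

definition steps :: "com \<Rightarrow> store \<Rightarrow> nat \<Rightarrow> store \<Rightarrow> bool" where
  "steps c s T s' \<longleftrightarrow> (\<exists>t\<le>T. \<forall>w. big_step c s w t s' w)"

lemma steps_mono: "steps c s T s' \<Longrightarrow> T \<le> T' \<Longrightarrow> steps c s T' s'"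
  unfolding steps_def by (meson order_trans)

lemma steps_Assign: "steps (Assign x e) s (1 + expr_cost e s) (s(x := eval_expr e s))"
  unfolding steps_def by (blast intro: big_step.intros)

lemma steps_Assign_le:
  "1 + expr_cost e s \<le> T \<Longrightarrow> s' = s(x := eval_expr e s) \<Longrightarrow> steps (Assign x e) s T s'"
  using steps_mono[OF steps_Assign] by simp

lemma steps_Seq:
  "steps c s T s' \<Longrightarrow> steps c' s' T' s'' \<Longrightarrow> steps (Seq c c') s (T + T') s''"
  unfolding steps_def by (meson add_mono big_step.Seq)

lemma steps_CondTrue:
  "eval_expr e s \<noteq> Num 0 \<Longrightarrow> steps c s T s' \<Longrightarrow> steps (Cond e c c') s (1 + expr_cost e s + T) s'"
  unfolding steps_def by (meson add_left_mono big_step.CondTrue)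

lemma steps_CondFalse:
  "eval_expr e s = Num 0 \<Longrightarrow> steps c' s T s' \<Longrightarrow> steps (Cond e c c') s (1 + expr_cost e s + T) s'"
  unfolding steps_def by (meson add_left_mono big_step.CondFalse)

lemma steps_WhileFalse:
  "eval_expr e s = Num 0 \<Longrightarrow> steps (While e c) s (1 + expr_cost e s) s"
  unfolding steps_def by (blast intro: big_step.intros)

lemma steps_WhileTrue:
  assumes "eval_expr e s \<noteq> Num 0" "steps c s T s'" "steps (While e c) s' T' s''"
  shows "steps (While e c) s (1 + expr_cost e s + T + T') s''"
proof -
  from assms obtain t t' where "t \<le> T" "\<forall>w. big_step c s w t s' w"
    "t' \<le> T'" "\<forall>w. big_step (While e c) s' w t' s'' w"
    unfolding steps_def by blast
  with assms(1) show ?thesis unfolding steps_def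
    using big_step.WhileTrue[of e s c] by (intro exI[of _ "1 + expr_cost e s + t + t'"]) force
qed

text \<open>
  The program may be placed at any base register \<open>b\<close> and leaves the registers below \<open>b\<close> alone,
  so that programs for subterms can be run side by side.
\<close>

definition computes :: "(nat \<Rightarrow> com) \<Rightarrow> nat poly \<Rightarrow> ('a::enc \<Rightarrow> 'b::enc) \<Rightarrow> bool" where
  "computes c p f \<longleftrightarrow> (\<forall>b x s. s b = enc x \<longrightarrow>
     (\<exists>s'. steps (c b) s (poly p (sz x)) s' \<and> s' b = enc (f x) \<and> (\<forall>i<b. s' i = s i)))"

text \<open>The size of the value is bounded along with the time, because \<open>pt_comp\<close>
  evaluates the time bound of the outer function at it.\<close>

definition pt :: "('a::enc \<Rightarrow> 'b::enc) \<Rightarrow> bool" where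
  "pt f \<longleftrightarrow> (\<exists>p c. (\<forall>x. sz (f x) \<le> poly p (sz x)) \<and> computes c p f)"

lemma computesD:
  "computes c p f \<Longrightarrow> s b = enc x \<Longrightarrow>
    \<exists>s'. steps (c b) s (poly p (sz x)) s' \<and> s' b = enc (f x) \<and> (\<forall>i<b. s' i = s i)"
  unfolding computes_def by blast

lemma ptE:
  assumes "pt f"
  obtains p :: "nat poly" and c where "\<And>x. sz (f x) \<le> poly p (sz x)" "computes c p f"
  using assms unfolding pt_def by blast

lemma ptI:
  fixes p p' :: "nat poly" and f :: "'a::enc \<Rightarrow> 'b::enc"
  assumes "\<And>x. sz (f x) \<le> poly p (sz x)"
    "\<And>b x s. s b = enc x \<Longrightarrow>
        \<exists>s'. steps (c b) s (poly p' (sz x)) s' \<and> s' b = enc (f x) \<and> (\<forall>i<b. s' i = s i)"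
  shows "pt f"
  unfolding pt_def
proof (intro exI[of _ "p + p'"] exI[of _ c] conjI allI)
  show "sz (f x) \<le> poly (p + p') (sz x)" for x :: 'a using assms(1)[of x] by simp
  show "computes c (p + p') f"
    unfolding computes_def using assms(2) by (metis le_add2 poly_add steps_mono)
qed

lemma ptD_size: "pt f \<Longrightarrow> \<exists>p :: nat poly. \<forall>x. sz (f x) \<le> poly p (sz x)"
  unfolding pt_def by blast

section \<open>Closure properties of polynomial-time functions\<close>

named_theorems pt_rule

lemma vsize_eval_le: "vsize (eval_expr e s) \<le> expr_cost e s"
  by (cases e) auto

text \<open>The cost of the expression also bounds the size of the value, because evaluation is
  charged for every value that it produces.\<close>

lemma pt_by_expr:
  fixes p :: "nat poly" and f :: "'a::enc \<Rightarrow> 'b::enc"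
  assumes "\<And>b x s. s b = enc x \<Longrightarrow> eval_expr (e b) s = enc (f x)"
    "\<And>b (x::'a) s. s b = enc x \<Longrightarrow> expr_cost (e b) s \<le> poly p (sz x)"
  shows "pt f"
proof (rule ptI[where p = p and p' = "1 + p" and c = "\<lambda>b. Assign b (e b)"])
  show "sz (f x) \<le> poly p (sz x)" for x
    using assms(1)[of "\<lambda>_. enc x" 0 x] assms(2)[of "\<lambda>_. enc x" 0 x]
      vsize_eval_le[of "e 0" "\<lambda>_. enc x"] by simp
next
  fix b and x :: 'a and s :: store assume s: "s b = enc x"
  have "steps (Assign b (e b)) s (poly (1 + p) (sz x)) (s(b := enc (f x)))"
    using steps_mono[OF steps_Assign[of b "e b" s]] assms(1)[of s b x, OF s] assms(2)[of s b x, OF s] by auto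
  then show "\<exists>s'. steps (Assign b (e b)) s (poly (1 + p) (sz x)) s' \<and> s' b = enc (f x) \<and> (\<forall>i<b. s' i = s i)"
    by fastforce
qed

lemma pt_comp:
  fixes f :: "'a::enc \<Rightarrow> 'b::enc" and g :: "'b \<Rightarrow> 'c::enc"
  assumes "pt g" "pt f"
  shows "pt (\<lambda>x. g (f x))"
proof -
  from assms(1) obtain p c where
    p: "\<And>x. sz (g x) \<le> poly p (sz x)" and
    c: "computes c p g"
    using ptE by blast
  from assms(2) obtain p' c' where
    p': "\<And>x. sz (f x) \<le> poly p' (sz x)" and
    c': "computes c' p' f"
    using ptE by blast
  have m: "poly p (sz (f x)) \<le> poly p (poly p' (sz x))" for x
    by (rule poly_nat_mono[OF p'])
  show ?thesis
  proof (rule ptI[where p = "pcompose p p'" and p' = "p' + pcompose p p'"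
        and c = "\<lambda>b. Seq (c' b) (c b)"])
    show "sz (g (f x)) \<le> poly (pcompose p p') (sz x)" for x
      using order_trans[OF p m] by (simp add: poly_pcompose)
  next
    fix b and x :: 'a and s :: store assume "s b = enc x"
    from computesD[OF c', of s b x, OF this] obtain s' where 1: "steps (c' b) s (poly p' (sz x)) s'" "s' b = enc (f x)"
      "\<forall>i<b. s' i = s i" by blast
    from computesD[OF c, of s' b "f x", OF 1(2)] obtain s'' where 2: "steps (c b) s' (poly p (sz (f x))) s''"
      "s'' b = enc (g (f x))" "\<forall>i<b. s'' i = s' i" by blast
    show "\<exists>s'. steps (Seq (c' b) (c b)) s (poly (p' + pcompose p p') (sz x)) s' \<and>
        s' b = enc (g (f x)) \<and> (\<forall>i<b. s' i = s i)"
      using steps_mono[OF steps_Seq[OF 1(1) 2(1)]] m[of x] 1(3) 2(2,3)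
      by (intro exI[of _ s'']) (simp add: poly_pcompose)
  qed
qed

lemma pt_id [pt_rule]: "pt (\<lambda>x. x)"
  by (rule pt_by_expr[where e = Var and p = "[:0, 1:]"]) auto

fun literal :: "val \<Rightarrow> expr" where
  "literal (Num n) = Const n"
| "literal (Pair u v) = Binop MkPair (literal u) (literal v)"

lemma eval_literal: "eval_expr (literal v) s = v"
  by (induction v) auto

lemma cost_literal: "expr_cost (literal v) s = expr_cost (literal v) s'"
  by (induction v) (auto simp: eval_literal)

lemma pt_const [pt_rule]: "pt (\<lambda>x. a)"
  by (rule pt_by_expr[where e = "\<lambda>_. literal (enc a)" and p = "[:expr_cost (literal (enc a)) (\<lambda>_. Num 0):]"])
    (auto simp: eval_literal intro: eq_refl cost_literal)

text \<open>\<open>f\<close> runs at base \<open>b + 1\<close>, so \<open>x\<close> survives in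
  register \<open>b\<close>; then \<open>g\<close> runs at base \<open>b + 2\<close>, so the value
  of \<open>f\<close> survives in register \<open>b + 1\<close>.\<close>

lemma pt_Pair [pt_rule]:
  fixes f :: "'a::enc \<Rightarrow> 'b::enc" and g :: "'a \<Rightarrow> 'c::enc"
  assumes "pt f" "pt g"
  shows "pt (\<lambda>x. (f x, g x))"
proof -
  from assms(1) obtain p c where
    p: "\<And>x. sz (f x) \<le> poly p (sz x)" and
    c: "computes c p f"
    using ptE by blast
  from assms(2) obtain p' c' where
    p': "\<And>x. sz (g x) \<le> poly p' (sz x)" and
    c': "computes c' p' g"
    using ptE by blast
  let ?c = "\<lambda>b. Seq (Assign (b+1) (Var b)) (Seq (c (b+1)) (Seq (Assign (b+2) (Var b))
    (Seq (c' (b+2)) (Assign b (Binop MkPair (Var (b+1)) (Var (b+2)))))))"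
  show ?thesis
  proof (rule ptI[where p = "1 + p + p'" and p' = "[:4, 2:] + 3 * p + 3 * p'" and c = ?c])
    show "sz (f x, g x) \<le> poly (1 + p + p') (sz x)" for x
      using p[of x] p'[of x] by simp
  next
    fix b and x :: 'a and s :: store assume s: "s b = enc x"
    let ?s1 = "s(b+1 := enc x)"
    have 1: "steps (Assign (b+1) (Var b)) s (1 + sz x) ?s1"
      using steps_Assign[of "b+1" "Var b" s] s by simp
    have "?s1 (b+1) = enc x" by simp
    from computesD[OF c, of ?s1 "b+1" x, OF this] obtain s2 where 2: "steps (c (b+1)) ?s1 (poly p (sz x)) s2"
      "s2 (b+1) = enc (f x)" "\<forall>i<b+1. s2 i = ?s1 i" by blast
    have s2b: "s2 b = enc x" using 2(3) s by simp
    let ?s3 = "s2(b+2 := enc x)"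
    have 3: "steps (Assign (b+2) (Var b)) s2 (1 + sz x) ?s3"
      using steps_Assign[of "b+2" "Var b" s2] s2b by simp
    have "?s3 (b+2) = enc x" by simp
    from computesD[OF c', of ?s3 "b+2" x, OF this] obtain s4 where 4: "steps (c' (b+2)) ?s3 (poly p' (sz x)) s4"
      "s4 (b+2) = enc (g x)" "\<forall>i<b+2. s4 i = ?s3 i" by blast
    have s4: "s4 (b+1) = enc (f x)" using 4(3) 2(2) by simp
    let ?s5 = "s4(b := enc (f x, g x))"
    have 5: "steps (Assign b (Binop MkPair (Var (b+1)) (Var (b+2)))) s4
        (1 + (1 + sz (f x) + sz (g x) + sz (f x) + sz (g x))) ?s5"
      using steps_Assign[of b "Binop MkPair (Var (b+1)) (Var (b+2))" s4] 4(2) s4 by simp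
    have "steps (?c b) s (poly ([:4, 2:] + 3 * p + 3 * p') (sz x)) ?s5"
      by (rule steps_mono[OF steps_Seq[OF 1 steps_Seq[OF 2(1) steps_Seq[OF 3 steps_Seq[OF 4(1) 5]]]]])
        (use p[of x] p'[of x] in simp)
    then show "\<exists>s'. steps (?c b) s (poly ([:4, 2:] + 3 * p + 3 * p') (sz x)) s' \<and>
        s' b = enc (f x, g x) \<and> (\<forall>i<b. s' i = s i)"
      using 4(3) 2(3) by (intro exI[of _ ?s5]) simp
  qed
qed

lemma pt_if [pt_rule]:
  fixes f g :: "'a::enc \<Rightarrow> 'b::enc"
  assumes "pt d" "pt f" "pt g"
  shows "pt (\<lambda>x. if d x then f x else g x)"
proof -
  from assms(1) obtain p c where
    p: "\<And>x. sz (d x) \<le> poly p (sz x)" and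
    c: "computes c p d"
    using ptE by blast
  from assms(2) obtain p1 c1 where
    p1: "\<And>x. sz (f x) \<le> poly p1 (sz x)" and
    c1: "computes c1 p1 f"
    using ptE by blast
  from assms(3) obtain p2 c2 where
    p2: "\<And>x. sz (g x) \<le> poly p2 (sz x)" and
    c2: "computes c2 p2 g"
    using ptE by blast
  let ?c = "\<lambda>b. Seq (Assign (b+1) (Var b)) (Seq (c (b+1)) (Cond (Var (b+1)) (c1 b) (c2 b)))"
  let ?p = "[:2, 1:] + 2 * p + p1 + p2"
  show ?thesis
  proof (rule ptI[where p = "p1 + p2" and p' = ?p and c = ?c])
    show "sz (if d x then f x else g x) \<le> poly (p1 + p2) (sz x)" for x
      using p1[of x] p2[of x] by simp
  next
    fix b and x :: 'a and s :: store assume s: "s b = enc x"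
    let ?s1 = "s(b+1 := enc x)"
    have 1: "steps (Assign (b+1) (Var b)) s (1 + sz x) ?s1"
      using steps_Assign[of "b+1" "Var b" s] s by simp
    have "?s1 (b+1) = enc x" by simp
    from computesD[OF c, of ?s1 "b+1" x, OF this] obtain s2 where 2: "steps (c (b+1)) ?s1 (poly p (sz x)) s2"
      "s2 (b+1) = enc (d x)" "\<forall>i<b+1. s2 i = ?s1 i" by blast
    have s2b: "s2 b = enc x" using 2(3) s by simp
    have "\<exists>s3. steps (Cond (Var (b+1)) (c1 b) (c2 b)) s2
        (1 + sz (d x) + (poly p1 (sz x) + poly p2 (sz x))) s3 \<and>
        s3 b = enc (if d x then f x else g x) \<and> (\<forall>i<b. s3 i = s2 i)"
    proof (cases "d x")
      case True
      from computesD[OF c1, of s2 b x, OF s2b] obtain s3 where 3: "steps (c1 b) s2 (poly p1 (sz x)) s3"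
        "s3 b = enc (f x)" "\<forall>i<b. s3 i = s2 i" by blast
      have "eval_expr (Var (b+1)) s2 \<noteq> Num 0" using 2(2) True by simp
      from steps_mono[OF steps_CondTrue[OF this 3(1), where c' = "c2 b"]] show ?thesis
        using 2(2) 3 True by (intro exI[of _ s3]) simp
    next
      case False
      from computesD[OF c2, of s2 b x, OF s2b] obtain s3 where 3: "steps (c2 b) s2 (poly p2 (sz x)) s3"
        "s3 b = enc (g x)" "\<forall>i<b. s3 i = s2 i" by blast
      have "eval_expr (Var (b+1)) s2 = Num 0" using 2(2) False by simp
      from steps_mono[OF steps_CondFalse[OF this 3(1), where c = "c1 b"]] show ?thesis
        using 2(2) 3 False by (intro exI[of _ s3]) simp
    qed
    then obtain s3 where 3: "steps (Cond (Var (b+1)) (c1 b) (c2 b)) s2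
        (1 + sz (d x) + (poly p1 (sz x) + poly p2 (sz x))) s3"
        "s3 b = enc (if d x then f x else g x)" "\<forall>i<b. s3 i = s2 i" by blast
    have "steps (?c b) s (poly ?p (sz x)) s3"
      by (rule steps_mono[OF steps_Seq[OF 1 steps_Seq[OF 2(1) 3(1)]]])
        (use p[of x] in simp)
    then show "\<exists>s'. steps (?c b) s (poly ?p (sz x)) s' \<and>
        s' b = enc (if d x then f x else g x) \<and> (\<forall>i<b. s' i = s i)"
      using 3(2,3) 2(3) by (intro exI[of _ s3]) simp
  qed
qed

lemma pt_fst [pt_rule]:
  fixes f :: "'a::enc \<Rightarrow> 'b::enc \<times> 'c::enc"
  assumes "pt f" shows "pt (\<lambda>x. fst (f x))"
proof -
  have "pt (\<lambda>x :: 'b \<times> 'c. fst x)"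
    by (rule pt_by_expr[where e = "\<lambda>b. Unop Left (Var b)" and p = "[:0, 2:]"]) (auto simp: sz_prod)
  from pt_comp[OF this assms] show ?thesis .
qed

lemma pt_snd [pt_rule]:
  fixes f :: "'a::enc \<Rightarrow> 'b::enc \<times> 'c::enc"
  assumes "pt f" shows "pt (\<lambda>x. snd (f x))"
proof -
  have "pt (\<lambda>x :: 'b \<times> 'c. snd x)"
    by (rule pt_by_expr[where e = "\<lambda>b. Unop Right (Var b)" and p = "[:0, 2:]"]) (auto simp: sz_prod)
  from pt_comp[OF this assms] show ?thesis .
qed

lemma pt_comp2:
  assumes "pt (\<lambda>z. g (fst z) (snd z))" "pt f" "pt f'"
  shows "pt (\<lambda>x. g (f x) (f' x))"
  using pt_comp[OF assms(1) pt_Pair[OF assms(2,3)]] by simp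

lemma pt_comp3:
  assumes "pt (\<lambda>z. g (fst z) (fst (snd z)) (snd (snd z)))" "pt f" "pt f'" "pt f''"
  shows "pt (\<lambda>x. g (f x) (f' x) (f'' x))"
  using pt_comp[OF assms(1) pt_Pair[OF assms(2) pt_Pair[OF assms(3,4)]]] by simp

lemma pt_comp4:
  assumes "pt (\<lambda>z. g (fst z) (fst (snd z)) (fst (snd (snd z))) (snd (snd (snd z))))"
    "pt f1" "pt f2" "pt f3" "pt f4"
  shows "pt (\<lambda>x. g (f1 x) (f2 x) (f3 x) (f4 x))"
  using pt_comp[OF assms(1) pt_Pair[OF assms(2) pt_Pair[OF assms(3) pt_Pair[OF assms(4,5)]]]] by simp

lemma pt_binop:
  fixes g :: "'a::enc \<Rightarrow> 'b::enc \<Rightarrow> 'c::enc"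
  assumes "\<And>x y. apply_binop \<omega> (enc x) (enc y) = enc (g x y)"
    "\<And>x y. sz (g x y) \<le> sz x + sz y" "pt f" "pt f'"
  shows "pt (\<lambda>x. g (f x) (f' x))"
proof (rule pt_comp2[OF _ assms(3,4)])
  show "pt (\<lambda>z. g (fst z) (snd z))"
  proof (rule pt_by_expr[where e = "\<lambda>b. Binop \<omega> (Unop Left (Var b)) (Unop Right (Var b))"
          and p = "[:0, 4:]"])
    fix b and x :: "'a \<times> 'b" and s :: store assume "s b = enc x"
    then show "expr_cost (Binop \<omega> (Unop Left (Var b)) (Unop Right (Var b))) s \<le> poly [:0, 4:] (sz x)"
      using assms(2)[of "fst x" "snd x"] by (simp add: assms(1) sz_prod)
  qed (simp add: assms(1))
qed

lemma pt_arith [pt_rule]: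
  fixes f g :: "'a::enc \<Rightarrow> nat"
  assumes "pt f" "pt g"
  shows "pt (\<lambda>x. f x + g x)" "pt (\<lambda>x. f x - g x)" "pt (\<lambda>x. f x * g x)" "pt (\<lambda>x. f x div g x)"
    "pt (\<lambda>x. f x < g x)"
proof -
  note le = floorlog2_add_le floorlog2_mult_le floorlog2_mono[OF diff_le_self] floorlog2_mono[OF div_le_dividend]
  show "pt (\<lambda>x. f x + g x)"
    by (rule pt_binop[OF _ _ assms, where \<omega> = Add]) (auto intro: le_SucI le)
  show "pt (\<lambda>x. f x - g x)"
    by (rule pt_binop[OF _ _ assms, where \<omega> = Sub]) (auto intro: trans_le_add1 le_SucI le)
  show "pt (\<lambda>x. f x * g x)"
    by (rule pt_binop[OF _ _ assms, where \<omega> = Mul]) (auto intro: le_SucI le)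
  show "pt (\<lambda>x. f x div g x)"
    by (rule pt_binop[OF _ _ assms, where \<omega> = Div]) (auto intro: trans_le_add1 le_SucI le)
  show "pt (\<lambda>x. f x < g x)"
    by (rule pt_binop[OF _ _ assms, where \<omega> = Less]) (auto simp: floorlog_def)
qed

text \<open>Codes are injective, so comparing them decides equality on every encodable type.\<close>

lemma pt_eq [pt_rule]:
  assumes "pt f" "pt g"
  shows "pt (\<lambda>x. f x = g x)"
proof (rule pt_binop[OF _ _ assms, where \<omega> = Eq])
  show "sz (x = y) \<le> sz x + sz y" for x y
    using vsize_pos[of "enc x"] vsize_pos[of "enc y"] by (simp add: floorlog_def)
qed (simp add: enc_inject)

lemma pt_logic [pt_rule]:
  assumes "pt P" "pt Q"
  shows "pt (\<lambda>x. P x \<and> Q x)" "pt (\<lambda>x. P x \<or> Q x)"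
proof -
  have "pt (\<lambda>x. if P x then Q x else False)" "pt (\<lambda>x. if P x then True else Q x)"
    by (intro pt_rule assms)+
  moreover have "(\<lambda>x. if P x then Q x else False) = (\<lambda>x. P x \<and> Q x)"
    "(\<lambda>x. if P x then True else Q x) = (\<lambda>x. P x \<or> Q x)" by auto
  ultimately show "pt (\<lambda>x. P x \<and> Q x)" "pt (\<lambda>x. P x \<or> Q x)" by simp_all
qed

lemma pt_Not [pt_rule]:
  assumes "pt P"
  shows "pt (\<lambda>x. \<not> P x)"
proof -
  have "pt (\<lambda>x. if P x then False else True)" by (intro pt_rule assms)
  moreover have "(\<lambda>x. if P x then False else True) = (\<lambda>x. \<not> P x)" by auto
  ultimately show ?thesis by simp
qed

lemma pt_le [pt_rule]:
  fixes f g :: "'a::enc \<Rightarrow> nat"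
  assumes "pt f" "pt g"
  shows "pt (\<lambda>x. f x \<le> g x)"
  unfolding not_less[symmetric] by (intro pt_rule assms)

lemma pt_Let [pt_rule]:
  assumes "pt (\<lambda>z. g (fst z) (snd z))" "pt f"
  shows "pt (\<lambda>x. let y = f x in g x y)"
  using pt_comp2[OF assms(1) pt_id assms(2)] by simp

lemma pt_Cons [pt_rule]:
  fixes f :: "'a::enc \<Rightarrow> 'b::enc"
  assumes "pt f" "pt g"
  shows "pt (\<lambda>x. f x # g x)"
proof (rule pt_comp2[OF _ assms])
  show "pt (\<lambda>z :: 'b \<times> 'b list. fst z # snd z)"
    by (rule pt_by_expr[where e = Var and p = "[:0, 1:]"]) (auto simp: enc_prod_def)
qed

lemma pt_action [pt_rule]:
  assumes "pt f"
  shows "pt (\<lambda>x. Move (f x))" "pt (\<lambda>x. Pickup (f x))" "pt (\<lambda>x. Drop (f x))"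
proof -
  show "pt (\<lambda>x. Move (f x))"
    by (rule pt_comp[OF _ assms], rule pt_by_expr[where e = "\<lambda>b. Binop MkPair (Const 0) (Var b)" and p = "[:5, 2:]"]) auto
  show "pt (\<lambda>x. Pickup (f x))"
    by (rule pt_comp[OF _ assms], rule pt_by_expr[where e = "\<lambda>b. Binop MkPair (Const 1) (Var b)" and p = "[:5, 2:]"])
      (auto simp: floorlog_def)
  show "pt (\<lambda>x. Drop (f x))"
    by (rule pt_comp[OF _ assms], rule pt_by_expr[where e = "\<lambda>b. Binop MkPair (Const 2) (Var b)" and p = "[:8, 2:]"])
      (auto simp: floorlog_def)
qed

section \<open>Iteration and recursion on lists\<close>

lemma pt_fold_bounded:
  fixes l :: "'x::enc \<Rightarrow> 'e::enc list" and a :: "'x \<Rightarrow> 'a::enc" and q :: "nat poly"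
  assumes l: "pt l" and a: "pt a"
    and h: "pt (\<lambda>z. h (fst z) (fst (snd z)) (snd (snd z)))"
    and bound: "\<And>x ys zs. l x = ys @ zs \<Longrightarrow> sz (fold (h x) ys (a x)) \<le> poly q (sz x)"
  shows "pt (\<lambda>x. fold (h x) (l x) (a x))"
proof -
  obtain pl cl where
    pl: "\<And>x. sz (l x) \<le> poly pl (sz x)" and
    cl: "computes cl pl l"
    by (rule ptE[OF l]) (rule that)
  obtain pa ca where "\<And>x. sz (a x) \<le> poly pa (sz x)" and
    ca: "computes ca pa a"
    by (rule ptE[OF a]) (rule that)
  obtain ph ch where "\<And>z. sz (h (fst z) (fst (snd z)) (snd (snd z))) \<le> poly ph (sz z)" and
    ch: "computes ch ph (\<lambda>z. h (fst z) (fst (snd z)) (snd (snd z)))"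
    by (rule ptE[OF h]) (rule that)
  \<comment> \<open>Register \<open>b\<close> keeps the parameter, \<open>b + 1\<close> the rest of
    the list, \<open>b + 2\<close> the accumulator, and \<open>b + 3\<close> takes the triple on
    which the step is run.\<close>
  let ?body = "\<lambda>b. Seq (Assign (b+3) (Binop MkPair (Var b) (Binop MkPair (Unop Left (Var (b+1))) (Var (b+2)))))
    (Seq (ch (b+3)) (Seq (Assign (b+2) (Var (b+3))) (Assign (b+1) (Unop Right (Var (b+1))))))"
  \<comment> \<open>The code of a list is a pair iff the list is nonempty.\<close>
  let ?loop = "\<lambda>b. While (Unop IsPair (Var (b+1))) (?body b)"
  let ?c = "\<lambda>b. Seq (Assign (b+1) (Var b)) (Seq (cl (b+1)) (Seq (Assign (b+2) (Var b)) (Seq (ca (b+2))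
    (Seq (?loop b) (Assign b (Var (b+2)))))))"
  define N where "N = (\<lambda>x :: 'x. sz x + poly pl (sz x) + poly q (sz x))"
  \<comment> \<open>\<open>B x\<close> pays for one iteration: the step on a triple of size at most
    \<open>N x + 2\<close>, the copying between registers, and the guard.\<close>
  define B where "B = (\<lambda>x. poly ph (N x + 2) + 20 * N x + 30)"
  have loop: "\<exists>s'. steps (?loop b) s (B x * (length zs + 1)) s' \<and>
      s' (b+2) = enc (fold (h x) (l x) (a x)) \<and> (\<forall>i<b. s' i = s i)"
    if "l x = ys @ zs" "s b = enc x" "s (b+1) = enc zs" "s (b+2) = enc (fold (h x) ys (a x))"
    for b x s ys zs
    using that
  proof (induction zs arbitrary: ys s)
    case Nil
    have "steps (?loop b) s (1 + expr_cost (Unop IsPair (Var (b+1))) s) s"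
      by (rule steps_WhileFalse) (use Nil in simp)
    then have "steps (?loop b) s (B x * (length [] + 1)) s"
      by (rule steps_mono) (use Nil in \<open>simp add: B_def\<close>)
    then show ?case using Nil by auto
  next
    case (Cons z zs)
    let ?A = "fold (h x) ys (a x)" and ?A' = "h x z (fold (h x) ys (a x))"
    have A: "sz ?A \<le> poly q (sz x)" by (rule bound[OF Cons.prems(1)])
    have lx: "l x = (ys @ [z]) @ zs" using Cons.prems(1) by simp
    have A': "sz ?A' \<le> poly q (sz x)" using bound[OF lx] by simp
    have zs: "1 + sz z + sz zs \<le> poly pl (sz x)"
      using pl[of x] sz_append[of ys "z # zs"] vsize_pos[of "enc ys"] Cons.prems(1)
      by simp
    let ?s1 = "s(b+3 := enc (x, z, ?A))"
    have 1: "steps (Assign (b+3) (Binop MkPair (Var b) (Binop MkPair (Unop Left (Var (b+1))) (Var (b+2))))) s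
        (10 * N x + 10) ?s1"
      using Cons.prems A zs by (intro steps_Assign_le) (auto simp: N_def)
    have "?s1 (b+3) = enc (x, z, ?A)" by simp
    from computesD[OF ch, of ?s1 "b+3" "(x, z, ?A)", OF this] obtain s2
      where 2: "steps (ch (b+3)) ?s1 (poly ph (sz (x, z, ?A))) s2"
      "s2 (b+3) = enc ?A'" "\<forall>i<b+3. s2 i = ?s1 i" by auto
    have "sz (x, z, ?A) \<le> N x + 2" using A zs by (simp add: N_def)
    then have le2: "poly ph (sz (x, z, ?A)) \<le> poly ph (N x + 2)" by (rule poly_nat_mono)
    let ?s3 = "s2(b+2 := enc ?A')"
    have 3: "steps (Assign (b+2) (Var (b+3))) s2 (1 + N x) ?s3"
      using 2(2) A' by (intro steps_Assign_le) (auto simp: N_def)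
    let ?s4 = "?s3(b+1 := enc zs)"
    have s3: "?s3 (b+1) = enc (z # zs)" using 2(3) Cons.prems(3) by simp
    have 4: "steps (Assign (b+1) (Unop Right (Var (b+1)))) ?s3 (1 + 2 * N x) ?s4"
      using s3 zs by (intro steps_Assign_le) (auto simp: N_def)
    have body: "steps (?body b) s (10 * N x + 10 + (poly ph (N x + 2) + (1 + N x + (1 + 2 * N x)))) ?s4"
      using steps_Seq[OF 1 steps_Seq[OF steps_mono[OF 2(1) le2] steps_Seq[OF 3 4]]] .
    have "\<exists>s'. steps (?loop b) ?s4 (B x * (length zs + 1)) s' \<and>
      s' (b+2) = enc (fold (h x) (l x) (a x)) \<and> (\<forall>i<b. s' i = ?s4 i)"
    proof (rule Cons.IH[OF lx])
      show "?s4 b = enc x" using 2(3) Cons.prems(2) by simp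
    qed simp_all
    then obtain s' where s': "steps (?loop b) ?s4 (B x * (length zs + 1)) s'"
      "s' (b+2) = enc (fold (h x) (l x) (a x))" "\<forall>i<b. s' i = ?s4 i" by blast
    have ne: "eval_expr (Unop IsPair (Var (b+1))) s \<noteq> Num 0" using Cons.prems(3) by simp
    have "steps (?loop b) s (B x * (length (z # zs) + 1)) s'"
      by (rule steps_mono[OF steps_WhileTrue[OF ne body s'(1)]])
        (use Cons.prems zs in \<open>simp add: B_def N_def floorlog_def\<close>)
    then show ?case using s'(2,3) 2(3) by auto
  qed
  let ?N = "[:0, 1:] + pl + q"
  let ?B = "pcompose ph (?N + 2) + 20 * ?N + 30"
  let ?T = "[:2, 2:] + pl + pa + ?B * (pl + 1) + (1 + q)"
  show ?thesis
  proof (rule ptI[where p = q and p' = ?T and c = ?c])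
    show "sz (fold (h x) (l x) (a x)) \<le> poly q (sz x)" for x
      by (rule bound) simp
  next
    fix b and x :: 'x and s :: store assume s: "s b = enc x"
    let ?s1 = "s(b+1 := enc x)"
    have 1: "steps (Assign (b+1) (Var b)) s (1 + sz x) ?s1"
      using steps_Assign[of "b+1" "Var b" s] s by simp
    have "?s1 (b+1) = enc x" by simp
    from computesD[OF cl, of ?s1 "b+1" x, OF this] obtain s2 where 2: "steps (cl (b+1)) ?s1 (poly pl (sz x)) s2"
      "s2 (b+1) = enc (l x)" "\<forall>i<b+1. s2 i = ?s1 i" by blast
    have s2b: "s2 b = enc x" using 2(3) s by simp
    let ?s3 = "s2(b+2 := enc x)"
    have 3: "steps (Assign (b+2) (Var b)) s2 (1 + sz x) ?s3"
      using steps_Assign[of "b+2" "Var b" s2] s2b by simp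
    have "?s3 (b+2) = enc x" by simp
    from computesD[OF ca, of ?s3 "b+2" x, OF this] obtain s4 where 4: "steps (ca (b+2)) ?s3 (poly pa (sz x)) s4"
      "s4 (b+2) = enc (a x)" "\<forall>i<b+2. s4 i = ?s3 i" by blast
    have s4: "s4 (b+1) = enc (l x)" "s4 b = enc x" using 4(3) 2(2,3) s by simp_all
    from loop[of x "[]" "l x" s4 b] s4 4(2) obtain s5 where
      5: "steps (?loop b) s4 (B x * (length (l x) + 1)) s5"
        "s5 (b+2) = enc (fold (h x) (l x) (a x))" "\<forall>i<b. s5 i = s4 i" by auto
    let ?s6 = "s5(b := enc (fold (h x) (l x) (a x)))"
    have 6: "steps (Assign b (Var (b+2))) s5 (1 + poly q (sz x)) ?s6"
      using 5(2) bound[of x "l x" "[]"] by (intro steps_Assign_le) auto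
    have "B x * (length (l x) + 1) \<le> B x * (poly pl (sz x) + 1)"
      using length_less_sz[of "l x"] pl[of x] by simp
    moreover have "poly ?B (sz x) = B x"
      by (simp add: B_def N_def poly_pcompose add.assoc)
    ultimately have "steps (?c b) s (poly ?T (sz x)) ?s6"
      by (intro steps_mono[OF steps_Seq[OF 1 steps_Seq[OF 2(1) steps_Seq[OF 3 steps_Seq[OF 4(1)
            steps_Seq[OF 5(1) 6]]]]]]) simp
    then show "\<exists>s'. steps (?c b) s (poly ?T (sz x)) s' \<and>
        s' b = enc (fold (h x) (l x) (a x)) \<and> (\<forall>i<b. s' i = s i)"
      using 5(3) 4(3) 2(3) by (intro exI[of _ ?s6]) simp
  qed
qed

text \<open>A step that squares the size of its accumulator is polynomial, but its iterates are not.
  Here the accumulator may grow only by an amount that depends on the other arguments, so the growth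
  over a whole list adds up to a polynomial.\<close>

definition additive :: "('a::enc \<Rightarrow> 'b::enc \<Rightarrow> 'b) \<Rightarrow> bool" where
  "additive h \<longleftrightarrow> (\<exists>q :: nat poly. \<forall>z r. sz (h z r) \<le> sz r + poly q (sz z))"

lemma pt_fold:
  fixes l :: "'x::enc \<Rightarrow> 'e::enc list" and a :: "'x \<Rightarrow> 'a::enc"
  assumes l: "pt l" and a: "pt a"
    and h: "pt (\<lambda>z. h (fst z) (fst (snd z)) (snd (snd z)))"
    and add: "additive (\<lambda>z. h (fst z) (snd z))"
  shows "pt (\<lambda>x. fold (h x) (l x) (a x))"
proof -
  from ptD_size[OF l] obtain pl where pl: "\<And>x. sz (l x) \<le> poly pl (sz x)" by blast
  from ptD_size[OF a] obtain pa where pa: "\<And>x. sz (a x) \<le> poly pa (sz x)" by blast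
  from add obtain q where q: "\<And>x y r. sz (h x y r) \<le> sz r + poly q (sz (x, y))"
    unfolding additive_def by (metis fst_conv snd_conv)
  show ?thesis
  proof (rule pt_fold_bounded[OF l a h])
    fix x ys zs assume "l x = ys @ zs"
    then have "sz (fold (h x) ys (a x)) \<le> sz (a x) + length ys * poly q (1 + sz x + sz (l x))"
    proof (induction ys arbitrary: zs rule: rev_induct)
      case (snoc y ys)
      have "sz y < sz (l x)" using snoc.prems by (intro sz_mem_less) simp
      then have "poly q (sz (x, y)) \<le> poly q (1 + sz x + sz (l x))"
        by (intro poly_nat_mono) simp
      then show ?case using snoc.IH[of "y # zs"] snoc.prems q[of x y "fold (h x) ys (a x)"] by simp
    qed simp
    also have "\<dots> \<le> poly pa (sz x) + poly pl (sz x) * poly q (1 + sz x + poly pl (sz x))"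
    proof (intro add_mono mult_mono poly_nat_mono order_refl)
      show "length ys \<le> poly pl (sz x)"
        using length_less_sz[of "l x"] pl[of x] \<open>l x = ys @ zs\<close> by simp
    qed (use pa pl in auto)
    also have "\<dots> = poly (pa + pl * pcompose q (1 + [:0, 1:] + pl)) (sz x)"
      by (simp add: poly_pcompose)
    finally show "sz (fold (h x) ys (a x)) \<le> \<dots>" .
  qed
qed

lemma additive_by_pt: "pt f \<Longrightarrow> additive (\<lambda>z r. f z)"
  unfolding additive_def using ptD_size[of f] trans_le_add2 by blast

lemma additive_self: "additive (\<lambda>z r. r)"
  unfolding additive_def by auto

lemma additive_if:
  assumes "additive f" "additive g"
  shows "additive (\<lambda>z r. if c z r then f z r else g z r)"
proof -
  from assms obtain p q where pq: "\<And>z r. sz (f z r) \<le> sz r + poly p (sz z)"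
    "\<And>z r. sz (g z r) \<le> sz r + poly q (sz z)" unfolding additive_def by blast
  have "sz (if c z r then f z r else g z r) \<le> sz r + poly (p + q) (sz z)" for z r
    using pq(1)[of z r] pq(2)[of z r] by simp
  then show ?thesis unfolding additive_def by blast
qed

lemma additive_plus:
  fixes f :: "'a::enc \<Rightarrow> nat" and g :: "'a \<Rightarrow> nat \<Rightarrow> nat"
  assumes "pt f" "additive g"
  shows "additive (\<lambda>z r. f z + g z r)"
proof -
  from assms ptD_size obtain p q where pq: "\<And>z. sz (f z) \<le> poly p (sz z)"
    "\<And>z r. sz (g z r) \<le> sz r + poly q (sz z)" unfolding additive_def by blast
  have "sz (f z + g z r) \<le> sz r + poly (p + q) (sz z)" for z r
    using floorlog2_add_le[of "f z" "g z r"] pq(1)[of z] pq(2)[of z r] by simp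
  then show ?thesis unfolding additive_def by blast
qed

text \<open>In binary, multiplication by a factor that does not depend on the accumulator only adds
  the bit length of that factor.\<close>

lemma additive_times:
  fixes f :: "'a::enc \<Rightarrow> nat" and g :: "'a \<Rightarrow> nat \<Rightarrow> nat"
  assumes "pt f" "additive g"
  shows "additive (\<lambda>z r. f z * g z r)"
proof -
  from assms ptD_size obtain p q where pq: "\<And>z. sz (f z) \<le> poly p (sz z)"
    "\<And>z r. sz (g z r) \<le> sz r + poly q (sz z)" unfolding additive_def by blast
  have "sz (f z * g z r) \<le> sz r + poly (p + q) (sz z)" for z r
    using floorlog2_mult_le[of "f z" "g z r"] pq(1)[of z] pq(2)[of z r] by simp
  then show ?thesis unfolding additive_def by blast
qed

lemma additive_Cons:
  assumes "pt f" "additive g"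
  shows "additive (\<lambda>z r. f z # g z r)"
proof -
  from assms ptD_size obtain p q where pq: "\<And>z. sz (f z) \<le> poly p (sz z)"
    "\<And>z r. sz (g z r) \<le> sz r + poly q (sz z)" unfolding additive_def by blast
  have "sz (f z # g z r) \<le> sz r + poly (1 + p + q) (sz z)" for z r
    using pq(1)[of z] pq(2)[of z r] by simp
  then show ?thesis unfolding additive_def by blast
qed

lemma additive_append:
  assumes "pt f" "additive g"
  shows "additive (\<lambda>z r. f z @ g z r)" "additive (\<lambda>z r. g z r @ f z)"
proof -
  from assms ptD_size obtain p q where pq: "\<And>z. sz (f z) \<le> poly p (sz z)"
    "\<And>z r. sz (g z r) \<le> sz r + poly q (sz z)" unfolding additive_def by blast
  have "sz (f z @ g z r) \<le> sz r + poly (1 + p + q) (sz z)"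
    "sz (g z r @ f z) \<le> sz r + poly (1 + p + q) (sz z)" for z r
    using pq(1)[of z] pq(2)[of z r] sz_append[of "f z" "g z r"] sz_append[of "g z r" "f z"] by simp_all
  then show "additive (\<lambda>z r. f z @ g z r)" "additive (\<lambda>z r. g z r @ f z)"
    unfolding additive_def by blast+
qed

lemmas additive_rule = additive_self additive_if additive_plus additive_times
  additive_Cons additive_append

lemma pt_rev [pt_rule]:
  fixes l :: "'x::enc \<Rightarrow> 'e::enc list"
  assumes "pt l" shows "pt (\<lambda>x. rev (l x))"
proof -
  have "pt (\<lambda>x. fold (\<lambda>y r. y # r) (l x) [])"
    by (rule pt_fold[OF assms]) (intro pt_rule additive_rule)+
  moreover have "fold (\<lambda>y r. y # r) ys [] = rev ys" for ys :: "'e list"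
    by (simp add: rev_conv_fold)
  ultimately show ?thesis by simp
qed

text \<open>Primitive recursion works from the right end, so it is a \<open>fold\<close> over the
  reversed list; the accumulator carries the suffix treated so far together with its value, because
  the step also takes the tail.\<close>

lemma pt_rec_bounded:
  fixes l :: "'x::enc \<Rightarrow> 'e::enc list" and a :: "'x \<Rightarrow> 'a::enc" and q :: "nat poly"
  assumes l: "pt l" and a: "pt a"
    and h: "pt (\<lambda>z. h (fst z) (fst (snd z)) (fst (snd (snd z))) (snd (snd (snd z))))"
    and bound: "\<And>x ys zs. l x = ys @ zs \<Longrightarrow> sz (rec_list (a x) (h x) zs) \<le> poly q (sz x)"
  shows "pt (\<lambda>x. rec_list (a x) (h x) (l x))"
proof -
  define g where "g = (\<lambda>x y (p :: 'e list \<times> 'a). (y # fst p, h x y (fst p) (snd p)))"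
  have g: "fold (g x) (rev zs) ([], a x) = (zs, rec_list (a x) (h x) zs)" for x zs
    by (induction zs) (simp_all add: g_def)
  from ptD_size[OF l] obtain pl where pl: "\<And>x. sz (l x) \<le> poly pl (sz x)" by blast
  have "pt (\<lambda>x. fold (g x) (rev (l x)) ([], a x))"
  proof (rule pt_fold_bounded[where q = "1 + pl + q"])
    show "pt (\<lambda>x. rev (l x))" "pt (\<lambda>x. ([] :: 'e list, a x))" by (intro pt_rule l a)+
    have "pt (\<lambda>z. h (fst z) (fst (snd z)) (fst (snd (snd z))) (snd (snd (snd z))))" by (rule h)
    then show "pt (\<lambda>z. g (fst z) (fst (snd z)) (snd (snd z)))"
      unfolding g_def by (intro pt_rule)
    fix x ys zs assume e: "rev (l x) = ys @ zs"
    then have lx: "l x = rev zs @ rev ys" by (metis rev_append rev_rev_ident)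
    have "sz (rev ys) \<le> sz (l x)"
      using sz_append[of "rev zs" "rev ys"] vsize_pos[of "enc (rev zs)"] by (simp add: lx)
    moreover have "fold (g x) ys ([], a x) = (rev ys, rec_list (a x) (h x) (rev ys))"
      using g[of x "rev ys"] by simp
    ultimately show "sz (fold (g x) ys ([], a x)) \<le> poly (1 + pl + q) (sz x)"
      using pl[of x] bound[OF lx] by simp
  qed
  then have "pt (\<lambda>x. snd (fold (g x) (rev (l x)) ([], a x)))" by (rule pt_snd)
  then show ?thesis by (simp add: g)
qed

text \<open>Each step adds at most a fixed polynomial, as head and tail are no larger than the whole
  list, and there are at most \<open>length (l x)\<close> steps.\<close>

lemma pt_rec:
  fixes l :: "'x::enc \<Rightarrow> 'e::enc list" and a :: "'x \<Rightarrow> 'a::enc"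
  assumes l: "pt l" and a: "pt a"
    and h: "pt (\<lambda>z. h (fst z) (fst (snd z)) (fst (snd (snd z))) (snd (snd (snd z))))"
    and add: "additive (\<lambda>z. h (fst z) (fst (snd z)) (snd (snd z)))"
  shows "pt (\<lambda>x. rec_list (a x) (h x) (l x))"
proof -
  from ptD_size[OF l] obtain pl where pl: "\<And>x. sz (l x) \<le> poly pl (sz x)" by blast
  from ptD_size[OF a] obtain pa where pa: "\<And>x. sz (a x) \<le> poly pa (sz x)" by blast
  from add obtain q where q: "\<And>x y ys r. sz (h x y ys r) \<le> sz r + poly q (sz (x, y, ys))"
    unfolding additive_def by (metis fst_conv snd_conv)
  show ?thesis
  proof (rule pt_rec_bounded[OF l a h])
    fix x ys zs assume "l x = ys @ zs"
    then have "sz (rec_list (a x) (h x) zs) \<le> sz (a x) + length zs * poly q (2 + sz x + sz (l x))"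
    proof (induction zs arbitrary: ys)
      case (Cons z zs)
      have "sz (z # zs) \<le> sz (l x)"
        using Cons.prems sz_append[of ys "z # zs"] vsize_pos[of "enc ys"] by simp
      then have "poly q (sz (x, z, zs)) \<le> poly q (2 + sz x + sz (l x))"
        by (intro poly_nat_mono) simp
      then show ?case using Cons.IH[of "ys @ [z]"] Cons.prems q[of x z zs "rec_list (a x) (h x) zs"] by simp
    qed simp
    also have "\<dots> \<le> poly pa (sz x) + poly pl (sz x) * poly q (2 + sz x + poly pl (sz x))"
    proof (intro add_mono mult_mono poly_nat_mono order_refl)
      show "length zs \<le> poly pl (sz x)"
        using length_less_sz[of "l x"] pl[of x] \<open>l x = ys @ zs\<close> by simp
    qed (use pa pl in auto)
    also have "\<dots> = poly (pa + pl * pcompose q (2 + [:0, 1:] + pl)) (sz x)"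
      by (simp add: poly_pcompose)
    finally show "sz (rec_list (a x) (h x) zs) \<le> \<dots>" .
  qed
qed

section \<open>List functions by primitive recursion\<close>

lemma pt_case_list [pt_rule]:
  fixes l :: "'x::enc \<Rightarrow> 'e::enc list" and a :: "'x \<Rightarrow> 'a::enc"
  assumes "pt l" "pt a" "pt (\<lambda>z. h (fst z) (fst (snd z)) (snd (snd z)))"
  shows "pt (\<lambda>x. case l x of [] \<Rightarrow> a x | y # ys \<Rightarrow> h x y ys)"
proof -
  have *: "pt (\<lambda>z. h (fst z) (fst (snd z)) (fst (snd (snd z))))"
    by (rule pt_comp3[OF assms(3)]) (intro pt_rule)+
  have "pt (\<lambda>x. rec_list (a x) (\<lambda>y ys r. h x y ys) (l x))"
    by (rule pt_rec[OF assms(1,2) *])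
      (rule additive_by_pt[OF assms(3)])
  moreover have "rec_list (a x) (\<lambda>y ys r. h x y ys) (l x) = (case l x of [] \<Rightarrow> a x | y # ys \<Rightarrow> h x y ys)" for x
    by (cases "l x") auto
  ultimately show ?thesis by (simp only:)
qed

lemma pt_append [pt_rule]:
  fixes l :: "'x::enc \<Rightarrow> 'e::enc list"
  assumes "pt l" "pt k" shows "pt (\<lambda>x. l x @ k x)"
proof -
  have "pt (\<lambda>x. rec_list (k x) (\<lambda>y ys r. y # r) (l x))"
    by (rule pt_rec[OF assms]) (intro pt_rule additive_rule)+
  moreover have "rec_list zs (\<lambda>y ys r. y # r) ys = ys @ zs" for ys zs :: "'e list"
    by (induction ys) auto
  ultimately show ?thesis by simp
qed

lemma pt_map [pt_rule]:
  fixes l :: "'x::enc \<Rightarrow> 'e::enc list" and h :: "'x \<Rightarrow> 'e \<Rightarrow> 'b::enc"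
  assumes "pt l" "pt (\<lambda>z. h (fst z) (snd z))"
  shows "pt (\<lambda>x. map (h x) (l x))"
proof -
  have *: "pt (\<lambda>z. h (fst z) (fst (snd z)))"
    by (rule pt_comp2[OF assms(2)]) (intro pt_rule)+
  have "pt (\<lambda>x. rec_list [] (\<lambda>y ys r. h x y # r) (l x))"
    by (rule pt_rec[OF assms(1)]; intro pt_rule additive_rule pt_comp2[OF assms(2)])
  moreover have "rec_list [] (\<lambda>y ys r. g y # r) ys = map g ys" for g :: "'e \<Rightarrow> 'b" and ys
    by (induction ys) auto
  ultimately show ?thesis by simp
qed

lemma pt_concat [pt_rule]:
  fixes l :: "'x::enc \<Rightarrow> 'e::enc list list"
  assumes "pt l" shows "pt (\<lambda>x. concat (l x))"
proof -
  have "pt (\<lambda>x. rec_list [] (\<lambda>y ys r. y @ r) (l x))"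
    by (rule pt_rec[OF assms]) (intro pt_rule additive_rule)+
  moreover have "rec_list [] (\<lambda>y ys r. y @ r) ys = concat ys" for ys :: "'e list list"
    by (induction ys) auto
  ultimately show ?thesis by simp
qed

lemma pt_filter [pt_rule]:
  fixes l :: "'x::enc \<Rightarrow> 'e::enc list"
  assumes "pt l" "pt (\<lambda>z. P (fst z) (snd z))"
  shows "pt (\<lambda>x. filter (P x) (l x))"
proof -
  have "pt (\<lambda>x. rec_list [] (\<lambda>y ys r. if P x y then y # r else r) (l x))"
    by (rule pt_rec[OF assms(1)]; intro pt_rule additive_rule pt_comp2[OF assms(2)])
  moreover have "rec_list [] (\<lambda>y ys r. if Q y then y # r else r) ys = filter Q ys" for Q and ys :: "'e list"
    by (induction ys) auto
  ultimately show ?thesis by simp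
qed

lemma pt_Bex [pt_rule]:
  fixes l :: "'x::enc \<Rightarrow> 'e::enc list"
  assumes "pt l" "pt (\<lambda>z. P (fst z) (snd z))"
  shows "pt (\<lambda>x. \<exists>y\<in>set (l x). P x y)"
proof -
  have "pt (\<lambda>x. filter (P x) (l x) \<noteq> [])" by (intro pt_rule assms)
  moreover have "filter Q ys \<noteq> [] \<longleftrightarrow> (\<exists>y\<in>set ys. Q y)" for Q and ys :: "'e list"
    by (auto simp: filter_empty_conv)
  ultimately show ?thesis by simp
qed

lemma pt_member [pt_rule]:
  assumes "pt f" "pt l" shows "pt (\<lambda>x. f x \<in> set (l x))"
proof -
  have "pt (\<lambda>x. \<exists>y\<in>set (l x). f x = y)"
    by (intro pt_rule assms(2) pt_comp[OF assms(1)])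
  then show ?thesis by simp
qed

lemma pt_remdups [pt_rule]:
  fixes l :: "'x::enc \<Rightarrow> 'e::enc list"
  assumes "pt l" shows "pt (\<lambda>x. remdups (l x))"
proof -
  have "pt (\<lambda>x. rec_list [] (\<lambda>y ys r. if y \<in> set ys then r else y # r) (l x))"
    by (rule pt_rec[OF assms]) (intro pt_rule additive_rule)+
  moreover have "rec_list [] (\<lambda>y ys r. if y \<in> set ys then r else y # r) ys = remdups ys" for ys :: "'e list"
    by (induction ys) auto
  ultimately show ?thesis by simp
qed

lemma pt_length [pt_rule]:
  fixes l :: "'x::enc \<Rightarrow> 'e::enc list"
  assumes "pt l" shows "pt (\<lambda>x. length (l x))"
proof -
  have "pt (\<lambda>x. rec_list (0::nat) (\<lambda>y ys r. 1 + r) (l x))"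
    by (rule pt_rec[OF assms]) (intro pt_rule additive_rule)+
  moreover have "rec_list (0::nat) (\<lambda>y ys r. 1 + r) ys = length ys" for ys :: "'e list"
    by (induction ys) auto
  ultimately show ?thesis by simp
qed

text \<open>For positive \<open>d\<close> this is the largest power of two up to \<open>d\<close>;
  truncated subtraction makes it 1 at 0.\<close>

definition pow2_below :: "nat \<Rightarrow> nat" where
  "pow2_below d = 2 ^ (floorlog 2 d - 1)"

lemma power_le_iff_floorlog2: "2 ^ i \<le> d \<longleftrightarrow> i < floorlog 2 d"
  using floorlog2_le_iff[of d i] by linarith

lemma pow2_below_bounds:
  assumes "0 < d"
  shows "pow2_below d \<le> d" "d < 2 * pow2_below d"
proof -
  have "0 < floorlog 2 d" using power_le_iff_floorlog2[of 0 d] assms by simp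
  then obtain k where k: "floorlog 2 d = Suc k" by (cases "floorlog 2 d") auto
  show "pow2_below d \<le> d" "d < 2 * pow2_below d"
    using power_le_iff_floorlog2[of k d] power_le_iff_floorlog2[of "Suc k" d] k
    by (auto simp: pow2_below_def)
qed

text \<open>Recursion on lists does not apply, as the input is a number, so a loop is written by
  hand. It doubles a power of two, which takes fewer rounds than \<open>d\<close> has bits and hence
  linearly many in the size of \<open>d\<close>.\<close>

lemma pt_pow2_below [pt_rule]:
  assumes "pt f"
  shows "pt (\<lambda>x. pow2_below (f x))"
proof (rule pt_comp[OF _ assms])
  \<comment> \<open>That is, twice the current power is still at most \<open>d\<close>.\<close>
  let ?guard = "\<lambda>b. Binop Less (Binop Add (Var (b+1)) (Var (b+1))) (Binop Add (Var b) (Const 1))"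
  let ?body = "\<lambda>b. Assign (b+1) (Binop Add (Var (b+1)) (Var (b+1)))"
  let ?c = "\<lambda>b. Seq (Assign (b+1) (Const 1)) (Seq (While (?guard b) (?body b)) (Assign b (Var (b+1))))"
  define B where "B = (\<lambda>d. 20 * floorlog 2 d + 60)"
  have loop: "\<exists>s'. steps (While (?guard b) (?body b)) s (B d * (m + 1)) s' \<and>
      s' (b+1) = Num (pow2_below d) \<and> (\<forall>i<b. s' i = s i)"
    if "s b = Num d" "s (b+1) = Num (2 ^ i)" "i + m = floorlog 2 d - 1" for b s d i m
    using that
  proof (induction m arbitrary: s i)
    case 0
    have "\<not> 2 ^ Suc i \<le> d" unfolding power_le_iff_floorlog2 using 0(3) by linarith
    then have "d < 2 ^ Suc i" by (simp only: not_le)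
    then have "eval_expr (?guard b) s = Num 0" using 0 by simp
    from steps_WhileFalse[OF this] have "steps (While (?guard b) (?body b)) s (B d * (0 + 1)) s"
    proof (rule steps_mono)
      have "floorlog 2 (2 ^ i :: nat) \<le> floorlog 2 d + 1"
        using 0(3) unfolding floorlog2_le_iff by (intro power_strict_increasing) auto
      then show "1 + expr_cost (?guard b) s \<le> B d * (0 + 1)"
        using 0(1,2) floorlog2_add_le[of "2 ^ i" "2 ^ i"] floorlog2_add_le[of d 1] \<open>d < 2 ^ Suc i\<close>
        by (simp add: B_def floorlog_def[of 2 "Suc 0"])
    qed
    then show ?case using 0 by (auto simp: pow2_below_def)
  next
    case (Suc m)
    have le: "2 ^ Suc i \<le> d" using Suc.prems(3) power_le_iff_floorlog2[of "Suc i" d] by simp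
    then have ne: "eval_expr (?guard b) s \<noteq> Num 0" using Suc.prems by simp
    let ?s = "s(b+1 := Num (2 ^ Suc i))"
    have fl: "floorlog 2 (2 ^ i :: nat) \<le> floorlog 2 d" "floorlog 2 (2 * 2 ^ i :: nat) \<le> floorlog 2 d"
      using le floorlog2_mono[of "2 ^ i" d] floorlog2_mono[of "2 ^ Suc i" d] by simp_all
    have body: "steps (?body b) s (10 * floorlog 2 d + 10) ?s"
      using Suc.prems fl by (intro steps_Assign_le) (simp_all add: mult_2)
    have "\<exists>s'. steps (While (?guard b) (?body b)) ?s (B d * (m + 1)) s' \<and>
      s' (b+1) = Num (pow2_below d) \<and> (\<forall>i<b. s' i = ?s i)"
      by (rule Suc.IH[of ?s "Suc i"]) (use Suc.prems in simp_all)
    then obtain s' where s': "steps (While (?guard b) (?body b)) ?s (B d * (m + 1)) s'"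
      "s' (b+1) = Num (pow2_below d)" "\<forall>i<b. s' i = ?s i" by blast
    have "steps (While (?guard b) (?body b)) s (B d * (Suc m + 1)) s'"
    proof (rule steps_mono[OF steps_WhileTrue[OF ne body s'(1)]])
      have "expr_cost (?guard b) s \<le> 8 * floorlog 2 d + 30"
        using Suc.prems(1,2) fl floorlog2_add_le[of d 1] by (simp add: mult_2 floorlog_def[of 2 "Suc 0"])
      then show "1 + expr_cost (?guard b) s + (10 * floorlog 2 d + 10) + B d * (m + 1) \<le> B d * (Suc m + 1)"
        unfolding B_def by (simp only: ring_distribs mult_Suc_right)
    qed
    then show ?case using s'(2,3) by auto
  qed
  let ?T = "[:40, 2:] + [:60, 20:] * [:1, 1:]"
  show "pt pow2_below"
  proof (rule ptI[where p = "[:2, 1:]" and p' = ?T and c = ?c])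
    have "floorlog 2 (pow2_below d) \<le> floorlog 2 d + 1" for d
      unfolding pow2_below_def floorlog2_le_iff by (rule power_strict_increasing) auto
    then show size: "sz (pow2_below d) \<le> poly [:2, 1:] (sz d)" for d
      by (simp add: le_SucI)
    fix b and d :: nat and s :: store assume s: "s b = enc d"
    let ?s1 = "s(b+1 := Num 1)"
    have 1: "steps (Assign (b+1) (Const 1)) s 5 ?s1"
      by (intro steps_Assign_le) (simp_all add: floorlog_def)
    from loop[of ?s1 b d 0 "floorlog 2 d - 1"] s obtain s2 where
      2: "steps (While (?guard b) (?body b)) ?s1 (B d * (floorlog 2 d - 1 + 1)) s2"
      "s2 (b+1) = Num (pow2_below d)" "\<forall>i<b. s2 i = ?s1 i" by auto
    let ?s3 = "s2(b := Num (pow2_below d))"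
    have 3: "steps (Assign b (Var (b+1))) s2 (3 + sz d) ?s3"
      using 2(2) size[of d] by (intro steps_Assign_le) simp_all
    have "B d * (floorlog 2 d - 1 + 1) \<le> poly ([:60, 20:] * [:1, 1:]) (sz d)"
      unfolding poly_mult B_def by (intro mult_mono) simp_all
    then have "steps (?c b) s (poly ?T (sz d)) ?s3"
      by (intro steps_mono[OF steps_Seq[OF 1 steps_Seq[OF 2(1) 3]]]) (simp add: algebra_simps)
    then show "\<exists>s'. steps (?c b) s (poly ?T (sz d)) s' \<and> s' b = enc (pow2_below d) \<and> (\<forall>i<b. s' i = s i)"
      using 2(3) by (intro exI[of _ ?s3]) simp
  qed
qed

lemma pt_hd [pt_rule]:
  assumes "pt l" shows "pt (\<lambda>x. hd (l x))"
proof -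
  have "pt (\<lambda>x. case l x of [] \<Rightarrow> hd [] | y # ys \<Rightarrow> y)" by (intro pt_rule assms)
  moreover have "(case l x of [] \<Rightarrow> hd [] | y # ys \<Rightarrow> y) = hd (l x)" for x by (cases "l x") auto
  ultimately show ?thesis by simp
qed

lemma pt_upt_length [pt_rule]:
  fixes l :: "'x::enc \<Rightarrow> 'e::enc list"
  assumes "pt l" shows "pt (\<lambda>x. [0..<length (l x)])"
proof -
  have "pt (\<lambda>x. rec_list [] (\<lambda>y ys r. r @ [length ys]) (l x))"
    by (rule pt_rec[OF assms]) (intro pt_rule additive_rule)+
  moreover have "rec_list [] (\<lambda>y ys r. r @ [length ys]) ys = [0..<length ys]" for ys :: "'e list"
    by (induction ys) auto
  ultimately show ?thesis by simp
qed

definition enum :: "'a list \<Rightarrow> (nat \<times> 'a) list" where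
  "enum xs = zip [0..<length xs] xs"

lemma enum_snoc: "enum (xs @ [x]) = enum xs @ [(length xs, x)]"
  by (simp add: enum_def)

lemma set_enum: "set (enum xs) = {(i, xs ! i) |i. i < length xs}"
  by (force simp: enum_def set_zip)

lemma map_fst_enum: "map fst (enum xs) = [0..<length xs]"
  by (simp add: enum_def)

lemma pt_enum [pt_rule]:
  fixes l :: "'x::enc \<Rightarrow> 'e::enc list"
  assumes "pt l" shows "pt (\<lambda>x. enum (l x))"
proof -
  have "pt (\<lambda>x. rev (rec_list [] (\<lambda>y ys r. (length ys, y) # r) (rev (l x))))"
    by (intro pt_rev, rule pt_rec) (intro pt_rule additive_rule assms)+
  moreover have "rec_list [] (\<lambda>y ys r. (length ys, y) # r) (rev ys) = rev (enum ys)" for ys :: "'e list"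
    by (induction ys rule: rev_induct) (simp_all add: enum_snoc, simp add: enum_def)
  ultimately show ?thesis by simp
qed

text \<open>Outside the range \<open>xs ! i\<close> is unspecified, so no bound on its size can be
  shown; hence the default value.\<close>

definition lookup :: "'a \<Rightarrow> 'a list \<Rightarrow> nat \<Rightarrow> 'a" where
  "lookup a xs i = (if i < length xs then xs ! i else a)"

lemma pt_lookup [pt_rule]:
  fixes a :: "'x::enc \<Rightarrow> 'e::enc"
  assumes "pt a" "pt l" "pt i" shows "pt (\<lambda>x. lookup (a x) (l x) (i x))"
proof (rule pt_comp3[OF _ assms])
  \<comment> \<open>The recursion of \<open>!\<close> changes the index, while \<open>pt_rec\<close>
    keeps its parameters fixed; so the index is compared with the enumerated positions
    instead.\<close>
  have "pt (\<lambda>z :: 'e \<times> 'e list \<times> nat. case filter (\<lambda>p. fst p = snd (snd z)) (enum (fst (snd z))) of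
      [] \<Rightarrow> fst z | p # ps \<Rightarrow> snd p)"
    by (intro pt_rule)
  moreover have "filter (\<lambda>p. fst p = i) (enum xs) = (if i < length xs then [(i, xs ! i)] else [])"
    for xs :: "'e list" and i
    by (induction xs rule: rev_induct) (auto simp: enum_snoc nth_append, simp add: enum_def)
  ultimately show "pt (\<lambda>z :: 'e \<times> 'e list \<times> nat. lookup (fst z) (fst (snd z)) (snd (snd z)))"
    by (simp add: lookup_def if_distrib cong: if_cong)
qed

section \<open>The algorithm\<close>

text \<open>The program sees the metric as a matrix, the analysis as a function. All definitions
  below take the function; running times are shown for the instance \<open>wt A\<close>, correctness
  for an arbitrary \<open>w\<close>.\<close>

definition wt :: "nat list list \<Rightarrow> nat \<Rightarrow> nat \<Rightarrow> nat" where
  "wt A u v = lookup 0 (lookup [] A u) v"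

lemma pt_wt [pt_rule]:
  assumes "pt A" "pt u" "pt v" shows "pt (\<lambda>x. wt (A x) (u x) (v x))"
  unfolding wt_def by (intro pt_rule assms)

primrec argmin :: "('a \<Rightarrow> nat) \<Rightarrow> 'a list \<Rightarrow> 'a" where
  "argmin f [] = undefined"
| "argmin f (y # ys) = (if ys = [] \<or> f y \<le> f (argmin f ys) then y else argmin f ys)"

lemma argmin_mem: "xs \<noteq> [] \<Longrightarrow> argmin f xs \<in> set xs"
  by (induction xs) auto

lemma argmin_le: "x \<in> set xs \<Longrightarrow> f (argmin f xs) \<le> f x"
proof (induction xs)
  case (Cons y ys)
  then show ?case by (cases "ys = []") (auto intro: order_trans)
qed simp

lemma pt_argmin [pt_rule]:
  fixes l :: "'x::enc \<Rightarrow> 'e::enc list"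
  assumes "pt l" "pt (\<lambda>z. h (fst z) (snd z))"
  shows "pt (\<lambda>x. argmin (h x) (l x))"
proof -
  have "pt (\<lambda>x. rec_list undefined (\<lambda>y ys r. if ys = [] \<or> h x y \<le> h x r then y else r) (l x))"
    by (rule pt_rec[OF assms(1)]; intro pt_rule additive_rule additive_by_pt pt_comp2[OF assms(2)])
  moreover have "rec_list undefined (\<lambda>y ys r. if ys = [] \<or> f y \<le> f r then y else r) ys = argmin f ys"
    for f and ys :: "'e list" by (induction ys) auto
  ultimately show ?thesis by simp
qed

primrec insert_after :: "'a \<Rightarrow> 'a \<Rightarrow> 'a list \<Rightarrow> 'a list" where
  "insert_after u v [] = []"
| "insert_after u v (x # xs) = (if x = u then x # v # xs else x # insert_after u v xs)"

lemma pt_insert_after [pt_rule]: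
  fixes l :: "'x::enc \<Rightarrow> 'e::enc list"
  assumes "pt u" "pt v" "pt l" shows "pt (\<lambda>x. insert_after (u x) (v x) (l x))"
proof (rule pt_comp3[OF _ assms])
  have "pt (\<lambda>z :: 'e \<times> 'e \<times> 'e list. rec_list []
      (\<lambda>x xs r. if x = fst z then x # fst (snd z) # xs else x # r) (snd (snd z)))"
    by (rule pt_rec; intro pt_rule additive_rule additive_by_pt)
  moreover have "rec_list [] (\<lambda>x xs r. if x = u then x # v # xs else x # r) ys = insert_after u v ys"
    for u v and ys :: "'e list" by (induction ys) auto
  ultimately show "pt (\<lambda>z :: 'e \<times> 'e \<times> 'e list. insert_after (fst z) (fst (snd z)) (snd (snd z)))"
    by simp
qed

text \<open>One step of Prim's algorithm; the new vertex is placed next to its neighbour in the tree.\<close>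

definition grow :: "(nat \<Rightarrow> nat \<Rightarrow> nat) \<Rightarrow> nat list \<Rightarrow> nat list \<Rightarrow> nat list" where
  "grow w T xs =
     (let Q = filter (\<lambda>v. v \<notin> set xs) T;
          p = argmin (\<lambda>p. w (fst p) (snd p)) (concat (map (\<lambda>u. map (\<lambda>v. (u, v)) Q) xs))
      in if Q = [] then xs else insert_after (fst p) (snd p) xs)"

lemma pt_grow [pt_rule]:
  assumes "pt A" "pt T" "pt l" shows "pt (\<lambda>x. grow (wt (A x)) (T x) (l x))"
proof (rule pt_comp3[where g = "\<lambda>A T l. grow (wt A) T l", OF _ assms])
  show "pt (\<lambda>z. grow (wt (fst z)) (fst (snd z)) (snd (snd z)))"
    unfolding grow_def by (intro pt_rule)
qed

text \<open>The list \<open>T\<close> is recursed on only as a counter. If it is distinct and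
  contains \<open>r\<close>, the last round finds no vertex left and changes nothing.\<close>

definition vertex_order :: "(nat \<Rightarrow> nat \<Rightarrow> nat) \<Rightarrow> nat list \<Rightarrow> nat \<Rightarrow> nat list" where
  "vertex_order w T r = rec_list [r] (\<lambda>_ _ xs. grow w T xs) T"

lemma sz_insert_after: "sz (insert_after u v xs) \<le> sz xs + sz v + 1"
  by (induction xs) auto

lemma sz_grow: "sz (grow w T xs) \<le> sz xs + (sz T + 1)"
proof -
  define Q where "Q = filter (\<lambda>v. v \<notin> set xs) T"
  define P where "P = concat (map (\<lambda>u. map (\<lambda>v. (u, v)) Q) xs)"
  define p where "p = argmin (\<lambda>p. w (fst p) (snd p)) P"
  show ?thesis
  proof (cases "Q = [] \<or> xs = []")
    case False
    then have "P \<noteq> []" unfolding P_def by auto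
    then have "p \<in> set P" unfolding p_def by (rule argmin_mem)
    then have "snd p \<in> set T" unfolding P_def Q_def by auto
    then show ?thesis using sz_insert_after[of "fst p" "snd p" xs] sz_mem_less[of "snd p" T]
      unfolding grow_def Let_def Q_def[symmetric] P_def[symmetric] p_def[symmetric] by simp
  next
    case True
    then show ?thesis by (auto simp: grow_def Q_def)
  qed
qed

lemma pt_vertex_order [pt_rule]:
  assumes "pt A" "pt T" "pt r" shows "pt (\<lambda>x. vertex_order (wt (A x)) (T x) (r x))"
proof (rule pt_comp3[where g = "\<lambda>A T r. vertex_order (wt A) T r", OF _ assms])
  have "additive (\<lambda>(z :: (nat list list \<times> nat list \<times> nat) \<times> nat \<times> nat list) xs.
      grow (wt (fst (fst z))) (fst (snd (fst z))) xs)"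
    unfolding additive_def
  proof (intro exI[of _ "[:1, 1:]"] allI)
    fix z :: "(nat list list \<times> nat list \<times> nat) \<times> nat \<times> nat list" and xs
    have "sz (fst (snd (fst z))) \<le> sz z" by (simp add: sz_prod)
    then show "sz (grow (wt (fst (fst z))) (fst (snd (fst z))) xs) \<le> sz xs + poly [:1, 1:] (sz z)"
      using sz_grow[of "wt (fst (fst z))" "fst (snd (fst z))" xs] by simp
  qed
  then show "pt (\<lambda>z. vertex_order (wt (fst z)) (fst (snd z)) (snd (snd z)))"
    unfolding vertex_order_def by (intro pt_rec pt_rule)
qed

section \<open>Positions along the path and its segments\<close>

primrec position :: "(nat \<Rightarrow> nat \<Rightarrow> nat) \<Rightarrow> nat \<Rightarrow> nat list \<Rightarrow> nat" where
  "position w v [] = 0"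
| "position w v (x # xs) = (if x = v \<or> xs = [] then 0 else w x (hd xs) + position w v xs)"

lemma pt_position [pt_rule]:
  assumes "pt A" "pt v" "pt l" shows "pt (\<lambda>x. position (wt (A x)) (v x) (l x))"
proof (rule pt_comp3[where g = "\<lambda>A v l. position (wt A) v l", OF _ assms])
  have "pt (\<lambda>z. rec_list 0 (\<lambda>x xs r. if x = fst (snd z) \<or> xs = [] then 0 else wt (fst z) x (hd xs) + r)
      (snd (snd z)))"
    by (rule pt_rec; intro pt_rule additive_rule additive_by_pt)
  moreover have "rec_list 0 (\<lambda>x xs r. if x = v \<or> xs = [] then 0 else w x (hd xs) + r) ys = position w v ys"
    for w v ys by (induction ys) auto
  ultimately show "pt (\<lambda>z. position (wt (fst z)) (fst (snd z)) (snd (snd z)))" by simp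
qed

text \<open>The quotient of the position by \<open>R\<close> numbers the segments of length
  \<open>R\<close>; a segment is represented by its first vertex on the path.\<close>

definition rep :: "(nat \<Rightarrow> nat \<Rightarrow> nat) \<Rightarrow> nat list \<Rightarrow> nat \<Rightarrow> nat \<Rightarrow> nat" where
  "rep w xs R v = hd (filter (\<lambda>u. position w u xs div R = position w v xs div R) xs)"

lemma pt_rep [pt_rule]:
  assumes "pt A" "pt l" "pt R" "pt v" shows "pt (\<lambda>x. rep (wt (A x)) (l x) (R x) (v x))"
proof (rule pt_comp4[where g = "\<lambda>A l R v. rep (wt A) l R v", OF _ assms])
  show "pt (\<lambda>z. rep (wt (fst z)) (fst (snd z)) (fst (snd (snd z))) (snd (snd (snd z))))"
    unfolding rep_def by (intro pt_rule)
qed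

definition reps :: "(nat \<Rightarrow> nat \<Rightarrow> nat) \<Rightarrow> nat list \<Rightarrow> nat \<Rightarrow> nat list" where
  "reps w xs R = remdups (map (rep w xs R) xs)"

lemma pt_reps [pt_rule]:
  assumes "pt A" "pt l" "pt R" shows "pt (\<lambda>x. reps (wt (A x)) (l x) (R x))"
proof (rule pt_comp3[where g = "\<lambda>A l R. reps (wt A) l R", OF _ assms])
  show "pt (\<lambda>z. reps (wt (fst z)) (fst (snd z)) (snd (snd z)))"
    unfolding reps_def by (intro pt_rule)
qed

section \<open>Region growing\<close>

definition zone :: "(nat \<Rightarrow> nat \<Rightarrow> nat) \<Rightarrow> nat \<Rightarrow> nat list \<Rightarrow> nat \<Rightarrow> nat \<Rightarrow> nat list" where
  "zone w R U v j = filter (\<lambda>p. w v p \<le> 4 * R * j) U"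

text \<open>At this radius one more step at most doubles the zone, so that the points a cluster
  serves can be charged to the points it covers.\<close>

definition radius :: "(nat \<Rightarrow> nat \<Rightarrow> nat) \<Rightarrow> nat \<Rightarrow> nat list \<Rightarrow> nat \<Rightarrow> nat" where
  "radius w R U v =
     hd (filter (\<lambda>j. length (zone w R U v (j + 1)) \<le> 2 * length (zone w R U v j)) [0..<length U])"

text \<open>A cluster is a triple of its center, the points it covers and the points it can serve.\<close>

type_synonym cluster = "nat \<times> nat list \<times> nat list"

abbreviation center :: "cluster \<Rightarrow> nat" where "center c \<equiv> fst c"
abbreviation inner :: "cluster \<Rightarrow> nat list" where "inner c \<equiv> fst (snd c)"
abbreviation outer :: "cluster \<Rightarrow> nat list" where "outer c \<equiv> snd (snd c)"

definition uncovered :: "nat list \<Rightarrow> cluster list \<Rightarrow> nat list" where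
  "uncovered P cs = filter (\<lambda>p. \<not> (\<exists>c\<in>set cs. p \<in> set (inner c))) P"

text \<open>Only the smaller zone leaves the uncovered points; the larger one may overlap the zones
  of later clusters.\<close>

definition new_cluster :: "(nat \<Rightarrow> nat \<Rightarrow> nat) \<Rightarrow> nat \<Rightarrow> nat list \<Rightarrow> nat \<Rightarrow> cluster" where
  "new_cluster w R U v = (let j = radius w R U v in (v, zone w R U v j, zone w R U v (j + 1)))"

text \<open>New clusters go to the end, so the list is in order of creation. This matters to
  \<open>hub\<close>, which takes the earliest cluster that covers an end of the object.\<close>

primrec carve :: "(nat \<Rightarrow> nat \<Rightarrow> nat) \<Rightarrow> nat \<Rightarrow> nat list \<Rightarrow> nat list \<Rightarrow> cluster list" where
  "carve w R P [] = []"
| "carve w R P (v # vs) =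
     (let cs = carve w R P vs; U = uncovered P cs
      in if v \<in> set U then cs @ [new_cluster w R U v] else cs)"

definition clusters :: "(nat \<Rightarrow> nat \<Rightarrow> nat) \<Rightarrow> nat list \<Rightarrow> nat \<Rightarrow> cluster list" where
  "clusters w xs R = carve w R (reps w xs R) (reps w xs R)"

lemma pt_zone [pt_rule]:
  assumes "pt A" "pt R" "pt U" "pt v" "pt j"
  shows "pt (\<lambda>x. zone (wt (A x)) (R x) (U x) (v x) (j x))"
proof -
  have "pt (\<lambda>z :: (nat list list \<times> nat) \<times> nat list \<times> nat \<times> nat.
      zone (wt (fst (fst z))) (snd (fst z)) (fst (snd z)) (fst (snd (snd z))) (snd (snd (snd z))))"
    unfolding zone_def by (intro pt_rule)
  from pt_comp[OF this, of "\<lambda>x. ((A x, R x), U x, v x, j x)"] assms show ?thesis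
    by (simp add: pt_rule)
qed

lemma pt_radius [pt_rule]:
  assumes "pt A" "pt R" "pt U" "pt v"
  shows "pt (\<lambda>x. radius (wt (A x)) (R x) (U x) (v x))"
proof (rule pt_comp4[where g = "\<lambda>A R U v. radius (wt A) R U v", OF _ assms])
  show "pt (\<lambda>z. radius (wt (fst z)) (fst (snd z)) (fst (snd (snd z))) (snd (snd (snd z))))"
    unfolding radius_def by (intro pt_rule)
qed

lemma pt_uncovered [pt_rule]:
  assumes "pt P" "pt cs" shows "pt (\<lambda>x. uncovered (P x) (cs x))"
proof (rule pt_comp2[OF _ assms])
  show "pt (\<lambda>z. uncovered (fst z) (snd z))"
    unfolding uncovered_def by (intro pt_rule)
qed

lemma pt_new_cluster [pt_rule]:
  assumes "pt A" "pt R" "pt U" "pt v"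
  shows "pt (\<lambda>x. new_cluster (wt (A x)) (R x) (U x) (v x))"
  unfolding new_cluster_def Let_def by (intro pt_rule assms)

lemma pt_carve [pt_rule]:
  assumes "pt A" "pt R" "pt P" "pt vs"
  shows "pt (\<lambda>x. carve (wt (A x)) (R x) (P x) (vs x))"
proof (rule pt_comp4[where g = "\<lambda>A R P vs. carve (wt A) R P vs", OF _ assms])
  define h where "h = (\<lambda>w R P v (vs :: nat list) cs. if v \<in> set (uncovered P cs)
    then cs @ [new_cluster w R (uncovered P cs) v] else cs)"
  have "additive (\<lambda>z cs. h (wt (fst (fst z))) (fst (snd (fst z))) (fst (snd (snd (fst z))))
      (fst (snd (z :: (nat list list \<times> nat \<times> nat list \<times> nat list) \<times> nat \<times> nat list))) (snd (snd z)) cs)"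
    unfolding additive_def
  proof (intro exI[of _ "[:5, 3:]"] allI)
    fix z :: "(nat list list \<times> nat \<times> nat list \<times> nat list) \<times> nat \<times> nat list" and cs
    define w R P v where "w = wt (fst (fst z))" "R = fst (snd (fst z))" "P = fst (snd (snd (fst z)))"
      "v = fst (snd z)"
    \<comment> \<open>Both lists of a new cluster are filters of \<open>P\<close>, whatever the
      clusters so far; hence the bound does not involve \<open>cs\<close>.\<close>
    have "sz (new_cluster w R (uncovered P cs) v) \<le> 2 + sz v + 2 * sz P"
      unfolding new_cluster_def Let_def zone_def uncovered_def filter_filter
      using sz_filter_le[of _ P] by (simp add: add_le_mono mult_2)
    moreover have "sz v + sz P \<le> sz z" by (simp add: w_R_P_v_def sz_prod)
    ultimately have "sz (h w R P v (snd (snd z)) cs) \<le> sz cs + poly [:5, 3:] (sz z)"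
      using sz_append[of cs "[new_cluster w R (uncovered P cs) v]"] by (simp add: h_def)
    then show "sz (h (wt (fst (fst z))) (fst (snd (fst z))) (fst (snd (snd (fst z)))) (fst (snd z)) (snd (snd z)) cs)
        \<le> sz cs + poly [:5, 3:] (sz z)"
      by (simp only: w_R_P_v_def)
  qed
  moreover have "pt (\<lambda>z. h (wt (fst (fst z))) (fst (snd (fst z))) (fst (snd (snd (fst z))))
      (fst (snd (z :: (nat list list \<times> nat \<times> nat list \<times> nat list) \<times> nat \<times> nat list \<times> cluster list)))
      (fst (snd (snd z))) (snd (snd (snd z))))"
    unfolding h_def by (intro pt_rule)
  ultimately have "pt (\<lambda>z. rec_list [] (h (wt (fst z)) (fst (snd z)) (fst (snd (snd z)))) (snd (snd (snd z))))"
    by (intro pt_rec pt_rule)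
  moreover have "rec_list [] (h w R P) vs = carve w R P vs" for w R P vs
    by (induction vs) (auto simp: h_def Let_def)
  ultimately show "pt (\<lambda>z. carve (wt (fst z)) (fst (snd z)) (fst (snd (snd z))) (snd (snd (snd z))))"
    by simp
qed

lemma pt_clusters [pt_rule]:
  assumes "pt A" "pt l" "pt R"
  shows "pt (\<lambda>x. clusters (wt (A x)) (l x) (R x))"
  unfolding clusters_def by (intro pt_rule assms)

section \<open>Grouping of the objects and trips of the vehicle\<close>

text \<open>An object is given by its index, its source and its destination.\<close>

type_synonym object = "nat \<times> nat \<times> nat"

abbreviation index :: "object \<Rightarrow> nat" where "index z \<equiv> fst z"

definition endpoint :: "bool \<Rightarrow> object \<Rightarrow> nat" where
  "endpoint b z = (if b then fst (snd z) else snd (snd z))"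

definition scale :: "(nat \<Rightarrow> nat \<Rightarrow> nat) \<Rightarrow> object \<Rightarrow> nat" where
  "scale w z = pow2_below (w (endpoint True z) (endpoint False z))"

definition home :: "(nat \<Rightarrow> nat \<Rightarrow> nat) \<Rightarrow> nat list \<Rightarrow> bool \<Rightarrow> object \<Rightarrow> nat" where
  "home w xs b z = rep w xs (scale w z) (endpoint b z)"

definition hub :: "(nat \<Rightarrow> nat \<Rightarrow> nat) \<Rightarrow> nat list \<Rightarrow> object \<Rightarrow> nat" where
  "hub w xs z = center (hd (filter (\<lambda>c. home w xs True z \<in> set (inner c) \<or> home w xs False z \<in> set (inner c))
     (clusters w xs (scale w z))))"

text \<open>Objects with equal keys on side \<open>b\<close> can share trips: they use the same hub,
  and their ends on that side lie in the same segment.\<close>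

definition key :: "(nat \<Rightarrow> nat \<Rightarrow> nat) \<Rightarrow> nat list \<Rightarrow> bool \<Rightarrow> object \<Rightarrow> nat \<times> nat \<times> nat" where
  "key w xs b z = (scale w z, hub w xs z, home w xs b z)"

text \<open>A bucket sort by the vertices of the path, so that a trip runs through its segment once
  and in the order of the path.\<close>

definition sorted_objects :: "nat list \<Rightarrow> bool \<Rightarrow> object list \<Rightarrow> object list" where
  "sorted_objects xs b zs = concat (map (\<lambda>v. filter (\<lambda>z. endpoint b z = v) zs) xs)"

text \<open>Built from the right end: for positive \<open>k\<close> all chunks except possibly the
  first are full.\<close>

primrec chunks :: "nat \<Rightarrow> 'a list \<Rightarrow> 'a list list" where
  "chunks k [] = []"
| "chunks k (y # ys) = (case chunks k ys of [] \<Rightarrow> [[y]]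
     | c # cs \<Rightarrow> if length c < k then (y # c) # cs else [y] # c # cs)"

definition batches ::
  "(nat \<Rightarrow> nat \<Rightarrow> nat) \<Rightarrow> nat list \<Rightarrow> nat \<Rightarrow> object list \<Rightarrow> bool \<Rightarrow> nat \<Rightarrow> object list list" where
  "batches w xs k zs b v = concat (map (\<lambda>\<kappa>. chunks k (filter (\<lambda>z. key w xs b z = \<kappa>) (sorted_objects xs b zs)))
     (filter (\<lambda>\<kappa>. fst (snd \<kappa>) = v) (remdups (map (key w xs b) zs))))"

abbreviation fetch :: "object \<Rightarrow> action list" where
  "fetch z \<equiv> [Move (endpoint True z), Pickup (index z)]"

abbreviation bring :: "object \<Rightarrow> action list" where
  "bring z \<equiv> [Move (endpoint False z), Drop (index z)]"

text \<open>Started at \<open>v\<close>, a trip of either kind is a closed tour from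
  \<open>v\<close>, so the lengths of consecutive trips add up.\<close>

definition collect :: "nat \<Rightarrow> object list \<Rightarrow> action list" where
  "collect v zs = concat (map fetch zs) @
     Move v # map (\<lambda>z. Drop (index z)) zs"

definition deliver :: "nat \<Rightarrow> object list \<Rightarrow> action list" where
  "deliver v zs = map (\<lambda>z. Pickup (index z)) zs @
     concat (map bring zs) @ [Move v]"

text \<open>The two passes batch the same objects differently, by the segment of the source and by
  the segment of the destination. Hence all objects of the hub are collected before the first one is
  delivered.\<close>

definition serve :: "(nat \<Rightarrow> nat \<Rightarrow> nat) \<Rightarrow> nat list \<Rightarrow> nat \<Rightarrow> object list \<Rightarrow> nat \<Rightarrow> action list" where
  "serve w xs k zs v = Move v # concat (map (collect v) (batches w xs k zs True v)) @
     concat (map (deliver v) (batches w xs k zs False v))"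

text \<open>Objects whose two ends coincide are already in place. They are dropped because a
  distance of 0 has no scale below it.\<close>

definition objects :: "(nat \<times> nat) list \<Rightarrow> object list" where
  "objects ds = filter (\<lambda>z. endpoint True z \<noteq> endpoint False z) (enum ds)"

definition terminals :: "nat \<Rightarrow> object list \<Rightarrow> nat list" where
  "terminals r zs = remdups (r # concat (map (\<lambda>z. [endpoint True z, endpoint False z]) zs))"

definition route :: "(nat \<Rightarrow> nat \<Rightarrow> nat) \<Rightarrow> nat \<Rightarrow> nat \<Rightarrow> (nat \<times> nat) list \<Rightarrow> action list" where
  "route w k r ds =
     (let zs = objects ds; xs = vertex_order w (terminals r zs) r
      in concat (map (serve w xs k zs) xs) @ [Move r])"

section \<open>The route is computed in polynomial time\<close>

lemma pt_endpoint [pt_rule]: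
  assumes "pt b" "pt z" shows "pt (\<lambda>x. endpoint (b x) (z x))"
  unfolding endpoint_def by (intro pt_rule assms)

lemma pt_scale [pt_rule]:
  assumes "pt A" "pt z" shows "pt (\<lambda>x. scale (wt (A x)) (z x))"
  unfolding scale_def by (intro pt_rule assms)

lemma pt_home [pt_rule]:
  assumes "pt A" "pt l" "pt b" "pt z" shows "pt (\<lambda>x. home (wt (A x)) (l x) (b x) (z x))"
  unfolding home_def by (intro pt_rule assms)

lemma pt_hub [pt_rule]:
  assumes "pt A" "pt l" "pt z" shows "pt (\<lambda>x. hub (wt (A x)) (l x) (z x))"
proof (rule pt_comp3[where g = "\<lambda>A l z. hub (wt A) l z", OF _ assms])
  show "pt (\<lambda>z. hub (wt (fst z)) (fst (snd z)) (snd (snd z)))"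
    unfolding hub_def by (intro pt_rule)
qed

lemma pt_key [pt_rule]:
  assumes "pt A" "pt l" "pt b" "pt z" shows "pt (\<lambda>x. key (wt (A x)) (l x) (b x) (z x))"
  unfolding key_def by (intro pt_rule assms)

lemma pt_sorted_objects [pt_rule]:
  assumes "pt l" "pt b" "pt zs" shows "pt (\<lambda>x. sorted_objects (l x) (b x) (zs x))"
proof (rule pt_comp3[OF _ assms])
  show "pt (\<lambda>z. sorted_objects (fst z) (fst (snd z)) (snd (snd z)))"
    unfolding sorted_objects_def by (intro pt_rule)
qed

lemma pt_chunks [pt_rule]:
  fixes l :: "'x::enc \<Rightarrow> 'e::enc list"
  assumes "pt k" "pt l" shows "pt (\<lambda>x. chunks (k x) (l x))"
proof (rule pt_comp2[OF _ assms])
  define h where "h = (\<lambda>k (y :: 'e) (ys :: 'e list) r. case r of [] \<Rightarrow> [[y]]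
     | c # cs \<Rightarrow> if length c < k then (y # c) # cs else [y] # c # cs)"
  have "additive (\<lambda>(z :: (nat \<times> 'e list) \<times> 'e \<times> 'e list) r. h (fst (fst z)) (fst (snd z)) (snd (snd z)) r)"
    unfolding additive_def
    by (intro exI[of _ "[:5, 1:]"]) (auto simp: h_def sz_prod split: list.split)
  moreover have "pt (\<lambda>z. h (fst (fst (z :: (nat \<times> 'e list) \<times> 'e \<times> 'e list \<times> 'e list list))) (fst (snd z))
      (fst (snd (snd z))) (snd (snd (snd z))))"
    unfolding h_def by (intro pt_rule)
  ultimately have "pt (\<lambda>z :: nat \<times> 'e list. rec_list [] (h (fst z)) (snd z))"
    by (intro pt_rec pt_rule)
  moreover have "rec_list [] (h k) ys = chunks k ys" for k ys
    by (induction ys) (auto simp: h_def)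
  ultimately show "pt (\<lambda>z :: nat \<times> 'e list. chunks (fst z) (snd z))"
    by simp
qed

lemma pt_batches [pt_rule]:
  assumes "pt A" "pt l" "pt k" "pt zs" "pt b" "pt v"
  shows "pt (\<lambda>x. batches (wt (A x)) (l x) (k x) (zs x) (b x) (v x))"
proof -
  have "pt (\<lambda>z :: (nat list list \<times> nat list \<times> nat) \<times> object list \<times> bool \<times> nat.
      batches (wt (fst (fst z))) (fst (snd (fst z))) (snd (snd (fst z))) (fst (snd z)) (fst (snd (snd z)))
        (snd (snd (snd z))))"
    unfolding batches_def by (intro pt_rule)
  from pt_comp[OF this, of "\<lambda>x. ((A x, l x, k x), zs x, b x, v x)"] assms show ?thesis
    by (simp add: pt_rule)
qed

lemma pt_trips [pt_rule]:
  assumes "pt v" "pt zs" shows "pt (\<lambda>x. collect (v x) (zs x))" "pt (\<lambda>x. deliver (v x) (zs x))"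
  unfolding collect_def deliver_def by (intro pt_rule assms)+

lemma pt_serve [pt_rule]:
  assumes "pt A" "pt l" "pt k" "pt zs" "pt v"
  shows "pt (\<lambda>x. serve (wt (A x)) (l x) (k x) (zs x) (v x))"
proof -
  have "pt (\<lambda>z :: (nat list list \<times> nat list \<times> nat) \<times> object list \<times> nat.
      serve (wt (fst (fst z))) (fst (snd (fst z))) (snd (snd (fst z))) (fst (snd z)) (snd (snd z)))"
    unfolding serve_def by (intro pt_rule)
  from pt_comp[OF this, of "\<lambda>x. ((A x, l x, k x), zs x, v x)"] assms show ?thesis
    by (simp add: pt_rule)
qed

lemma pt_objects [pt_rule]:
  assumes "pt ds" shows "pt (\<lambda>x. objects (ds x))"
  unfolding objects_def by (intro pt_rule assms)

lemma pt_terminals [pt_rule]: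
  assumes "pt r" "pt zs" shows "pt (\<lambda>x. terminals (r x) (zs x))"
  unfolding terminals_def by (intro pt_rule assms)

lemma pt_route [pt_rule]:
  assumes "pt A" "pt k" "pt r" "pt ds"
  shows "pt (\<lambda>x. route (wt (A x)) (k x) (r x) (ds x))"
proof (rule pt_comp4[where g = "\<lambda>A k r ds. route (wt A) k r ds", OF _ assms])
  show "pt (\<lambda>z. route (wt (fst z)) (fst (snd z)) (fst (snd (snd z))) (snd (snd (snd z))))"
    unfolding route_def Let_def by (intro pt_rule)
qed

section \<open>Vertex order and lower bounds\<close>

fun plen :: "('a \<Rightarrow> 'a \<Rightarrow> nat) \<Rightarrow> 'a list \<Rightarrow> nat" where
  "plen w (x # y # zs) = w x y + plen w (y # zs)"
| "plen w _ = 0"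

lemma plen_append: "xs \<noteq> [] \<Longrightarrow> ys \<noteq> [] \<Longrightarrow> plen w (xs @ ys) = plen w xs + w (last xs) (hd ys) + plen w ys"
proof (induction w xs rule: plen.induct)
  case ("2_2" w v)
  then show ?case by (cases ys) auto
qed auto

lemma plen_map: "plen w (map f xs) = plen (\<lambda>a b. w (f a) (f b)) xs"
  by (induction xs rule: induct_list012) auto

lemma plen_mono: "(\<And>x y. x \<in> set xs \<Longrightarrow> y \<in> set xs \<Longrightarrow> w x y \<le> w' x y) \<Longrightarrow> plen w xs \<le> plen w' xs"
  by (induction xs rule: induct_list012) (auto intro!: add_mono)

text \<open>
  An ultrametric on the ranks in Prim's order, where \<open>W j\<close> is the length of the edge by which the
  vertex of rank \<open>j\<close> is reached. The given distances dominate it.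
\<close>

definition umax :: "(nat \<Rightarrow> nat) \<Rightarrow> nat \<Rightarrow> nat \<Rightarrow> nat" where
  "umax W a b = Max (insert 0 (W ` {min a b<..max a b}))"

lemma umax_le_iff: "umax W a b \<le> c \<longleftrightarrow> (\<forall>j. min a b < j \<and> j \<le> max a b \<longrightarrow> W j \<le> c)"
  unfolding umax_def by (subst Max_le_iff) auto

lemma le_umax: "min a b < j \<Longrightarrow> j \<le> max a b \<Longrightarrow> W j \<le> umax W a b"
  using umax_le_iff[of W a b "umax W a b"] by blast

lemma umax_commute: "umax W a b = umax W b a"
  by (simp add: umax_def min.commute max.commute)

text \<open>The walk does not start at \<open>t\<close>, so every visit to \<open>t\<close> has a
  predecessor. Cutting out all visits to the top rank saves at least \<open>W t\<close>.\<close>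

lemma umax_remove_top:
  assumes "t \<in> set xs" "xs \<noteq> []" "hd xs \<noteq> t" "\<forall>x\<in>set xs. x \<le> t"
  shows "plen (umax W) (filter (\<lambda>x. x \<noteq> t) xs) + W t \<le> plen (umax W) xs"
  using assms
proof (induction "length xs" arbitrary: xs rule: less_induct)
  case less
  from less.prems obtain a b ys where xs: "xs = a # b # ys"
    by (cases xs; cases "tl xs") auto
  have a: "a < t" using less.prems xs by auto
  have top: "W t \<le> umax W c t" if "c < t" for c using that by (intro le_umax) auto
  \<comment> \<open>The interval between \<open>c\<close> and \<open>d\<close> lies within the one
    from the smaller of them to \<open>t\<close>: that leg pays for the shortcut, and the other leg
    for \<open>W t\<close>.\<close>
  have sub: "umax W c d + W t \<le> umax W c t + umax W t d" if "c < t" "d < t" for c d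
  proof (cases "c \<le> d")
    case True
    then have "umax W c d \<le> umax W c t" unfolding umax_le_iff using that by (auto intro!: le_umax)
    then show ?thesis using top[OF that(2)] by (simp add: umax_commute)
  next
    case False
    then have "umax W c d \<le> umax W t d" unfolding umax_le_iff using that by (auto intro!: le_umax)
    then show ?thesis using top[OF that(1)] by simp
  qed
  show ?case
  proof (cases "b = t")
    case False
    have "filter (\<lambda>x. x \<noteq> t) (b # ys) \<noteq> []" using False by simp
    have "plen (umax W) (filter (\<lambda>x. x \<noteq> t) (b # ys)) + W t \<le> plen (umax W) (b # ys)"
      by (rule less.hyps) (use less.prems xs False a in simp_all)
    then show ?thesis using xs False a by simp
  next
    case b: True
    show ?thesis
    proof (cases ys)
      case Nil
      then show ?thesis using xs b a top[OF a] by auto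
    next
      case (Cons c zs)
      show ?thesis
      proof (cases "c = t")
        case True
        have "plen (umax W) (filter (\<lambda>x. x \<noteq> t) (a # t # zs)) + W t \<le> plen (umax W) (a # t # zs)"
          by (rule less.hyps) (use less.prems xs b Cons True a in simp_all)
        then show ?thesis using xs b Cons True a by simp
      next
        case False
        have c: "c < t" using False less.prems xs Cons by auto
        have "plen (umax W) (filter (\<lambda>x. x \<noteq> t) (c # zs)) \<le> plen (umax W) (c # zs)"
        proof (cases "t \<in> set zs")
          case True
          then have "plen (umax W) (filter (\<lambda>x. x \<noteq> t) (c # zs)) + W t \<le> plen (umax W) (c # zs)"
            by (intro less.hyps) (use less.prems xs Cons False in simp_all)
          then show ?thesis by simp
        next
          case False
          then have "filter (\<lambda>x. x \<noteq> t) (c # zs) = c # zs" using c by (auto simp: filter_id_conv)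
          then show ?thesis by simp
        qed
        moreover have "filter (\<lambda>x. x \<noteq> t) xs = a # c # filter (\<lambda>x. x \<noteq> t) zs"
          using xs b Cons a c by simp
        ultimately show ?thesis using sub[OF a c] xs b Cons False by simp
      qed
    qed
  qed
qed

text \<open>The weight of Prim's tree bounds every walk through all ranks from below: removing the
  ranks from the top releases one \<open>W j\<close> after the other.\<close>

lemma umax_walk:
  assumes "xs \<noteq> []" "hd xs = 0" "set xs = {..t}"
  shows "(\<Sum>j=1..t. W j) \<le> plen (umax W) xs"
  using assms
proof (induction t arbitrary: xs)
  case (Suc t)
  let ?ys = "filter (\<lambda>x. x \<noteq> Suc t) xs"
  obtain zs where zs: "xs = 0 # zs" using Suc.prems(1,2) by (cases xs) simp_all
  have "(\<Sum>j=1..t. W j) \<le> plen (umax W) ?ys"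
  proof (rule Suc.IH)
    show "?ys \<noteq> []" "hd ?ys = 0" using zs by simp_all
    show "set ?ys = {..t}" unfolding set_filter Suc.prems(3) atMost_Suc by auto
  qed
  moreover have "plen (umax W) ?ys + W (Suc t) \<le> plen (umax W) xs"
  proof (rule umax_remove_top)
    show "Suc t \<in> set xs" "\<forall>x\<in>set xs. x \<le> Suc t" unfolding Suc.prems(3) by simp_all
    show "xs \<noteq> []" "hd xs \<noteq> Suc t" using Suc.prems(1,2) by simp_all
  qed
  ultimately show ?case by simp
qed simp

section \<open>Prim's path compared with an arbitrary walk\<close>

locale weights =
  fixes w :: "nat \<Rightarrow> nat \<Rightarrow> nat" and n :: nat
  assumes w_refl: "u < n \<Longrightarrow> w u u = 0"
    and w_sym: "u < n \<Longrightarrow> v < n \<Longrightarrow> w u v = w v u"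
    and w_triangle: "u < n \<Longrightarrow> v < n \<Longrightarrow> x < n \<Longrightarrow> w u x \<le> w u v + w v x"
begin

lemma plen_insert_after:
  assumes "set xs \<subseteq> {..<n}" "u \<in> set xs" "v < n"
  shows "plen w (insert_after u v xs) \<le> plen w xs + 2 * w u v"
  using assms
proof (induction xs rule: induct_list012)
  case (3 x y zs)
  show ?case
  proof (cases "x = u")
    case True
    then have "w v y \<le> w v u + w u y" "w v u = w u v"
      using 3(3-5) by (auto intro: w_triangle w_sym)
    then show ?thesis using True by simp
  next
    case False
    then show ?thesis using 3 by (cases "y = u") auto
  qed
qed auto

lemma plen_skip:
  assumes "insert x (insert y (set zs)) \<subseteq> {..<n}"
  shows "plen w (x # zs) \<le> w x y + plen w (y # zs)"
  using assms w_triangle by (cases zs) auto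

lemma plen_filter:
  assumes "set xs \<subseteq> {..<n}"
  shows "plen w (filter P xs) \<le> plen w xs"
  using assms
proof (induction "length xs" arbitrary: xs rule: less_induct)
  case less
  show ?case
  proof (cases xs)
    case (Cons x ys)
    show ?thesis
    proof (cases "\<not> P x \<or> ys = []")
      case True
      have "plen w (filter P ys) \<le> plen w ys" using less Cons by simp
      also have "\<dots> \<le> plen w xs" using Cons by (cases ys) auto
      finally show ?thesis using True Cons by auto
    next
      case False
      then obtain y zs where ys: "ys = y # zs" by (cases ys) auto
      show ?thesis
      proof (cases "P y")
        case True
        have "plen w (filter P ys) \<le> plen w ys" using less Cons by simp
        then show ?thesis using True False ys Cons by simp
      next
        case Py: False
        have "plen w (filter P (x # zs)) \<le> plen w (x # zs)"
          by (rule less.hyps) (use less.prems Cons ys in auto)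
        also have "\<dots> \<le> plen w xs" using plen_skip[of x y zs] less.prems Cons ys by simp
        finally show ?thesis using Py Cons ys False by simp
      qed
    qed
  qed simp
qed

end

lemma set_insert_after: "u \<in> set xs \<Longrightarrow> set (insert_after u v xs) = insert v (set xs)"
  by (induction xs) auto

lemma length_insert_after: "u \<in> set xs \<Longrightarrow> length (insert_after u v xs) = Suc (length xs)"
  by (induction xs) auto

lemma distinct_insert_after: "distinct xs \<Longrightarrow> v \<notin> set xs \<Longrightarrow> distinct (insert_after u v xs)"
proof (induction xs)
  case (Cons x xs)
  have "set (insert_after u v xs) \<subseteq> insert v (set xs)" by (induction xs) auto
  then show ?case using Cons by auto
qed simp

lemma growE:
  assumes "xs \<noteq> []" "\<not> set T \<subseteq> set xs"
  obtains u v where "u \<in> set xs" "v \<in> set T" "v \<notin> set xs" "grow w T xs = insert_after u v xs"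
    "\<And>u' v'. u' \<in> set xs \<Longrightarrow> v' \<in> set T \<Longrightarrow> v' \<notin> set xs \<Longrightarrow> w u v \<le> w u' v'"
proof -
  define Q where "Q = filter (\<lambda>v. v \<notin> set xs) T"
  define P where "P = concat (map (\<lambda>u. map (\<lambda>v. (u, v)) Q) xs)"
  define f where "f = (\<lambda>p. w (fst p) (snd p))"
  define p where "p = argmin f P"
  have Q: "Q \<noteq> []" using assms(2) by (auto simp: Q_def filter_empty_conv)
  then have "P \<noteq> []" using assms(1) unfolding P_def by auto
  then have "p \<in> set P" unfolding p_def by (rule argmin_mem)
  then have p: "fst p \<in> set xs" "snd p \<in> set T" "snd p \<notin> set xs" unfolding P_def Q_def by auto
  have "w (fst p) (snd p) \<le> w u' v'" if "u' \<in> set xs" "v' \<in> set T" "v' \<notin> set xs" for u' v'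
  proof -
    have "(u', v') \<in> set P" using that by (auto simp: P_def Q_def)
    from argmin_le[OF this, of f] show ?thesis by (simp add: p_def f_def)
  qed
  moreover have "grow w T xs = insert_after (fst p) (snd p) xs"
    using Q unfolding grow_def Let_def Q_def[symmetric] P_def[symmetric] f_def[symmetric] p_def[symmetric]
    by simp
  ultimately show ?thesis using p that by blast
qed

lemma rec_list_funpow: "rec_list a (\<lambda>_ _ r. f r) xs = (f ^^ length xs) a"
  by (induction xs) auto

context weights
begin

text \<open>Two orders of the same vertices are tracked: \<open>X\<close> is the path, while
  \<open>vs\<close> is the order of arrival, and \<open>W j\<close> is the length of the edge that
  brought \<open>vs ! j\<close>. The last clause records Prim's choice, that no edge from the first
  \<open>j\<close> vertices to the remaining ones is shorter than \<open>W j\<close>; this is what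
  makes the ultrametric a lower bound for \<open>w\<close>.\<close>

lemma prim_chain:
  assumes T: "distinct T" "set T \<subseteq> {..<n}" "r \<in> set T" and i: "i < length T"
  defines "X \<equiv> (grow w T ^^ i) [r]"
  shows "distinct X \<and> hd X = r \<and> X \<noteq> [] \<and> set X \<subseteq> set T \<and> length X = Suc i \<and>
    (\<exists>vs W. length vs = Suc i \<and> distinct vs \<and> vs ! 0 = r \<and> set vs = set X \<and>
      plen w X \<le> 2 * (\<Sum>j=1..i. W j) \<and>
      (\<forall>j a v. 1 \<le> j \<and> j \<le> i \<and> a < j \<and> v \<in> set T \<and> v \<notin> set (take j vs) \<longrightarrow> W j \<le> w (vs ! a) v))"
  using i unfolding X_def
proof (induction i)
  case 0
  then show ?case using T(3) by (auto intro!: exI[of _ "[r]"])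
next
  case (Suc i)
  define X where "X = (grow w T ^^ i) [r]"
  from Suc obtain vs W where X: "distinct X" "hd X = r" "X \<noteq> []" "set X \<subseteq> set T" "length X = Suc i"
    and vs: "length vs = Suc i" "distinct vs" "vs ! 0 = r" "set vs = set X"
    and W: "plen w X \<le> 2 * (\<Sum>j=1..i. W j)"
      "\<And>j a v. 1 \<le> j \<Longrightarrow> j \<le> i \<Longrightarrow> a < j \<Longrightarrow> v \<in> set T \<Longrightarrow> v \<notin> set (take j vs) \<Longrightarrow> W j \<le> w (vs ! a) v"
    unfolding X_def by fastforce
  have "card (set X) < card (set T)" using X(1,5) T(1) Suc.prems by (simp add: distinct_card)
  then have "\<not> set T \<subseteq> set X" by (metis card_mono leD List.finite_set)
  with X(3) obtain u v where uv: "u \<in> set X" "v \<in> set T" "v \<notin> set X" "grow w T X = insert_after u v X"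
    "\<And>u' v'. u' \<in> set X \<Longrightarrow> v' \<in> set T \<Longrightarrow> v' \<notin> set X \<Longrightarrow> w u v \<le> w u' v'"
    by (rule growE[of X T w]) auto
  have S: "(grow w T ^^ Suc i) [r] = insert_after u v X" using uv(4) by (simp add: X_def)
  define W' where "W' = W(Suc i := w u v)"
  have "hd (insert_after u v X) = r" using X(2,3) by (cases X) auto
  moreover have "(vs @ [v]) ! 0 = r" using vs(1,3) by (simp add: nth_append)
  moreover have "plen w (insert_after u v X) \<le> 2 * (\<Sum>j=1..Suc i. W' j)"
  proof -
    have "(\<Sum>j=1..i. W' j) = (\<Sum>j=1..i. W j)" by (intro sum.cong) (auto simp: W'_def)
    moreover have "set X \<subseteq> {..<n}" "v < n" using X(4) T(2) uv(2) by auto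
    ultimately show ?thesis using plen_insert_after[of X u v] uv(1) W(1)
      by (simp add: W'_def)
  qed
  moreover have "W' j \<le> w ((vs @ [v]) ! a) x"
    if "1 \<le> j" "j \<le> Suc i" "a < j" "x \<in> set T" "x \<notin> set (take j (vs @ [v]))" for j a x
  proof (cases "j = Suc i")
    case True
    have "vs ! a \<in> set X" using that(3) vs(1,4) True nth_mem[of a vs] by simp
    then show ?thesis using uv(5)[of "vs ! a" x] that vs(1,4) True by (simp add: W'_def nth_append)
  next
    case False
    then show ?thesis using W(2)[of j a x] that vs(1) by (simp add: W'_def nth_append)
  qed
  ultimately show ?case unfolding S
    using set_insert_after[OF uv(1), of v] length_insert_after[OF uv(1), of v]
      distinct_insert_after[OF X(1) uv(3), of u] X vs uv(1-3)
    by (auto intro!: exI[of _ "vs @ [v]"] exI[of _ W'])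
qed

text \<open>The path costs at most twice the tree by \<open>prim_chain\<close>. The tree costs at
  most \<open>q\<close>: restricted to \<open>T\<close> and renamed to ranks, \<open>q\<close> is a
  walk as in \<open>umax_walk\<close>, and \<open>umax\<close> is dominated by
  \<open>w\<close>.\<close>

lemma vertex_order:
  assumes T: "distinct T" "set T \<subseteq> {..<n}" "r \<in> set T"
  defines "X \<equiv> vertex_order w T r"
  shows "distinct X" "set X = set T" "hd X = r"
    and "\<And>q. q \<noteq> [] \<Longrightarrow> hd q = r \<Longrightarrow> set T \<subseteq> set q \<Longrightarrow> set q \<subseteq> {..<n} \<Longrightarrow> plen w X \<le> 2 * plen w q"
proof -
  obtain t where t: "length T = Suc t" using T(3) by (cases T) auto
  define Y where "Y = (grow w T ^^ t) [r]"
  from prim_chain[OF T, of t] t obtain vs W where Y: "distinct Y" "hd Y = r" "set Y \<subseteq> set T" "length Y = Suc t"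
    and vs: "length vs = Suc t" "distinct vs" "vs ! 0 = r" "set vs = set Y"
    and W: "plen w Y \<le> 2 * (\<Sum>j=1..t. W j)"
      "\<And>j a v. 1 \<le> j \<Longrightarrow> j \<le> t \<Longrightarrow> a < j \<Longrightarrow> v \<in> set T \<Longrightarrow> v \<notin> set (take j vs) \<Longrightarrow> W j \<le> w (vs ! a) v"
    unfolding Y_def[symmetric] by fastforce
  have YT: "set Y = set T"
    by (rule card_subset_eq) (use Y T(1) t in \<open>simp_all add: distinct_card\<close>)
  then have "grow w T Y = Y" by (simp add: grow_def)
  then have X: "X = Y" unfolding X_def vertex_order_def rec_list_funpow t by (simp add: Y_def)
  show "distinct X" "set X = set T" "hd X = r" using X Y YT by simp_all
  fix q assume q: "q \<noteq> []" "hd q = r" "set T \<subseteq> set q" "set q \<subseteq> {..<n}"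
  define q' where "q' = filter (\<lambda>v. v \<in> set T) q"
  have q': "q' \<noteq> []" "hd q' = r" "set q' = set T" 
  proof -
    obtain qs where "q = r # qs" using q(1,2) by (cases q) simp_all
    then show "q' \<noteq> []" "hd q' = r" using T(3) by (simp_all add: q'_def)
    show "set q' = set T" using q(3) by (auto simp: q'_def)
  qed
  define rk where "rk = (\<lambda>v. THE i. i < length vs \<and> vs ! i = v)"
  have rk: "rk (vs ! i) = i" if "i < length vs" for i
    unfolding rk_def using that vs(2) by (auto simp: nth_eq_iff_index_eq)
  have rk_lt: "rk v < Suc t" "vs ! rk v = v" if "v \<in> set T" for v
    using that rk YT vs(1,4) by (metis in_set_conv_nth)+
  have "(\<Sum>j=1..t. W j) \<le> plen (umax W) (map rk q')"
  proof (rule umax_walk)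
    show "map rk q' \<noteq> []" using q'(1) by simp
    show "hd (map rk q') = 0" using q'(1,2) rk[of 0] vs(1,3) by (simp add: hd_map)
    have "rk ` set T = {..<Suc t}"
    proof (intro equalityI subsetI)
      fix i assume "i \<in> {..<Suc t}"
      then show "i \<in> rk ` set T" using rk[of i] vs(1,4) YT nth_mem[of i vs] by (metis image_eqI lessThan_iff)
    qed (use rk_lt in auto)
    then show "set (map rk q') = {..t}" using q'(3) by (simp add: lessThan_Suc_atMost)
  qed
  also have "\<dots> \<le> plen w q'" unfolding plen_map
  proof (rule plen_mono)
    \<comment> \<open>When rank \<open>j\<close> was chosen, \<open>x\<close> was in the tree and
      \<open>y\<close> was not, so the edge between them was a candidate.\<close>
    have *: "W j \<le> w x y" if "x \<in> set T" "y \<in> set T" "rk x < j" "j \<le> rk y" for x y j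
    proof -
      have "y \<notin> set (take j vs)"
      proof
        assume "y \<in> set (take j vs)"
        then obtain i where "i < j" "i < length vs" "y = vs ! i"
          by (auto simp: in_set_conv_nth)
        then show False using rk[of i] that(4) by simp
      qed
      then show ?thesis using W(2)[of j "rk x" y] that rk_lt(1)[OF that(2)] rk_lt(2)[OF that(1)] by simp
    qed
    fix x y assume xy: "x \<in> set q'" "y \<in> set q'"
    then have "w x y = w y x" using q'(3) T(2) by (intro w_sym) auto
    show "umax W (rk x) (rk y) \<le> w x y"
      unfolding umax_le_iff
    proof (intro allI impI)
      fix j assume "min (rk x) (rk y) < j \<and> j \<le> max (rk x) (rk y)"
      then have "rk x < j \<and> j \<le> rk y \<or> rk y < j \<and> j \<le> rk x" by linarith
      then show "W j \<le> w x y"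
        using *[of x y j] *[of y x j] xy q'(3) \<open>w x y = w y x\<close> by auto
    qed
  qed
  also have "\<dots> \<le> plen w q" unfolding q'_def by (rule plen_filter[OF q(4)])
  finally show "plen w X \<le> 2 * plen w q" using W(1) X by simp
qed

section \<open>Distances and positions along the path\<close>

lemma position_le_plen: "position w v xs \<le> plen w xs"
  by (induction xs rule: induct_list012) auto

lemma le_position:
  assumes "set xs \<subseteq> {..<n}" "v \<in> set xs"
  shows "w (hd xs) v \<le> position w v xs"
  using assms
proof (induction xs rule: induct_list012)
  case (3 x y zs)
  show ?case
  proof (cases "x = v")
    case False
    then have "w y v \<le> position w v (y # zs)" using 3 by simp
    moreover have "w x v \<le> w x y + w y v" using 3(3,4) by (intro w_triangle) auto
    ultimately show ?thesis using False by simp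
  qed (use 3 w_refl in auto)
qed (use w_refl in auto)

lemma le_position_diff:
  assumes "set xs \<subseteq> {..<n}" "u \<in> set xs" "v \<in> set xs" "position w u xs \<le> position w v xs"
  shows "position w u xs + w u v \<le> position w v xs"
  using assms
proof (induction xs rule: induct_list012)
  case (3 x y zs)
  have uv: "u < n" "v < n" using 3(3-5) by auto
  show ?case
  proof (cases "u = x \<or> v = x")
    case True
    then show ?thesis
    proof
      assume "u = x"
      then show ?thesis using le_position[OF 3(3,5)] by simp
    next
      \<comment> \<open>Weights may vanish between distinct vertices, so \<open>u\<close> can share
        the position 0 of \<open>v\<close>.\<close>
      assume v: "v = x"
      then have "position w u (x # y # zs) = 0" using 3(6) by simp
      moreover have "w x u \<le> position w u (x # y # zs)" using le_position[OF 3(3,4)] by simp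
      ultimately show ?thesis using w_sym[OF uv] v by simp
    qed
  next
    case False
    have "position w u (y # zs) + w u v \<le> position w v (y # zs)"
      by (rule 3(2)) (use 3(3-6) False in simp_all)
    then show ?thesis using False by simp
  qed
qed (use w_refl in auto)

lemma sorted_position:
  assumes "distinct xs"
  shows "sorted_wrt (\<lambda>u v. position w u xs \<le> position w v xs) xs"
  using assms
proof (induction xs)
  case (Cons x xs)
  have "sorted_wrt (\<lambda>u v. position w u (x # xs) \<le> position w v (x # xs)) xs"
    by (rule sorted_wrt_mono_rel[OF _ Cons.IH]) (use Cons.prems in auto)
  then show ?case by simp
qed simp

lemma plen_sorted:
  assumes "set xs \<subseteq> {..<n}" "set vs \<subseteq> set xs" "vs \<noteq> []"
    "sorted_wrt (\<lambda>u v. position w u xs \<le> position w v xs) vs"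
  shows "position w (hd vs) xs + plen w vs \<le> position w (last vs) xs"
  using assms(2-)
proof (induction vs rule: induct_list012)
  case (3 u v vs)
  then show ?case using le_position_diff[OF assms(1), of u v] by auto
qed auto

end

section \<open>Lower bounds from a preemptive tour\<close>

fun stops :: "action list \<Rightarrow> nat list" where
  "stops [] = []"
| "stops (Move v # \<sigma>) = v # stops \<sigma>"
| "stops (Pickup i # \<sigma>) = stops \<sigma>"
| "stops (Drop i # \<sigma>) = stops \<sigma>"

lemma stops_append: "stops (\<sigma> @ \<tau>) = stops \<sigma> @ stops \<tau>"
  by (induction \<sigma> rule: stops.induct) auto

lemma acts_append: "acts I c (\<sigma> @ \<tau>) = Option.bind (acts I c \<sigma>) (\<lambda>c'. acts I c' \<tau>)"
  by (induction \<sigma> arbitrary: c) (auto intro: bind_cong)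

text \<open>An object can leave or reach a place only while the vehicle is there. This is how a tour
  is seen to visit both ends of every object that has to move.\<close>

lemma acts_stops:
  assumes "acts I (u, loc) \<sigma> = Some (u', loc')"
  shows "set (stops \<sigma>) \<subseteq> {..<nverts I} \<and> u' = last (u # stops \<sigma>) \<and>
    (\<forall>i. loc' i \<noteq> loc i \<longrightarrow> set_option (loc i) \<union> set_option (loc' i) \<subseteq> set (u # stops \<sigma>))"
  using assms
proof (induction \<sigma> arbitrary: u loc rule: stops.induct)
  case (3 j \<sigma>)
  then have j: "loc j = Some u" and "acts I (u, loc(j := None)) \<sigma> = Some (u', loc')"
    by (auto split: if_splits)
  note IH = 3(1)[OF this(2)]
  have "set_option (loc i) \<union> set_option (loc' i) \<subseteq> set (u # stops \<sigma>)" if "loc' i \<noteq> loc i" for i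
  proof (cases "i = j")
    case True
    have "set_option (loc' j) \<subseteq> set (u # stops \<sigma>)"
    proof (cases "loc' j = None")
      case False
      then have "loc' j \<noteq> (loc(j := None)) j" by simp
      with IH show ?thesis by blast
    qed simp
    then show ?thesis using j True by simp
  next
    case False
    then have "loc' i \<noteq> (loc(j := None)) i" using that by simp
    with IH have "set_option ((loc(j := None)) i) \<union> set_option (loc' i) \<subseteq> set (u # stops \<sigma>)" by blast
    then show ?thesis using False by simp
  qed
  then show ?case using IH by simp
next
  case (4 j \<sigma>)
  then have j: "loc j = None" and "acts I (u, loc(j := Some u)) \<sigma> = Some (u', loc')"
    by (auto split: if_splits)
  note IH = 4(1)[OF this(2)]
  have "set_option (loc i) \<union> set_option (loc' i) \<subseteq> set (u # stops \<sigma>)" if "loc' i \<noteq> loc i" for i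
  proof (cases "i = j")
    case True
    have "set_option (loc' j) \<subseteq> set (u # stops \<sigma>)"
    proof (cases "loc' j = Some u")
      case False
      then have "loc' j \<noteq> (loc(j := Some u)) j" by simp
      with IH show ?thesis by blast
    qed simp
    then show ?thesis using j True by simp
  next
    case False
    then have "loc' i \<noteq> (loc(j := Some u)) i" using that by simp
    with IH have "set_option ((loc(j := Some u)) i) \<union> set_option (loc' i) \<subseteq> set (u # stops \<sigma>)" by blast
    then show ?thesis using False by simp
  qed
  then show ?case using IH by simp
next
  case (2 v \<sigma>)
  then have v: "v < nverts I" and "acts I (v, loc) \<sigma> = Some (u', loc')"
    by (auto split: if_splits)
  note IH = 2(1)[OF this(2)]
  then have "set_option (loc i) \<union> set_option (loc' i) \<subseteq> set (u # v # stops \<sigma>)" if "loc' i \<noteq> loc i" for i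
    using that by (meson order_trans set_subset_Cons)
  then show ?case using IH v by simp
qed simp

abbreviation carried :: "dial_a_ride \<Rightarrow> (nat \<Rightarrow> nat option) \<Rightarrow> nat set" where
  "carried I loc \<equiv> {j. j < nobjects I \<and> loc j = None}"

definition place :: "nat \<Rightarrow> nat option \<Rightarrow> nat" where
  "place u x = (case x of None \<Rightarrow> u | Some v \<Rightarrow> v)"

lemma set_objects:
  "set (objects ds) = (\<lambda>i. (i, ds ! i)) ` {i. i < length ds \<and> fst (ds ! i) \<noteq> snd (ds ! i)}"
  by (auto simp: objects_def endpoint_def set_enum image_iff)

lemma set_terminals:
  "set (terminals r zs) = insert r (\<Union>z\<in>set zs. {endpoint True z, endpoint False z})"
  by (auto simp: terminals_def)

context weights
begin

text \<open>The potential is the total distance of the objects from their destinations, with carried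
  objects placed at the vehicle. A move lowers it only through the at most \<open>capacity I\<close>
  carried objects, for each by at most the length of the move; pickups and drops leave it
  unchanged.\<close>

lemma acts_potential:
  assumes "acts I (u, loc) \<sigma> = Some (u', loc')" "n = nverts I" "u < n"
    "\<And>i v. i < nobjects I \<Longrightarrow> loc i = Some v \<Longrightarrow> v < n"
    "\<And>i. i < nobjects I \<Longrightarrow> dest I i < n"
    "card (carried I loc) \<le> capacity I"
  shows "(\<Sum>i<nobjects I. w (place u (loc i)) (dest I i)) \<le>
    capacity I * plen w (u # stops \<sigma>) + (\<Sum>i<nobjects I. w (place u' (loc' i)) (dest I i))"
  using assms
proof (induction \<sigma> arbitrary: u loc rule: stops.induct)
  case (2 v \<sigma>)
  let ?m = "nobjects I" and ?C = "carried I loc"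
  from 2(2) have v: "v < nverts I" and acts: "acts I (v, loc) \<sigma> = Some (u', loc')"
    by (auto split: if_splits)
  have "(\<Sum>i<?m. w (place u (loc i)) (dest I i)) \<le>
      (\<Sum>i<?m. w (place v (loc i)) (dest I i) + (if i \<in> ?C then w u v else 0))"
  proof (rule sum_mono)
    fix i assume "i \<in> {..<?m}"
    then show "w (place u (loc i)) (dest I i) \<le> w (place v (loc i)) (dest I i) + (if i \<in> ?C then w u v else 0)"
      using w_triangle[of u v "dest I i"] v 2(3,4,6)
      by (cases "loc i") (auto simp: place_def add.commute)
  qed
  also have "\<dots> = (\<Sum>i<?m. w (place v (loc i)) (dest I i)) + card ?C * w u v"
  proof -
    have "(\<Sum>i<?m. if i \<in> ?C then w u v else 0) = (\<Sum>i\<in>{..<?m} \<inter> ?C. w u v)"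
      by (rule sum.inter_restrict[symmetric]) simp
    also have "{..<?m} \<inter> ?C = ?C" by auto
    finally show ?thesis by (simp add: sum.distrib)
  qed
  also have "\<dots> \<le> (\<Sum>i<?m. w (place v (loc i)) (dest I i)) + capacity I * w u v"
    using 2(7) by simp
  also have "(\<Sum>i<?m. w (place v (loc i)) (dest I i)) \<le>
      capacity I * plen w (v # stops \<sigma>) + (\<Sum>i<?m. w (place u' (loc' i)) (dest I i))"
    by (rule 2(1)[OF acts]) (use 2 v in auto)
  finally show ?case by (simp add: algebra_simps)
next
  case (3 j \<sigma>)
  let ?loc = "loc(j := None)"
  from 3(2) have j: "j < nobjects I" "loc j = Some u" "card (carried I loc) < capacity I"
    and acts: "acts I (u, ?loc) \<sigma> = Some (u', loc')" by (auto split: if_splits)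
  have "{i. i < nobjects I \<and> ?loc i = None} = insert j (carried I loc)"
    using j(1) by auto
  then have "card {i. i < nobjects I \<and> ?loc i = None} \<le> capacity I"
    using card_insert_le_m1 j(2,3) by simp
  then have "(\<Sum>i<nobjects I. w (place u (?loc i)) (dest I i)) \<le>
    capacity I * plen w (u # stops \<sigma>) + (\<Sum>i<nobjects I. w (place u' (loc' i)) (dest I i))"
    by (intro 3(1)[OF acts]) (use 3 in \<open>auto split: if_splits\<close>)
  moreover have "place u (?loc i) = place u (loc i)" for i using j(2) by (simp add: place_def)
  ultimately show ?case by simp
next
  case (4 j \<sigma>)
  let ?loc = "loc(j := Some u)"
  from 4(2) have j: "j < nobjects I" "loc j = None"
    and acts: "acts I (u, ?loc) \<sigma> = Some (u', loc')" by (auto split: if_splits)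
  have "card {i. i < nobjects I \<and> ?loc i = None} \<le> card (carried I loc)"
    by (rule card_mono) (auto split: if_splits)
  then have "card {i. i < nobjects I \<and> ?loc i = None} \<le> capacity I" using 4(7) by simp
  then have "(\<Sum>i<nobjects I. w (place u (?loc i)) (dest I i)) \<le>
    capacity I * plen w (u # stops \<sigma>) + (\<Sum>i<nobjects I. w (place u' (loc' i)) (dest I i))"
    by (intro 4(1)[OF acts]) (use 4 in \<open>auto split: if_splits\<close>)
  moreover have "place u (?loc i) = place u (loc i)" for i using j(2) by (simp add: place_def)
  ultimately show ?case by simp
qed simp

lemma tour_lower_bounds:
  assumes "preemptive_tour I \<sigma>" "n = nverts I" "root_vertex I < n"
    "\<And>i. i < nobjects I \<Longrightarrow> src I i < n \<and> dest I i < n"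
  defines "q \<equiv> root_vertex I # stops \<sigma>"
  shows "(\<Sum>i<nobjects I. w (src I i) (dest I i)) \<le> capacity I * plen w q"
    "set q \<subseteq> {..<n}" "set (terminals (root_vertex I) (objects (demands I))) \<subseteq> set q"
proof -
  from assms(1) obtain loc where acts: "acts I (root_vertex I, \<lambda>i. Some (src I i)) \<sigma> = Some (root_vertex I, loc)"
    and loc: "\<And>i. i < nobjects I \<Longrightarrow> loc i = Some (dest I i)" unfolding preemptive_tour_def by blast
  have "(\<Sum>i<nobjects I. w (place (root_vertex I) (Some (src I i))) (dest I i)) \<le>
      capacity I * plen w q + (\<Sum>i<nobjects I. w (place (root_vertex I) (loc i)) (dest I i))"
    unfolding q_def by (rule acts_potential[OF acts assms(2,3)]) (use assms(4) in auto)
  then show "(\<Sum>i<nobjects I. w (src I i) (dest I i)) \<le> capacity I * plen w q"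
    using assms(4) w_refl loc by (simp add: place_def)
  show "set q \<subseteq> {..<n}" using acts_stops[OF acts] assms(2,3) by (simp add: q_def)
  have "src I i \<in> set q \<and> dest I i \<in> set q" if "i < nobjects I" "src I i \<noteq> dest I i" for i
  proof -
    have "loc i \<noteq> Some (src I i)" using loc[OF that(1)] that(2) by simp
    with acts_stops[OF acts] have "set_option (Some (src I i)) \<union> set_option (loc i) \<subseteq> set q"
      unfolding q_def by blast
    then show ?thesis using loc[OF that(1)] by simp
  qed
  then show "set (terminals (root_vertex I) (objects (demands I))) \<subseteq> set q"
    unfolding set_terminals set_objects by (auto simp: endpoint_def q_def)
qed

end

lemma distinct_objects: "distinct (objects ds)"
  unfolding objects_def using map_fst_enum[of ds] by (metis distinct_filter distinct_map distinct_upt)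

lemma inj_on_index_objects: "inj_on index (set (objects ds))"
  by (auto simp: set_objects inj_on_def)

lemma sum_objects_le:
  "(\<Sum>z\<in>set (objects ds). w (endpoint True z) (endpoint False z)) \<le> (\<Sum>i<length ds. w (fst (ds ! i)) (snd (ds ! i)))"
  for w :: "nat \<Rightarrow> nat \<Rightarrow> nat"
proof -
  have "(\<Sum>z\<in>set (objects ds). w (endpoint True z) (endpoint False z)) \<le>
      (\<Sum>z\<in>(\<lambda>i. (i, ds ! i)) ` {..<length ds}. w (endpoint True z) (endpoint False z))"
    by (rule sum_mono2) (auto simp: set_objects)
  also have "\<dots> = (\<Sum>i<length ds. w (fst (ds ! i)) (snd (ds ! i)))"
    by (subst sum.reindex) (auto simp: inj_on_def endpoint_def)
  finally show ?thesis .
qed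

section \<open>Clusters\<close>

abbreviation first_cluster :: "cluster list \<Rightarrow> nat \<Rightarrow> nat \<Rightarrow> cluster" where
  "first_cluster cs p q \<equiv> hd (filter (\<lambda>c. p \<in> set (inner c) \<or> q \<in> set (inner c)) cs)"

lemma filter_snoc_hd:
  "hd (filter P (cs @ [c])) = (if \<exists>x\<in>set cs. P x then hd (filter P cs) else if P c then c else hd [])"
  by (auto simp: filter_empty_conv hd_append)

context weights
begin

lemma zone_mono: "i \<le> j \<Longrightarrow> set (zone w R U v i) \<subseteq> set (zone w R U v j)"
  by (auto simp: zone_def intro: order_trans)

text \<open>Every radius that fails more than doubles the zone, which contains \<open>v\<close> from
  the start and never exceeds \<open>U\<close>. So some radius below \<open>length U\<close>
  succeeds, and the first one is at most logarithmic.\<close>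

lemma radius_props:
  fixes R :: nat
  assumes "v \<in> set U" "set U \<subseteq> {..<n}"
  defines "j \<equiv> radius w R U v"
  shows "length (zone w R U v (j + 1)) \<le> 2 * length (zone w R U v j)" "2 ^ j \<le> length U"
proof -
  let ?f = "\<lambda>i. length (zone w R U v i)"
  let ?P = "\<lambda>j. ?f (j + 1) \<le> 2 * ?f j"
  have pow: "2 ^ i \<le> ?f i" if "\<forall>i'<i. \<not> ?P i'" for i
    using that
  proof (induction i)
    case 0
    have "v \<in> set (zone w R U v 0)" using assms w_refl by (auto simp: zone_def)
    then have "0 < length (zone w R U v 0)" by (rule length_pos_if_in_set)
    then show ?case by (simp add: Suc_le_eq)
  next
    case (Suc i)
    then have "2 ^ i \<le> ?f i" "2 * ?f i < ?f (Suc i)" by auto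
    then show ?case by simp
  qed
  have le: "?f i \<le> length U" for i by (simp add: zone_def)
  have "\<exists>j<length U. ?P j"
  proof (rule ccontr)
    assume "\<not> ?thesis"
    then have "2 ^ length U \<le> length U" using pow[of "length U"] le[of "length U"] by fastforce
    then show False using less_exp[of "length U"] by simp
  qed
  then have ne: "filter ?P [0..<length U] \<noteq> []" by (auto simp: filter_empty_conv)
  then obtain js where js: "filter ?P [0..<length U] = j # js"
    unfolding j_def radius_def by (cases "filter ?P [0..<length U]") auto
  then have "j \<in> set (filter ?P [0..<length U])" by simp
  then show P: "?P j" by simp
  have "\<not> ?P i" if "i < j" for i
  proof
    assume "?P i"
    have "j < length U" using \<open>j \<in> set (filter ?P [0..<length U])\<close> by simp
    then have "i \<in> set (j # js)" unfolding js[symmetric] using \<open>?P i\<close> that by simp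
    moreover have "sorted_wrt (<) (j # js)" unfolding js[symmetric] by (intro sorted_wrt_filter) simp
    ultimately show False using that by auto
  qed
  then show "2 ^ j \<le> length U" using pow[of j] le[of j] by (auto intro: order_trans)
qed

text \<open>The condition \<open>2 ^ j \<le> length P\<close> expresses, without logarithms, that
  the radius is logarithmic in the number of points.\<close>

definition cluster_ok :: "nat \<Rightarrow> nat list \<Rightarrow> cluster \<Rightarrow> bool" where
  "cluster_ok R P c \<longleftrightarrow> center c \<in> set (inner c) \<and> set (inner c) \<subseteq> set (outer c) \<and> set (outer c) \<subseteq> set P \<and>
     length (outer c) \<le> 2 * length (inner c) \<and>
     (\<exists>j. 2 ^ j \<le> length P \<and> (\<forall>p\<in>set (outer c). w (center c) p \<le> 4 * R * (j + 1)))"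

text \<open>The last clause holds because the first cluster that covers one of two close points was
  created when both were still uncovered, so its larger zone could reach the other one. It speaks of
  \<open>p\<close> only; for \<open>q\<close> it is applied with the points exchanged.\<close>

definition carved :: "nat \<Rightarrow> nat list \<Rightarrow> nat list \<Rightarrow> cluster list \<Rightarrow> bool" where
  "carved R P vs cs \<longleftrightarrow> (\<forall>c\<in>set cs. cluster_ok R P c) \<and> distinct (concat (map inner cs)) \<and>
    set vs \<subseteq> (\<Union>c\<in>set cs. set (inner c)) \<and>
    (\<forall>p q. p \<in> set P \<longrightarrow> q \<in> set P \<longrightarrow> w p q \<le> 4 * R \<longrightarrow>
      (\<exists>c\<in>set cs. p \<in> set (inner c) \<or> q \<in> set (inner c)) \<longrightarrow> p \<in> set (outer (first_cluster cs p q)))"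

lemma carvedD:
  assumes "carved R P vs cs"
  shows "\<forall>c\<in>set cs. cluster_ok R P c" "distinct (concat (map inner cs))"
    "set vs \<subseteq> (\<Union>c\<in>set cs. set (inner c))"
    "\<And>p q. p \<in> set P \<Longrightarrow> q \<in> set P \<Longrightarrow> w p q \<le> 4 * R \<Longrightarrow>
      \<exists>c\<in>set cs. p \<in> set (inner c) \<or> q \<in> set (inner c) \<Longrightarrow> p \<in> set (outer (first_cluster cs p q))"
  using assms unfolding carved_def by blast+

lemma carve:
  fixes R :: nat
  assumes "distinct P" "set P \<subseteq> {..<n}" "set vs \<subseteq> set P"
  defines "cs \<equiv> carve w R P vs"
  shows "carved R P vs cs"
  unfolding cs_def using assms(3)
proof (induction vs)
  case (Cons v vs)
  define cs where "cs = carve w R P vs"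
  define U where "U = uncovered P cs"
  have U: "set U = {p \<in> set P. \<forall>c\<in>set cs. p \<notin> set (inner c)}"
    by (auto simp: U_def uncovered_def)
  have "carved R P vs cs" unfolding cs_def using Cons by simp
  note IH = carvedD[OF this]
  show ?case
  proof (cases "v \<in> set U")
    case False
    then have "carve w R P (v # vs) = cs" by (simp add: cs_def U_def Let_def)
    moreover have "v \<in> (\<Union>c\<in>set cs. set (inner c))" using False U Cons.prems by auto
    ultimately show ?thesis using IH unfolding carved_def by simp
  next
    case True
    define j where "j = radius w R U v"
    define c where "c = new_cluster w R U v"
    have carve: "carve w R P (v # vs) = cs @ [c]" using True by (simp add: cs_def U_def c_def Let_def)
    have c: "center c = v" "inner c = zone w R U v j" "outer c = zone w R U v (j + 1)"
      by (simp_all add: c_def new_cluster_def j_def Let_def)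
    have Un: "set U \<subseteq> {..<n}" using U assms(2) by auto
    have dU: "distinct U" using assms(1) by (simp add: U_def uncovered_def)
    note rad = radius_props[OF True Un, of R, folded j_def]
    have inU: "set (inner c) \<subseteq> set U" "set (outer c) \<subseteq> set U" by (auto simp: c zone_def)
    have vc: "v \<in> set (inner c)" using True Un w_refl by (auto simp: c zone_def)
    have "length U \<le> length P" by (simp add: U_def uncovered_def)
    then have "2 ^ j \<le> length P" using rad(2) by simp
    moreover have "\<forall>p\<in>set (outer c). w (center c) p \<le> 4 * R * (j + 1)" by (auto simp: c zone_def)
    ultimately have "cluster_ok R P c"
      unfolding cluster_ok_def using vc rad(1) inU U zone_mono[of j "j + 1" R U v]
      by (auto simp: c)
    moreover have "distinct (concat (map inner (cs @ [c])))"
      using IH(2) dU inU U by (auto simp: c zone_def)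
    moreover have "p \<in> set (outer (first_cluster (cs @ [c]) p q))"
      if pq: "p \<in> set P" "q \<in> set P" "w p q \<le> 4 * R"
        "\<exists>c\<in>set (cs @ [c]). p \<in> set (inner c) \<or> q \<in> set (inner c)" for p q
    proof (cases "\<exists>c\<in>set cs. p \<in> set (inner c) \<or> q \<in> set (inner c)")
      case True
      then show ?thesis using IH(4)[OF pq(1-3) True] unfolding filter_snoc_hd by simp
    next
      case False
      then have pU: "p \<in> set U" "q \<in> set U" using pq U by auto
      have pqc: "p \<in> set (inner c) \<or> q \<in> set (inner c)" using False pq(4) by simp
      have "p \<in> set (outer c)"
      proof (cases "p \<in> set (inner c)")
        case True
        then show ?thesis using zone_mono[of j "j + 1" R U v] by (auto simp: c)
      next
        case False
        \<comment> \<open>Now \<open>q\<close> lies in the smaller zone; one more step of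
          \<open>4 * R\<close> absorbs the distance from \<open>q\<close> to
          \<open>p\<close>.\<close>
        then have "w v q \<le> 4 * R * j" using pqc by (auto simp: c zone_def)
        moreover have "w v p \<le> w v q + w q p" "w q p = w p q"
          using \<open>v \<in> set U\<close> pU Un by (auto intro!: w_triangle w_sym)
        ultimately have "w v p \<le> 4 * R * (j + 1)" using pq(3) by simp
        then show ?thesis using pU by (simp add: c zone_def)
      qed
      then show ?thesis using False pqc unfolding filter_snoc_hd by auto
    qed
    ultimately show ?thesis unfolding carve carved_def using IH(1,3) vc by auto
  qed
qed (simp add: carved_def)

end

section \<open>Counting batches and summing over scales\<close>

lemma concat_chunks: "concat (chunks k ys) = ys"
  by (induction ys) (auto split: list.split)

lemma chunks_mem:
  assumes "1 \<le> k" "c \<in> set (chunks k ys)"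
  shows "c \<noteq> []" "length c \<le> k"
proof -
  have "\<forall>c\<in>set (chunks k ys). c \<noteq> [] \<and> length c \<le> k"
    using assms(1) by (induction ys) (auto split: list.split)
  with assms(2) show "c \<noteq> []" "length c \<le> k" by auto
qed

text \<open>Only the first chunk may be short, which accounts for the single surplus
  \<open>k\<close>; the induction needs the exact length of the full ones.\<close>

lemma length_chunks:
  assumes "1 \<le> k"
  shows "k * length (chunks k ys) \<le> length ys + k"
proof -
  have "case chunks k ys of [] \<Rightarrow> ys = []
    | c # cs \<Rightarrow> length ys = length c + k * length cs \<and> 1 \<le> length c \<and> length c \<le> k"
    using assms by (induction ys) (auto split: list.splits)
  then show ?thesis using assms by (auto split: list.splits)
qed

lemma sum_set_le_sum_list: "(\<Sum>x\<in>set xs. f x) \<le> sum_list (map f xs)" for f :: "'a \<Rightarrow> nat"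
  by (induction xs) (auto simp: sum.insert_if)

text \<open>
  Small scales are bounded by a geometric series, and only logarithmically many are not small.
\<close>

lemma sum_scales:
  assumes "finite E" "\<And>e. e \<in> E \<Longrightarrow> 2 ^ e \<le> L" "n < 2 ^ F" "0 < n"
  shows "(\<Sum>e\<in>E. min (n * 2 ^ e) (2 * L)) \<le> 2 * L * (F + 1)"
proof -
  define E1 where "E1 = {e\<in>E. n * 2 ^ e \<le> L}"
  define E2 where "E2 = {e\<in>E. L < n * 2 ^ e}"
  have "(\<Sum>e\<in>E1. n * 2 ^ e) \<le> 2 * L"
  proof (cases "E1 = {}")
    case False
    define m where "m = Max E1"
    have fin: "finite E1" using assms(1) by (simp add: E1_def)
    then have m: "m \<in> E1" unfolding m_def using False by (rule Max_in)
    have "(\<Sum>e\<in>E1. n * 2 ^ e) \<le> (\<Sum>e\<in>{..<Suc m}. n * 2 ^ e)"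
      by (rule sum_mono2) (use fin in \<open>auto simp: m_def less_Suc_eq_le\<close>)
    also have "\<dots> = n * (2 ^ Suc m - 1)"
      unfolding sum_distrib_left[symmetric] atLeast0LessThan[symmetric] sum_power2 ..
    also have "\<dots> \<le> n * 2 ^ Suc m" by (rule mult_left_mono) auto
    also have "\<dots> \<le> 2 * L" using m by (simp add: E1_def)
    finally show ?thesis .
  qed simp
  moreover have "(\<Sum>e\<in>E2. 2 * L) \<le> 2 * L * F"
  proof (cases "E2 = {}")
    case False
    define m where "m = Min E2"
    have fin: "finite E2" using assms(1) by (simp add: E2_def)
    then have m: "m \<in> E2" "\<And>e. e \<in> E2 \<Longrightarrow> m \<le> e" unfolding m_def using False by auto
    \<comment> \<open>A scale that is not small lies between \<open>L / n\<close> and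
      \<open>L\<close>, so these exponents fit into a window of length \<open>F\<close>.\<close>
    have "e < m + F" if "e \<in> E2" for e
    proof -
      have "(2::nat) ^ e \<le> L" using that assms(2) by (simp add: E2_def)
      also have "L < n * 2 ^ m" using m(1) by (simp add: E2_def)
      also have "\<dots> \<le> 2 ^ F * 2 ^ m" using assms(3) by simp
      finally have "(2::nat) ^ e < 2 ^ (m + F)" by (simp add: power_add mult.commute)
      then show ?thesis by simp
    qed
    then have "E2 \<subseteq> {m..<m + F}" using m(2) by auto
    then have "card E2 \<le> F" using card_mono[of "{m..<m + F}" E2] by simp
    then show ?thesis by simp
  qed simp
  moreover have "(\<Sum>e\<in>E. min (n * 2 ^ e) (2 * L)) \<le> (\<Sum>e\<in>E1. n * 2 ^ e) + (\<Sum>e\<in>E2. 2 * L)"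
  proof -
    have "E = E1 \<union> E2" "E1 \<inter> E2 = {}" "finite E1" "finite E2" using assms(1) by (auto simp: E1_def E2_def)
    then have "(\<Sum>e\<in>E. min (n * 2 ^ e) (2 * L)) =
        (\<Sum>e\<in>E1. min (n * 2 ^ e) (2 * L)) + (\<Sum>e\<in>E2. min (n * 2 ^ e) (2 * L))"
      by (simp add: sum.union_disjoint)
    also have "\<dots> \<le> (\<Sum>e\<in>E1. n * 2 ^ e) + (\<Sum>e\<in>E2. 2 * L)"
      by (intro add_mono sum_mono) auto
    finally show ?thesis .
  qed
  ultimately have "(\<Sum>e\<in>E. min (n * 2 ^ e) (2 * L)) \<le> 2 * L + 2 * L * F" by linarith
  then show ?thesis by simp
qed

section \<open>Segments, homes and hubs of an instance\<close>

locale ride = weights +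
  fixes k r :: nat and ds :: "(nat \<times> nat) list"
  assumes w_pos: "u < n \<Longrightarrow> v < n \<Longrightarrow> u \<noteq> v \<Longrightarrow> 0 < w u v"
    and k_pos: "1 \<le> k" and r_less: "r < n"
    and ds_less: "i < length ds \<Longrightarrow> fst (ds ! i) < n \<and> snd (ds ! i) < n"
begin

abbreviation obs :: "object list" where "obs \<equiv> objects ds"

definition order :: "nat list" where "order = vertex_order w (terminals r obs) r"

definition L :: nat where "L = plen w order"

text \<open>The bit length of \<open>n\<close> stands in for the logarithm; as it is positive, it
  can absorb additive constants.\<close>

definition F :: nat where "F = floorlog 2 n"

lemma n_less: "n < 2 ^ F" unfolding F_def by (rule less_power_floorlog2)

lemma F_pos: "1 \<le> F"
proof (rule ccontr)
  assume "\<not> 1 \<le> F"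
  then have "F = 0" by simp
  then show False using n_less r_less by simp
qed

lemma terminals_less: "set (terminals r obs) \<subseteq> {..<n}"
  using r_less ds_less by (auto simp: set_terminals set_objects endpoint_def)

lemma order:
  "distinct order" "set order = set (terminals r obs)" "hd order = r" "set order \<subseteq> {..<n}" "order \<noteq> []"
  "\<And>q. q \<noteq> [] \<Longrightarrow> hd q = r \<Longrightarrow> set (terminals r obs) \<subseteq> set q \<Longrightarrow> set q \<subseteq> {..<n} \<Longrightarrow> L \<le> 2 * plen w q"
proof -
  have "distinct (terminals r obs)" "r \<in> set (terminals r obs)" by (simp_all add: terminals_def)
  note vo = vertex_order[OF this(1) terminals_less this(2), folded order_def L_def]
  show "distinct order" "set order = set (terminals r obs)" "hd order = r" by (fact vo)+
  then show "set order \<subseteq> {..<n}" "order \<noteq> []" using terminals_less \<open>r \<in> set (terminals r obs)\<close>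
    by fastforce+
  show "\<And>q. q \<noteq> [] \<Longrightarrow> hd q = r \<Longrightarrow> set (terminals r obs) \<subseteq> set q \<Longrightarrow> set q \<subseteq> {..<n} \<Longrightarrow> L \<le> 2 * plen w q"
    by (fact vo)
qed

abbreviation pos :: "nat \<Rightarrow> nat" where "pos v \<equiv> position w v order"

lemma pos_le_L: "pos v \<le> L"
  unfolding L_def by (rule position_le_plen)

text \<open>On natural numbers, maximum minus minimum is the absolute difference.\<close>

lemma w_le_pos_diff:
  assumes "u \<in> set order" "v \<in> set order"
  shows "w u v \<le> max (pos u) (pos v) - min (pos u) (pos v)"
proof (cases "pos u \<le> pos v")
  case True
  then show ?thesis using le_position_diff[OF order(4) assms True] by simp
next
  case False
  then have "pos v \<le> pos u" by simp
  moreover have "w v u = w u v" using assms order(4) by (intro w_sym) auto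
  ultimately show ?thesis using le_position_diff[OF order(4) assms(2,1)] by simp
qed

lemma same_segment:
  fixes a b R :: nat
  assumes "0 < R" "a div R = b div R"
  shows "max a b - min a b < R"
proof -
  have "a = a div R * R + a mod R" "b = a div R * R + b mod R" "a mod R < R" "b mod R < R"
    using assms by (metis div_mult_mod_eq mod_less_divisor)+
  then show ?thesis by linarith
qed

lemma rep:
  assumes "v \<in> set order"
  shows "rep w order R v \<in> set order" "pos (rep w order R v) div R = pos v div R"
proof -
  let ?l = "filter (\<lambda>u. pos u div R = pos v div R) order"
  have "?l \<noteq> []" using assms by (auto simp: filter_empty_conv)
  then have "hd ?l \<in> set ?l" by (rule hd_in_set)
  then show "rep w order R v \<in> set order" "pos (rep w order R v) div R = pos v div R"
    unfolding rep_def by simp_all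
qed

lemma w_rep:
  assumes "v \<in> set order" "0 < R"
  shows "w v (rep w order R v) < R"
  using w_le_pos_diff[OF assms(1) rep(1)[OF assms(1)]] same_segment[OF assms(2) rep(2)[OF assms(1), symmetric]]
  by (rule le_less_trans)

lemma set_reps: "set (reps w order R) = rep w order R ` set order"
  by (simp add: reps_def)

lemma reps_subset: "set (reps w order R) \<subseteq> set order"
  unfolding set_reps using rep(1) by auto

lemma distinct_reps: "distinct (reps w order R)"
  by (simp add: reps_def)

lemma length_reps_le: "length (reps w order R) \<le> n"
proof -
  have "card (set (reps w order R)) \<le> card {..<n}"
    by (rule card_mono) (use reps_subset order(4) in auto)
  then show ?thesis by (simp add: distinct_card[OF distinct_reps])
qed

text \<open>There are at most \<open>L div R + 1\<close> segments. This bound and the one by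
  \<open>n\<close> give the two arguments of the minimum in \<open>sum_scales\<close>.\<close>

lemma length_reps_le': "R * length (reps w order R) \<le> L + R"
proof -
  have "inj_on (\<lambda>p. pos p div R) (set (reps w order R))"
  proof (rule inj_onI)
    fix p q assume "p \<in> set (reps w order R)" "q \<in> set (reps w order R)" and eq: "pos p div R = pos q div R"
    then obtain u v where uv: "u \<in> set order" "v \<in> set order" "p = rep w order R u" "q = rep w order R v"
      unfolding set_reps by auto
    then have "pos u div R = pos v div R" using eq rep(2) by metis
    then show "p = q" unfolding uv(3,4) by (simp add: rep_def)
  qed
  then have "card (set (reps w order R)) \<le> card {..L div R}"
    by (rule card_inj_on_le) (auto intro!: div_le_mono pos_le_L)
  then have "R * length (reps w order R) \<le> R * (L div R + 1)"
    by (simp add: distinct_card[OF distinct_reps] del: mult_Suc_right)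
  also have "\<dots> \<le> L + R" by (simp add: algebra_simps)
  finally show ?thesis .
qed

lemma endpoint_in_order: "z \<in> set obs \<Longrightarrow> endpoint b z \<in> set order"
  unfolding order(2) set_terminals by (cases b) auto

lemma scale:
  assumes "z \<in> set obs"
  defines "R \<equiv> scale w z"
  shows "0 < R" "R \<le> w (endpoint True z) (endpoint False z)" "w (endpoint True z) (endpoint False z) < 2 * R"
    "\<exists>e. R = 2 ^ e" "R \<le> L"
proof -
  have ne: "endpoint True z \<noteq> endpoint False z" using assms(1) by (simp add: objects_def)
  have mem: "endpoint True z \<in> set order" "endpoint False z \<in> set order"
    using endpoint_in_order[OF assms(1)] by blast+
  then have "0 < w (endpoint True z) (endpoint False z)" using order(4) ne by (intro w_pos) auto
  from pow2_below_bounds[OF this] show R: "R \<le> w (endpoint True z) (endpoint False z)"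
    "w (endpoint True z) (endpoint False z) < 2 * R"
    by (simp_all add: R_def scale_def)
  show "0 < R" "\<exists>e. R = 2 ^ e" by (auto simp: R_def scale_def pow2_below_def)
  show "R \<le> L" using R(1) w_le_pos_diff[OF mem] pos_le_L[of "endpoint True z"] pos_le_L[of "endpoint False z"]
    by linarith
qed

lemma home:
  assumes "z \<in> set obs"
  shows "home w order b z \<in> set (reps w order (scale w z))"
    "w (endpoint b z) (home w order b z) < scale w z"
    "pos (home w order b z) div scale w z = pos (endpoint b z) div scale w z"
  using endpoint_in_order[OF assms] w_rep[OF _ scale(1)[OF assms]] rep(2)
  by (simp_all add: home_def set_reps)

lemma in_order_less: "v \<in> set order \<Longrightarrow> v < n"
  using order(4) by auto

lemma reps_less: "v \<in> set (reps w order R) \<Longrightarrow> v < n"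
  using order(4) reps_subset by blast

text \<open>From one home to its end, across to the other end and on to its home: at most
  \<open>R + 2 * R + R\<close>. This is the origin of the step \<open>4 * R\<close> in
  \<open>zone\<close>.\<close>

lemma home_dist:
  assumes "z \<in> set obs"
  shows "w (home w order b z) (home w order (\<not> b) z) \<le> 4 * scale w z"
proof -
  let ?h = "\<lambda>b. home w order b z" and ?e = "\<lambda>b. endpoint b z" and ?R = "scale w z"
  have less: "?h b < n" "?e b < n" for b
    using reps_less[OF home(1)[OF assms]] in_order_less[OF endpoint_in_order[OF assms]] by blast+
  have *: "w (?h True) (?h False) \<le> 4 * ?R"
  proof -
    have "w (?h True) (?h False) \<le> w (?h True) (?e True) + w (?e True) (?h False)"
      "w (?e True) (?h False) \<le> w (?e True) (?e False) + w (?e False) (?h False)"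
      by (intro w_triangle less)+
    moreover have "w (?h True) (?e True) = w (?e True) (?h True)" by (intro w_sym less)
    ultimately show ?thesis using home(2)[OF assms, of True] home(2)[OF assms, of False] scale(3)[OF assms] by linarith
  qed
  moreover have "w (?h False) (?h True) = w (?h True) (?h False)" by (intro w_sym less)
  ultimately show ?thesis by (cases b) simp_all
qed

abbreviation CL :: "nat \<Rightarrow> cluster list" where "CL R \<equiv> clusters w order R"

lemma carved_CL: "carved R (reps w order R) (reps w order R) (CL R)"
  unfolding clusters_def by (rule carve[OF distinct_reps _ subset_refl]) (use reps_less in blast)

lemmas CL = carvedD[OF carved_CL]

lemma hub:
  assumes "z \<in> set obs"
  obtains c where "c \<in> set (CL (scale w z))" "hub w order z = center c"
    "\<And>b. home w order b z \<in> set (outer c)"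
proof -
  let ?R = "scale w z"
  let ?h = "\<lambda>b. home w order b z"
  let ?P = "\<lambda>c. ?h True \<in> set (inner c) \<or> ?h False \<in> set (inner c)"
  define c where "c = hd (filter ?P (CL ?R))"
  have ex: "\<exists>c\<in>set (CL ?R). ?P c" using CL(3)[of ?R] home(1)[OF assms, of True] by auto
  then have "filter ?P (CL ?R) \<noteq> []" by (auto simp: filter_empty_conv)
  then have "c \<in> set (filter ?P (CL ?R))" unfolding c_def by (rule hd_in_set)
  then have c: "c \<in> set (CL ?R)" by simp
  \<comment> \<open>The first cluster depends only on the unordered pair of homes, so both uses of
    \<open>CL(4)\<close> speak of the same cluster.\<close>
  have sym: "(\<lambda>c. ?h False \<in> set (inner c) \<or> ?h True \<in> set (inner c)) = ?P" by auto
  have dist: "w (?h True) (?h False) \<le> 4 * ?R" "w (?h False) (?h True) \<le> 4 * ?R"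
    using home_dist[OF assms, of True] home_dist[OF assms, of False]
    by (simp_all only: not_True_eq_False not_False_eq_True)
  have ex': "\<exists>c\<in>set (CL ?R). ?h False \<in> set (inner c) \<or> ?h True \<in> set (inner c)"
    using ex by blast
  have "?h True \<in> set (outer c)" unfolding c_def
    by (rule CL(4)[OF home(1)[OF assms] home(1)[OF assms] dist(1) ex])
  moreover have "?h False \<in> set (outer c)" unfolding c_def
    by (rule CL(4)[OF home(1)[OF assms] home(1)[OF assms] dist(2) ex', unfolded sym])
  ultimately have "?h b \<in> set (outer c)" for b by (cases b) (simp_all only:)
  moreover have "hub w order z = center c" by (simp add: hub_def c_def)
  ultimately show ?thesis using c that by blast
qed

text \<open>Centers are representatives of segments and therefore lie on the path, so a walk along
  the path passes through all hubs.\<close>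

lemma hub_in_order: "z \<in> set obs \<Longrightarrow> hub w order z \<in> set order"
proof (erule hub)
  fix c assume "c \<in> set (CL (scale w z))" "hub w order z = center c"
  then show "hub w order z \<in> set order"
    using CL(1) reps_subset unfolding cluster_ok_def by (metis subset_iff)
qed

text \<open>From \<open>2 ^ j \<le> n < 2 ^ F\<close> follows \<open>j + 1 \<le> F\<close>; the
  strict inequality pays for the step from the smaller to the larger zone.\<close>

lemma hub_dist:
  assumes "z \<in> set obs"
  shows "w (hub w order z) (home w order b z) \<le> 4 * scale w z * F"
proof -
  let ?R = "scale w z"
  obtain c where c: "c \<in> set (CL ?R)" "hub w order z = center c" "\<And>b. home w order b z \<in> set (outer c)"
    by (rule hub[OF assms]) (rule that)
  then obtain j where j: "2 ^ j \<le> length (reps w order ?R)" "w (hub w order z) (home w order b z) \<le> 4 * ?R * (j + 1)"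
    using CL(1)[of ?R] unfolding cluster_ok_def by metis
  have "(2::nat) ^ j < 2 ^ F" using j(1) length_reps_le[of ?R] n_less by linarith
  then have "j + 1 \<le> F" by simp
  then have "4 * ?R * (j + 1) \<le> 4 * ?R * F" by (rule mult_left_mono) simp
  then show ?thesis using j(2) by simp
qed

text \<open>A key of scale \<open>R\<close> is determined by a cluster and a point of its larger
  zone. The larger zones have at most twice the size of the smaller ones, and these are disjoint
  sets of representatives. No logarithm is lost here.\<close>

lemma card_keys:
  "card {\<kappa> \<in> key w order b ` set obs. fst \<kappa> = R} \<le> 2 * length (reps w order R)"
proof -
  let ?X = "Sigma (set (CL R)) (\<lambda>c. set (outer c))"
  have "{\<kappa> \<in> key w order b ` set obs. fst \<kappa> = R} \<subseteq> (\<lambda>(c, p). (R, center c, p)) ` ?X"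
  proof
    fix \<kappa> assume "\<kappa> \<in> {\<kappa> \<in> key w order b ` set obs. fst \<kappa> = R}"
    then obtain z where z: "z \<in> set obs" "\<kappa> = (R, hub w order z, home w order b z)" "scale w z = R"
      by (auto simp: key_def)
    obtain c where "c \<in> set (CL (scale w z))" "hub w order z = center c" "\<And>b. home w order b z \<in> set (outer c)"
      by (rule hub[OF z(1)]) (rule that)
    then show "\<kappa> \<in> (\<lambda>(c, p). (R, center c, p)) ` ?X"
      using z by (auto simp: image_iff)
  qed
  then have "card {\<kappa> \<in> key w order b ` set obs. fst \<kappa> = R} \<le> card ?X"
    by (intro surj_card_le) auto
  also have "\<dots> = (\<Sum>c\<in>set (CL R). card (set (outer c)))" by (rule card_SigmaI) auto
  also have "\<dots> \<le> (\<Sum>c\<in>set (CL R). 2 * length (inner c))"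
  proof (rule sum_mono)
    fix c assume "c \<in> set (CL R)"
    then have "length (outer c) \<le> 2 * length (inner c)" using CL(1) by (auto simp: cluster_ok_def)
    then show "card (set (outer c)) \<le> 2 * length (inner c)" using card_length[of "outer c"] by linarith
  qed
  also have "\<dots> \<le> 2 * length (concat (map inner (CL R)))"
    using sum_set_le_sum_list[of "\<lambda>c. length (inner c)" "CL R"]
    by (simp add: sum_distrib_left[symmetric] length_concat comp_def)
  also have "length (concat (map inner (CL R))) = card (set (concat (map inner (CL R))))"
    using CL(2) by (simp add: distinct_card del: set_concat)
  also have "\<dots> \<le> card (set (reps w order R))"
    by (rule card_mono) (use CL(1)[of R] in \<open>auto simp: cluster_ok_def\<close>)
  also have "\<dots> = length (reps w order R)" by (rule distinct_card[OF distinct_reps])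
  finally show ?thesis by simp
qed

lemma sum_keys: "(\<Sum>\<kappa>\<in>key w order b ` set obs. fst \<kappa>) \<le> 4 * L * (F + 1)"
proof -
  let ?K = "key w order b ` set obs"
  define E where "E = {e. 2 ^ e \<in> scale w ` set obs}"
  have inj: "inj_on (\<lambda>e. 2 ^ e :: nat) A" for A by (auto simp: inj_on_def)
  have img: "(\<lambda>e. 2 ^ e) ` E = scale w ` set obs"
  proof (intro equalityI subsetI)
    fix R assume R: "R \<in> scale w ` set obs"
    then obtain e where "R = 2 ^ e" using scale(4) by blast
    then show "R \<in> (\<lambda>e. 2 ^ e) ` E" using R by (auto simp: E_def)
  qed (auto simp: E_def)
  have fin: "finite E" using img inj finite_imageD[of "\<lambda>e. 2 ^ e :: nat" E] by simp
  have "(\<Sum>\<kappa>\<in>?K. fst \<kappa>) = (\<Sum>R\<in>scale w ` set obs. \<Sum>\<kappa>\<in>{\<kappa>\<in>?K. fst \<kappa> = R}. fst \<kappa>)"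
    by (rule sum.group[symmetric]) (auto simp: key_def)
  also have "\<dots> \<le> (\<Sum>R\<in>scale w ` set obs. 2 * min (n * R) (2 * L))"
  proof (rule sum_mono)
    fix R assume "R \<in> scale w ` set obs"
    then have "R \<le> L" using scale(5) by auto
    have "(\<Sum>\<kappa>\<in>{\<kappa>\<in>?K. fst \<kappa> = R}. fst \<kappa>) = card {\<kappa>\<in>?K. fst \<kappa> = R} * R" by simp
    also have "\<dots> \<le> 2 * length (reps w order R) * R" using card_keys by (rule mult_right_mono) simp
    \<comment> \<open>Here \<open>R \<le> L\<close> turns the bound \<open>L + R\<close> on the
      total length of the segments into \<open>2 * L\<close>.\<close>
    also have "\<dots> \<le> 2 * min (n * R) (2 * L)"
      using length_reps_le'[of R] length_reps_le[of R] \<open>R \<le> L\<close> by (simp add: mult.commute mult_right_mono)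
    finally show "(\<Sum>\<kappa>\<in>{\<kappa>\<in>?K. fst \<kappa> = R}. fst \<kappa>) \<le> 2 * min (n * R) (2 * L)" .
  qed
  also have "\<dots> = 2 * (\<Sum>e\<in>E. min (n * 2 ^ e) (2 * L))"
    unfolding img[symmetric] by (subst sum.reindex[OF inj]) (simp add: sum_distrib_left)
  also have "\<dots> \<le> 2 * (2 * L * (F + 1))"
  proof (intro mult_left_mono sum_scales fin n_less)
    fix e assume "e \<in> E"
    then show "2 ^ e \<le> L" using scale(5) unfolding E_def by force
  qed (use r_less in auto)
  finally show ?thesis by simp
qed

end

section \<open>Length of the route\<close>

lemma distinct_concat_filter:
  assumes "distinct xs" "distinct zs"
  shows "distinct (concat (map (\<lambda>v. filter (\<lambda>z. f z = v) zs) xs))"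
  using assms by (induction xs) auto

lemma sorted_concat_filter:
  assumes "sorted_wrt P xs" "\<And>x. P x x"
  shows "sorted_wrt (\<lambda>a b. P (f a) (f b)) (concat (map (\<lambda>v. filter (\<lambda>z. f z = v) zs) xs))"
  using assms(1)
proof (induction xs)
  case (Cons v xs)
  have "sorted_wrt (\<lambda>a b. P (f a) (f b)) (filter (\<lambda>z. f z = v) zs)"
    by (induction zs) (use assms(2) in auto)
  then show ?case using Cons by (auto simp: sorted_wrt_append)
qed simp

lemma sorted_wrt_concat_mem:
  assumes "sorted_wrt P (concat cs)" "c \<in> set cs"
  shows "sorted_wrt P c"
proof -
  obtain as bs where "cs = as @ c # bs" using assms(2) by (meson split_list)
  then show ?thesis using assms(1) by (simp add: sorted_wrt_append)
qed

lemma plen_overlap: "plen w (xs @ v # ys) = plen w (xs @ [v]) + plen w (v # ys)"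
  by (induction xs rule: induct_list012) auto

lemma plen_loops:
  "plen w (v # concat (map (\<lambda>c. g c @ [v]) cs) @ ys) = (\<Sum>c\<leftarrow>cs. plen w (v # g c @ [v])) + plen w (v # ys)"
proof (induction cs)
  case (Cons c cs)
  then show ?case
    using plen_overlap[of w "v # g c" v "concat (map (\<lambda>c. g c @ [v]) cs) @ ys"] by simp
qed simp

lemma sum_list_concat_map: "(\<Sum>x\<leftarrow>concat xss. f x) = (\<Sum>xs\<leftarrow>xss. \<Sum>x\<leftarrow>xs. f x)"
  by (induction xss) auto

lemma stops_concat: "stops (concat xss) = concat (map stops xss)"
  by (induction xss) (auto simp: stops_append)

lemma stops_collect: "stops (collect v zs) = map (endpoint True) zs @ [v]"
proof -
  have "stops (concat (map fetch zs)) = map (endpoint True) zs"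
    by (induction zs) auto
  moreover have "stops (map (\<lambda>z. Drop (index z)) zs) = []" by (induction zs) auto
  ultimately show ?thesis by (simp add: collect_def stops_append)
qed

lemma stops_deliver: "stops (deliver v zs) = map (endpoint False) zs @ [v]"
proof -
  have "stops (concat (map bring zs)) = map (endpoint False) zs"
    by (induction zs) auto
  moreover have "stops (map (\<lambda>z. Pickup (index z)) zs) = []" by (induction zs) auto
  ultimately show ?thesis by (simp add: deliver_def stops_append)
qed

section \<open>Cost of the trips\<close>

context ride
begin

abbreviation trip :: "bool \<Rightarrow> nat \<Rightarrow> object list \<Rightarrow> nat" where
  "trip b v c \<equiv> plen w (v # map (endpoint b) c @ [v])"

abbreviation sorted_obs :: "bool \<Rightarrow> object list" where
  "sorted_obs b \<equiv> sorted_objects order b obs"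

lemma set_sorted_obs: "set (sorted_obs b) = set obs"
  using endpoint_in_order by (auto simp: sorted_objects_def)

lemma distinct_sorted_obs: "distinct (sorted_obs b)"
  unfolding sorted_objects_def by (rule distinct_concat_filter[OF order(1) distinct_objects])

lemma sorted_sorted_obs:
  "sorted_wrt (\<lambda>y z. pos (endpoint b y) \<le> pos (endpoint b z)) (sorted_obs b)"
  unfolding sorted_objects_def by (rule sorted_concat_filter[OF sorted_position[OF order(1)]]) simp

text \<open>Between the hub and an end it is at most \<open>4 * R * F + R\<close>, by way of the
  common home; this is paid twice, and the walk inside the segment costs at most \<open>R\<close>.
  As \<open>F\<close> is positive, the sum \<open>8 * R * F + 3 * R\<close> is at most
  \<open>11 * R * F\<close>.\<close>

lemma chunk_cost:
  assumes "\<kappa> = key w order b z\<^sub>0" "z\<^sub>0 \<in> set obs" "v = fst (snd \<kappa>)"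
    and c: "c \<in> set (chunks k (filter (\<lambda>z. key w order b z = \<kappa>) (sorted_obs b)))"
  shows "trip b v c \<le> 11 * fst \<kappa> * F"
proof -
  obtain R p where \<kappa>: "\<kappa> = (R, v, p)" using assms(3) by (cases \<kappa>) auto
  have R: "0 < R" using scale(1)[OF assms(2)] assms(1) \<kappa> by (simp add: key_def)
  have "set c \<subseteq> set (concat (chunks k (filter (\<lambda>z. key w order b z = \<kappa>) (sorted_obs b))))"
    using c by (simp only: set_concat) (rule UN_upper)
  then have sub: "set c \<subseteq> {z \<in> set obs. key w order b z = \<kappa>}"
    unfolding concat_chunks set_filter set_sorted_obs .
  have srt: "sorted_wrt (\<lambda>y z. pos (endpoint b y) \<le> pos (endpoint b z)) c"
    by (rule sorted_wrt_concat_mem[OF _ c]) (unfold concat_chunks, rule sorted_wrt_filter[OF sorted_sorted_obs])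
  have ne: "c \<noteq> []" using chunks_mem(1)[OF k_pos c] .
  define vs where "vs = map (endpoint b) c"
  have vs: "vs \<noteq> []" "set vs \<subseteq> set order" "set vs \<subseteq> {..<n}"
  proof -
    show "vs \<noteq> []" using ne by (simp add: vs_def)
    show "set vs \<subseteq> set order" using sub endpoint_in_order by (auto simp: vs_def)
    then show "set vs \<subseteq> {..<n}" using order(4) by blast
  qed
  have v: "v < n" using hub_in_order[OF assms(2)] in_order_less assms(1) \<kappa> by (auto simp: key_def)
  have u: "w v u \<le> 4 * R * F + R" "w u v = w v u" "pos u div R = pos p div R" if uvs: "u \<in> set vs" for u
  proof -
    obtain z where z: "z \<in> set obs" "u = endpoint b z" "scale w z = R" "hub w order z = v" "home w order b z = p"
    proof -
      obtain z where "z \<in> set c" "u = endpoint b z" using uvs by (auto simp: vs_def)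
      then show thesis using that[of z] sub \<kappa> by (auto simp: key_def)
    qed
    have less: "u < n" "p < n" using uvs vs(3) home(1)[OF z(1), of b] reps_less z by auto
    have "w v u \<le> w v p + w p u" by (intro w_triangle v less)
    also have "w p u = w u p" by (intro w_sym less)
    finally show "w v u \<le> 4 * R * F + R" using hub_dist[OF z(1), of b] home(2)[OF z(1), of b] z by simp
    show "w u v = w v u" by (intro w_sym v less)
    show "pos u div R = pos p div R" using home(3)[OF z(1), of b] z by simp
  qed
  \<comment> \<open>The ends are visited in the order of the path, so the walk costs no more than
    the difference of positions, which stays below \<open>R\<close> within a segment.\<close>
  have "pos (hd vs) + plen w vs \<le> pos (last vs)"
    by (rule plen_sorted[OF order(4) vs(2,1)]) (use srt in \<open>simp add: vs_def sorted_wrt_map\<close>)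
  moreover have "max (pos (hd vs)) (pos (last vs)) - min (pos (hd vs)) (pos (last vs)) < R"
    by (rule same_segment[OF R]) (simp add: u(3)[OF hd_in_set[OF vs(1)]] u(3)[OF last_in_set[OF vs(1)]])
  ultimately have "plen w vs \<le> R" by linarith
  moreover have "plen w (v # vs @ [v]) = w v (hd vs) + plen w vs + w (last vs) v"
    using vs(1) plen_append[of vs "[v]" w] by (cases vs) auto
  moreover have "w v (hd vs) \<le> 4 * R * F + R" "w (last vs) v \<le> 4 * R * F + R"
    using u(1)[OF hd_in_set[OF vs(1)]] u(1,2)[OF last_in_set[OF vs(1)]] by simp_all
  moreover have "3 * R \<le> 3 * (R * F)" using F_pos by simp
  moreover have "4 * R * F = 4 * (R * F)" by simp
  ultimately have "plen w (v # vs @ [v]) \<le> 11 * (R * F)" by linarith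
  then show ?thesis unfolding vs_def[symmetric] \<kappa> by simp
qed

definition side_cost :: "bool \<Rightarrow> nat" where
  "side_cost b = (\<Sum>v\<leftarrow>order. \<Sum>c\<leftarrow>batches w order k obs b v. trip b v c)"

abbreviation D :: nat where "D \<equiv> (\<Sum>z\<in>set obs. w (endpoint True z) (endpoint False z))"

text \<open>Multiplying by \<open>k\<close> avoids division. A group with key of scale
  \<open>R\<close> and \<open>N\<close> objects makes \<open>k\<close> times its number of trips at
  most \<open>N + k\<close>. The terms \<open>R * N\<close> add up to the sum of all scales, hence
  to at most \<open>D\<close>; the terms \<open>k * R\<close>, one partly filled trip per group, are
  bounded by \<open>sum_keys\<close>.\<close>

lemma side_cost: "k * side_cost b \<le> 11 * F * (D + k * (4 * L * (F + 1)))"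
proof -
  define K where "K = remdups (map (key w order b) obs)"
  have K: "distinct K" "set K = key w order b ` set obs" by (simp_all add: K_def)
  define ch where "ch = (\<lambda>\<kappa>. chunks k (filter (\<lambda>z. key w order b z = \<kappa>) (sorted_obs b)))"
  define N where "N = (\<lambda>\<kappa>. card {z \<in> set obs. key w order b z = \<kappa>})"
  have batch: "batches w order k obs b v = concat (map ch (filter (\<lambda>\<kappa>. fst (snd \<kappa>) = v) K))" for v
    by (simp add: batches_def ch_def K_def)
  have one: "k * (\<Sum>c\<leftarrow>ch \<kappa>. trip b v c) \<le> 11 * F * (fst \<kappa> * N \<kappa> + k * fst \<kappa>)"
    if \<kappa>: "\<kappa> \<in> set K" "fst (snd \<kappa>) = v" for \<kappa> v
  proof -
    obtain z where z: "z \<in> set obs" "\<kappa> = key w order b z" using \<kappa> K by auto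
    have "(\<Sum>c\<leftarrow>ch \<kappa>. trip b v c) \<le> (\<Sum>c\<leftarrow>ch \<kappa>. 11 * fst \<kappa> * F)"
      by (rule sum_list_mono) (use chunk_cost[OF z(2,1)] \<kappa>(2) in \<open>simp add: ch_def\<close>)
    also have "\<dots> = length (ch \<kappa>) * (11 * fst \<kappa> * F)" by (simp add: sum_list_triv)
    finally have "k * (\<Sum>c\<leftarrow>ch \<kappa>. trip b v c) \<le> k * (length (ch \<kappa>) * (11 * fst \<kappa> * F))"
      by (rule mult_left_mono) simp
    also have "\<dots> = k * length (ch \<kappa>) * (11 * fst \<kappa> * F)" by simp
    also have "\<dots> \<le> (N \<kappa> + k) * (11 * fst \<kappa> * F)"
    proof (rule mult_right_mono)
      have "length (filter (\<lambda>z. key w order b z = \<kappa>) (sorted_obs b)) = N \<kappa>"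
        unfolding N_def set_sorted_obs[of b, symmetric] set_filter[symmetric]
        by (rule distinct_card[symmetric]) (simp add: distinct_sorted_obs)
      then show "k * length (ch \<kappa>) \<le> N \<kappa> + k"
        using length_chunks[OF k_pos, of "filter (\<lambda>z. key w order b z = \<kappa>) (sorted_obs b)"] by (simp add: ch_def)
    qed simp
    also have "\<dots> = 11 * F * (fst \<kappa> * N \<kappa> + k * fst \<kappa>)" by (simp add: algebra_simps)
    finally show ?thesis .
  qed
  have "k * side_cost b = k * (\<Sum>v\<in>set order. \<Sum>\<kappa>\<in>{\<kappa>\<in>set K. fst (snd \<kappa>) = v}. \<Sum>c\<leftarrow>ch \<kappa>. trip b v c)"
    unfolding side_cost_def batch
    using K(1) order(1) by (simp add: sum_list_distinct_conv_sum_set sum_list_concat_map comp_def)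
  also have "\<dots> = (\<Sum>v\<in>set order. \<Sum>\<kappa>\<in>{\<kappa>\<in>set K. fst (snd \<kappa>) = v}. k * (\<Sum>c\<leftarrow>ch \<kappa>. trip b v c))"
    by (simp only: sum_distrib_left)
  also have "\<dots> \<le> (\<Sum>v\<in>set order. \<Sum>\<kappa>\<in>{\<kappa>\<in>set K. fst (snd \<kappa>) = v}. 11 * F * (fst \<kappa> * N \<kappa> + k * fst \<kappa>))"
    by (intro sum_mono) (use one in blast)
  \<comment> \<open>Every key names one hub, and all hubs lie on the path, so the double sum is a
    sum over all keys.\<close>
  also have "\<dots> = (\<Sum>\<kappa>\<in>set K. 11 * F * (fst \<kappa> * N \<kappa> + k * fst \<kappa>))"
    by (rule sum.group) (use hub_in_order in \<open>auto simp: K key_def\<close>)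
  also have "\<dots> = 11 * F * ((\<Sum>\<kappa>\<in>set K. fst \<kappa> * N \<kappa>) + k * (\<Sum>\<kappa>\<in>set K. fst \<kappa>))"
    by (simp only: sum_distrib_left[symmetric] sum.distrib)
  also have "\<dots> \<le> 11 * F * (D + k * (4 * L * (F + 1)))"
  proof (intro mult_left_mono add_mono)
    have "(\<Sum>\<kappa>\<in>set K. fst \<kappa> * N \<kappa>) = (\<Sum>\<kappa>\<in>set K. \<Sum>z\<in>{z\<in>set obs. key w order b z = \<kappa>}. scale w z)"
    proof (intro sum.cong refl)
      fix \<kappa>
      have "(\<Sum>z\<in>{z\<in>set obs. key w order b z = \<kappa>}. scale w z) = (\<Sum>z\<in>{z\<in>set obs. key w order b z = \<kappa>}. fst \<kappa>)"
        by (rule sum.cong) (auto simp: key_def)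
      then show "fst \<kappa> * N \<kappa> = (\<Sum>z\<in>{z\<in>set obs. key w order b z = \<kappa>}. scale w z)"
        by (simp add: N_def)
    qed
    also have "\<dots> = (\<Sum>z\<in>set obs. scale w z)"
      by (rule sum.group) (auto simp: K)
    also have "\<dots> \<le> D" by (rule sum_mono) (rule scale(2))
    finally show "(\<Sum>\<kappa>\<in>set K. fst \<kappa> * N \<kappa>) \<le> D" .
    show "(\<Sum>\<kappa>\<in>set K. fst \<kappa>) \<le> 4 * L * (F + 1)" unfolding K(2) by (rule sum_keys)
  qed simp_all
  finally show ?thesis .
qed

lemma plen_serve:
  "plen w (u # stops (serve w order k obs v) @ ys) = w u v + (\<Sum>c\<leftarrow>batches w order k obs True v. trip True v c)
     + (\<Sum>c\<leftarrow>batches w order k obs False v. trip False v c) + plen w (v # ys)"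
  unfolding serve_def
  by (simp add: stops_append stops_concat comp_def stops_collect stops_deliver plen_loops)

text \<open>Walking along the path costs \<open>L\<close>, and the return from its last vertex to
  \<open>r\<close> at most \<open>L\<close> again; everything else is closed trips at the
  hubs.\<close>

lemma plen_route: "plen w (r # stops (route w k r ds)) \<le> 2 * L + side_cost True + side_cost False"
proof -
  let ?cost = "\<lambda>b v. \<Sum>c\<leftarrow>batches w order k obs b v. trip b v c"
  have *: "plen w (u # stops (concat (map (serve w order k obs) vs)) @ [r]) =
      plen w (u # vs @ [r]) + (\<Sum>v\<leftarrow>vs. ?cost True v) + (\<Sum>v\<leftarrow>vs. ?cost False v)" for u vs
    by (induction vs arbitrary: u) (simp_all add: stops_append plen_serve)
  have "plen w (r # order @ [r]) = w r (hd order) + (plen w order + w (last order) r)"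
    using order(5) plen_append[OF order(5), of "[r]" w] by (cases order) auto
  moreover have "w r (hd order) = 0" using order(3) w_refl r_less by simp
  moreover have "w (last order) r \<le> L"
  proof -
    have "r \<in> set order" "last order \<in> set order" using order(3,5) by (metis hd_in_set, simp)
    then show ?thesis using w_le_pos_diff[of "last order" r] pos_le_L[of r] pos_le_L[of "last order"] by linarith
  qed
  ultimately have "plen w (r # order @ [r]) \<le> 2 * L" by (simp add: L_def)
  moreover have "stops (route w k r ds) = stops (concat (map (serve w order k obs) order)) @ [r]"
    by (simp add: route_def Let_def order_def stops_append)
  ultimately show ?thesis using *[of r order] by (simp add: side_cost_def)
qed

text \<open>With \<open>L\<close> at most twice the length of \<open>q\<close>, each side costs
  \<open>11 * F * (9 + 8 * F)\<close> times that length, where 9 is \<open>1 + 8\<close> and the 8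
  stems from \<open>4 * 2\<close>. As \<open>F\<close> is positive, this is at most
  \<open>187 * F\<^sup>2\<close>, and the walk along the path and back adds 4:
  \<open>378 = 2 * 187 + 4\<close>.\<close>

lemma route_length:
  assumes "q \<noteq> []" "hd q = r" "set (terminals r obs) \<subseteq> set q" "set q \<subseteq> {..<n}" "D \<le> k * plen w q"
  shows "plen w (r # stops (route w k r ds)) \<le> 378 * F\<^sup>2 * plen w q"
proof -
  let ?Q = "plen w q"
  have L: "L \<le> 2 * ?Q" by (rule order(6)[OF assms(1-4)])
  have side: "side_cost b \<le> 187 * (F\<^sup>2 * ?Q)" for b
  proof -
    have "k * side_cost b \<le> 11 * F * (k * ?Q + k * (4 * L * (F + 1)))"
      by (rule order_trans[OF side_cost]) (intro mult_left_mono add_mono assms(5) order_refl, simp)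
    also have "\<dots> \<le> 11 * F * (k * ?Q + k * (4 * (2 * ?Q) * (F + 1)))"
      by (intro mult_left_mono add_mono mult_right_mono L order_refl) simp_all
    also have "\<dots> = k * (11 * F * (?Q * (9 + 8 * F)))" by (simp add: algebra_simps)
    finally have "side_cost b \<le> 11 * F * (?Q * (9 + 8 * F))" using k_pos by simp
    also have "\<dots> \<le> 11 * F * (?Q * (17 * F))"
      by (intro mult_left_mono) (use F_pos in auto)
    also have "\<dots> = 187 * (F\<^sup>2 * ?Q)" by (simp add: power2_eq_square)
    finally show ?thesis .
  qed
  moreover have "2 * L \<le> 4 * (F\<^sup>2 * ?Q)"
  proof -
    have "1 * ?Q \<le> F\<^sup>2 * ?Q" by (rule mult_right_mono) (use F_pos in auto)
    then show ?thesis using L by linarith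
  qed
  ultimately have "plen w (r # stops (route w k r ds)) \<le> 378 * (F\<^sup>2 * ?Q)"
    using plen_route side[of True] side[of False] by linarith
  then show ?thesis by (simp add: mult.assoc)
qed

end

section \<open>Feasibility of the route\<close>

text \<open>This is \<open>override_on loc f S\<close>; it describes the effect of a trip on the
  places of the objects with indices in \<open>S\<close>.\<close>

definition put :: "nat set \<Rightarrow> (nat \<Rightarrow> nat option) \<Rightarrow> (nat \<Rightarrow> nat option) \<Rightarrow> nat \<Rightarrow> nat option" where
  "put S f loc = (\<lambda>j. if j \<in> S then f j else loc j)"

lemma put_empty [simp]: "put {} f loc = loc"
  by (simp add: put_def)

lemma put_upd: "put S f (loc(i := f i)) = put (insert i S) f loc"
  by (auto simp: put_def)

lemma put_put: "put S f (put T f loc) = put (T \<union> S) f loc"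
  by (auto simp: put_def)

lemma put_override: "put S f (put S g loc) = put S f loc"
  by (auto simp: put_def)

lemma card_None_upd:
  "card {j. j < m \<and> (loc(i := None)) j = None} \<le> Suc (card {j. j < m \<and> loc j = None})" for m :: nat
proof -
  have "{j. j < m \<and> (loc(i := None)) j = None} \<subseteq> insert i {j. j < m \<and> loc j = None}" by auto
  from card_mono[OF _ this] show ?thesis by (rule order_trans) (auto intro: card_insert_le_m1 simp: card_insert_if)
qed

lemma distinct_map_Cons_neq: "distinct (map f (z # zs)) \<Longrightarrow> y \<in> set zs \<Longrightarrow> f y \<noteq> f z"
  by (auto intro: rev_image_eqI)

text \<open>The capacity condition counts the objects still to be picked up together with those on
  board, so a pickup preserves it in the induction.\<close>

lemma acts_Move_Pickup:
  assumes "distinct (map index zs)"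
    "\<And>z. z \<in> set zs \<Longrightarrow> index z < nobjects I \<and> endpoint True z < nverts I \<and> loc (index z) = Some (endpoint True z)"
    "card (carried I loc) + length zs \<le> capacity I"
  shows "\<exists>u'. acts I (u, loc) (concat (map fetch zs)) =
    Some (u', put (index ` set zs) (\<lambda>_. None) loc)"
  using assms
proof (induction zs arbitrary: u loc)
  case (Cons z zs)
  define loc1 where "loc1 = loc(index z := None)"
  have d: "distinct (map index zs)" using Cons.prems(1) by simp
  have c: "index y < nobjects I \<and> endpoint True y < nverts I \<and> loc1 (index y) = Some (endpoint True y)"
    if "y \<in> set zs" for y
    using Cons.prems(2)[of y] distinct_map_Cons_neq[OF Cons.prems(1) that] that by (simp add: loc1_def)
  have l: "card (carried I loc1) + length zs \<le> capacity I"
    using card_None_upd[of "nobjects I" loc "index z"] Cons.prems(3) by (simp only: loc1_def list.size)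
  from Cons.IH[OF d c l] obtain u' where "acts I (endpoint True z, loc1)
      (concat (map fetch zs)) =
      Some (u', put (index ` set zs) (\<lambda>_. None) loc1)" by blast
  moreover have "card (carried I loc) < capacity I" using Cons.prems(3) by simp
  ultimately show ?case
    using Cons.prems(2)[of z] put_upd[of "index ` set zs" "\<lambda>_. None" loc "index z"]
    by (simp add: loc1_def[symmetric])
qed simp

lemma acts_Pickups:
  assumes "distinct (map index zs)"
    "\<And>z. z \<in> set zs \<Longrightarrow> index z < nobjects I \<and> loc (index z) = Some v"
    "card (carried I loc) + length zs \<le> capacity I"
  shows "acts I (v, loc) (map (\<lambda>z. Pickup (index z)) zs) = Some (v, put (index ` set zs) (\<lambda>_. None) loc)"
  using assms
proof (induction zs arbitrary: loc)
  case (Cons z zs)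
  define loc1 where "loc1 = loc(index z := None)"
  have d: "distinct (map index zs)" using Cons.prems(1) by simp
  have c: "index y < nobjects I \<and> loc1 (index y) = Some v" if "y \<in> set zs" for y
    using Cons.prems(2)[of y] distinct_map_Cons_neq[OF Cons.prems(1) that] that by (simp add: loc1_def)
  have l: "card (carried I loc1) + length zs \<le> capacity I"
    using card_None_upd[of "nobjects I" loc "index z"] Cons.prems(3) by (simp only: loc1_def list.size)
  have "card (carried I loc) < capacity I" using Cons.prems(3) by simp
  then show ?case
    using Cons.IH[OF d c l] Cons.prems(2)[of z] put_upd[of "index ` set zs" "\<lambda>_. None" loc "index z"]
    by (simp add: loc1_def[symmetric])
qed simp

lemma acts_Drops:
  assumes "distinct (map index zs)"
    "\<And>z. z \<in> set zs \<Longrightarrow> index z < nobjects I \<and> loc (index z) = None"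
  shows "acts I (v, loc) (map (\<lambda>z. Drop (index z)) zs) = Some (v, put (index ` set zs) (\<lambda>_. Some v) loc)"
  using assms
proof (induction zs arbitrary: loc)
  case (Cons z zs)
  define loc1 where "loc1 = loc(index z := Some v)"
  have d: "distinct (map index zs)" using Cons.prems(1) by simp
  have c: "index y < nobjects I \<and> loc1 (index y) = None" if "y \<in> set zs" for y
    using Cons.prems(2)[of y] distinct_map_Cons_neq[OF Cons.prems(1) that] that by (simp add: loc1_def)
  show ?case
    using Cons.IH[OF d c] Cons.prems(2)[of z] put_upd[of "index ` set zs" "\<lambda>_. Some v" loc "index z"]
    by (simp add: loc1_def[symmetric])
qed simp

lemma acts_Move_Drop:
  assumes "distinct (map index zs)"
    "\<And>z. z \<in> set zs \<Longrightarrow> index z < nobjects I \<and> endpoint False z < nverts I \<and>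
      loc (index z) = None \<and> endpoint False z = dest I (index z)"
  shows "\<exists>u'. acts I (u, loc) (concat (map bring zs)) =
    Some (u', put (index ` set zs) (\<lambda>j. Some (dest I j)) loc)"
  using assms
proof (induction zs arbitrary: u loc)
  case (Cons z zs)
  define loc1 where "loc1 = loc(index z := Some (dest I (index z)))"
  have d: "distinct (map index zs)" using Cons.prems(1) by simp
  have c: "index y < nobjects I \<and> endpoint False y < nverts I \<and> loc1 (index y) = None \<and>
      endpoint False y = dest I (index y)" if "y \<in> set zs" for y
    using Cons.prems(2)[of y] distinct_map_Cons_neq[OF Cons.prems(1) that] that by (simp add: loc1_def)
  from Cons.IH[OF d c] obtain u' where "acts I (endpoint False z, loc1)
      (concat (map bring zs)) =
      Some (u', put (index ` set zs) (\<lambda>j. Some (dest I j)) loc1)" by blast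
  then show ?case
    using Cons.prems(2)[of z] put_upd[of "index ` set zs" "\<lambda>j. Some (dest I j)" loc "index z"]
    by (simp add: loc1_def[symmetric])
qed simp

definition valid_batch :: "dial_a_ride \<Rightarrow> object list \<Rightarrow> bool" where
  "valid_batch I zs \<longleftrightarrow> distinct (map index zs) \<and> length zs \<le> capacity I \<and>
     (\<forall>z\<in>set zs. index z < nobjects I \<and> endpoint True z < nverts I \<and> endpoint False z < nverts I \<and>
        endpoint True z = src I (index z) \<and> endpoint False z = dest I (index z))"

lemma valid_batchD:
  "valid_batch I zs \<Longrightarrow> z \<in> set zs \<Longrightarrow> index z < nobjects I \<and> endpoint True z < nverts I \<and>
    endpoint False z < nverts I \<and> endpoint True z = src I (index z) \<and> endpoint False z = dest I (index z)"
  unfolding valid_batch_def by blast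

text \<open>The trip starts with an empty vehicle, so a batch of up to \<open>capacity I\<close>
  objects fits, and it leaves the vehicle empty for the next trip.\<close>

lemma acts_collect:
  assumes "valid_batch I zs" "v < nverts I" "\<And>z. z \<in> set zs \<Longrightarrow> loc (index z) = Some (src I (index z))"
    "\<And>j. j < nobjects I \<Longrightarrow> loc j \<noteq> None"
  shows "acts I (u, loc) (collect v zs) = Some (v, put (index ` set zs) (\<lambda>_. Some v) loc)"
proof -
  have e: "carried I loc = {}" using assms(4) by auto
  have d: "distinct (map index zs)" and l: "card (carried I loc) + length zs \<le> capacity I"
    using assms(1) by (simp_all add: valid_batch_def e)
  have c: "index z < nobjects I \<and> endpoint True z < nverts I \<and> loc (index z) = Some (endpoint True z)"
    if "z \<in> set zs" for z using valid_batchD[OF assms(1) that] assms(3)[OF that] by simp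
  from acts_Move_Pickup[OF d c l] obtain u' where
    "acts I (u, loc) (concat (map fetch zs)) =
    Some (u', put (index ` set zs) (\<lambda>_. None) loc)" by blast
  moreover have "acts I (v, put (index ` set zs) (\<lambda>_. None) loc) (map (\<lambda>z. Drop (index z)) zs) =
      Some (v, put (index ` set zs) (\<lambda>_. Some v) loc)"
    using acts_Drops[of zs I "put (index ` set zs) (\<lambda>_. None) loc" v] assms(1)
    unfolding valid_batch_def put_override by (simp add: put_def)
  ultimately show ?thesis using assms(2) by (simp add: collect_def acts_append)
qed

lemma acts_deliver:
  assumes "valid_batch I zs" "v < nverts I" "\<And>z. z \<in> set zs \<Longrightarrow> loc (index z) = Some v"
    "\<And>j. j < nobjects I \<Longrightarrow> loc j \<noteq> None"
  shows "acts I (v, loc) (deliver v zs) = Some (v, put (index ` set zs) (\<lambda>j. Some (dest I j)) loc)"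
proof -
  have e: "carried I loc = {}" using assms(4) by auto
  have "acts I (v, loc) (map (\<lambda>z. Pickup (index z)) zs) = Some (v, put (index ` set zs) (\<lambda>_. None) loc)"
    using acts_Pickups[of zs I loc v] assms(1,3) unfolding valid_batch_def e by simp
  moreover have "\<exists>u'. acts I (v, put (index ` set zs) (\<lambda>_. None) loc)
      (concat (map bring zs)) =
      Some (u', put (index ` set zs) (\<lambda>j. Some (dest I j)) (put (index ` set zs) (\<lambda>_. None) loc))"
  proof (rule acts_Move_Drop)
    show "distinct (map index zs)" using assms(1) by (simp add: valid_batch_def)
    fix z assume z: "z \<in> set zs"
    show "index z < nobjects I \<and> endpoint False z < nverts I \<and>
        put (index ` set zs) (\<lambda>_. None) loc (index z) = None \<and> endpoint False z = dest I (index z)"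
      using valid_batchD[OF assms(1) z] z by (simp add: put_def)
  qed
  then obtain u' where "acts I (v, put (index ` set zs) (\<lambda>_. None) loc)
      (concat (map bring zs)) =
      Some (u', put (index ` set zs) (\<lambda>j. Some (dest I j)) loc)"
    unfolding put_override by blast
  ultimately show ?thesis using assms(2) by (simp add: deliver_def acts_append)
qed

lemma acts_collects:
  assumes "\<And>c. c \<in> set cs \<Longrightarrow> valid_batch I c" "distinct (map index (concat cs))" "v < nverts I"
    "\<And>z. z \<in> set (concat cs) \<Longrightarrow> loc (index z) = Some (src I (index z))"
    "\<And>j. j < nobjects I \<Longrightarrow> loc j \<noteq> None"
  shows "acts I (v, loc) (concat (map (collect v) cs)) = Some (v, put (index ` set (concat cs)) (\<lambda>_. Some v) loc)"
  using assms
proof (induction cs arbitrary: loc)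
  case (Cons c cs)
  let ?loc = "put (index ` set c) (\<lambda>_. Some v) loc"
  have "acts I (v, loc) (collect v c) = Some (v, ?loc)"
    by (rule acts_collect) (use Cons.prems in auto)
  moreover have "acts I (v, ?loc) (concat (map (collect v) cs)) =
      Some (v, put (index ` set (concat cs)) (\<lambda>_. Some v) ?loc)"
  proof (rule Cons.IH)
    fix z assume z: "z \<in> set (concat cs)"
    then have "index z \<notin> index ` set c" using Cons.prems(2) by fastforce
    then show "?loc (index z) = Some (src I (index z))" using Cons.prems(4)[of z] z by (simp add: put_def)
  qed (use Cons.prems in \<open>auto simp: put_def\<close>)
  ultimately show ?case by (simp add: acts_append put_put image_Un)
qed simp

lemma acts_delivers:
  assumes "\<And>c. c \<in> set cs \<Longrightarrow> valid_batch I c" "distinct (map index (concat cs))" "v < nverts I"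
    "\<And>z. z \<in> set (concat cs) \<Longrightarrow> loc (index z) = Some v"
    "\<And>j. j < nobjects I \<Longrightarrow> loc j \<noteq> None"
  shows "acts I (v, loc) (concat (map (deliver v) cs)) =
    Some (v, put (index ` set (concat cs)) (\<lambda>j. Some (dest I j)) loc)"
  using assms
proof (induction cs arbitrary: loc)
  case (Cons c cs)
  let ?loc = "put (index ` set c) (\<lambda>j. Some (dest I j)) loc"
  have "acts I (v, loc) (deliver v c) = Some (v, ?loc)"
    by (rule acts_deliver) (use Cons.prems in auto)
  moreover have "acts I (v, ?loc) (concat (map (deliver v) cs)) =
      Some (v, put (index ` set (concat cs)) (\<lambda>j. Some (dest I j)) ?loc)"
  proof (rule Cons.IH)
    fix z assume z: "z \<in> set (concat cs)"
    then have "index z \<notin> index ` set c" using Cons.prems(2) by fastforce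
    then show "?loc (index z) = Some v" using Cons.prems(4)[of z] z by (simp add: put_def)
  qed (use Cons.prems in \<open>auto simp: put_def\<close>)
  ultimately show ?case by (simp add: acts_append put_put image_Un)
qed simp

section \<open>Places of the drops\<close>

lemma drops_append: "drops_from u (\<sigma> @ \<tau>) = drops_from u \<sigma> @ drops_from (last (u # stops \<sigma>)) \<tau>"
  by (induction \<sigma> arbitrary: u rule: stops.induct) auto

lemma drops_collect: "drops_from u (collect v zs) = map (\<lambda>z. (index z, v)) zs"
proof -
  have "drops_from u (concat (map fetch zs)) = []" for u
    by (induction zs arbitrary: u) auto
  moreover have "drops_from v (map (\<lambda>z. Drop (index z)) zs) = map (\<lambda>z. (index z, v)) zs"
    by (induction zs) auto
  ultimately show ?thesis by (simp add: collect_def drops_append)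
qed

lemma drops_deliver: "drops_from u (deliver v zs) = map (\<lambda>z. (index z, endpoint False z)) zs"
proof -
  have "drops_from u (concat (map bring zs)) =
      map (\<lambda>z. (index z, endpoint False z)) zs" for u
    by (induction zs arbitrary: u) auto
  moreover have "drops_from u (map (\<lambda>z. Pickup (index z)) zs) = []" for u
    by (induction zs) auto
  ultimately show ?thesis by (simp add: deliver_def drops_append)
qed

lemma drops_collects: "drops_from u (concat (map (collect v) cs)) = map (\<lambda>z. (index z, v)) (concat cs)"
  by (induction cs arbitrary: u) (simp_all add: drops_append drops_collect stops_collect)

lemma drops_delivers:
  "drops_from u (concat (map (deliver v) cs)) = map (\<lambda>z. (index z, endpoint False z)) (concat cs)"
  by (induction cs arbitrary: u) (simp_all add: drops_append drops_deliver stops_deliver)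

section \<open>The whole route on a given instance\<close>

locale ride_instance = ride +
  fixes I :: dial_a_ride
  assumes I: "nverts I = n" "root_vertex I = r" "capacity I = k" "demands I = ds"
begin

abbreviation bat :: "bool \<Rightarrow> nat \<Rightarrow> object list list" where
  "bat b v \<equiv> batches w order k obs b v"

lemma concat_bat:
  "concat (bat b v) = concat (map (\<lambda>\<kappa>. filter (\<lambda>z. key w order b z = \<kappa>) (sorted_obs b))
     (filter (\<lambda>\<kappa>. fst (snd \<kappa>) = v) (remdups (map (key w order b) obs))))"
proof -
  have "concat (concat (map (\<lambda>\<kappa>. chunks k (g \<kappa>)) \<kappa>s)) = concat (map g \<kappa>s)"
    for g :: "nat \<times> nat \<times> nat \<Rightarrow> object list" and \<kappa>s
    by (induction \<kappa>s) (auto simp: concat_chunks)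
  then show ?thesis by (simp add: batches_def)
qed

lemma set_concat_bat: "set (concat (bat b v)) = {z \<in> set obs. hub w order z = v}"
  unfolding concat_bat using set_sorted_obs[of b] by (auto simp: key_def)

text \<open>An object has a single key on each side, and the key contains its hub; so it occurs in a
  single batch of a single hub. For the collecting side this says that it is dropped at a hub only
  once.\<close>

lemma distinct_bats: "distinct (concat (map (\<lambda>v. concat (bat b v)) order))"
proof -
  let ?g = "\<lambda>\<kappa>. filter (\<lambda>z. key w order b z = \<kappa>) (sorted_obs b)"
  let ?K = "remdups (map (key w order b) obs)"
  have "concat (map (\<lambda>v. concat (bat b v)) vs) =
      concat (map ?g (concat (map (\<lambda>v. filter (\<lambda>\<kappa>. fst (snd \<kappa>) = v) ?K) vs)))" for vs
    by (induction vs) (simp_all add: concat_bat)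
  then show ?thesis
    by (simp add: distinct_concat_filter order(1) distinct_sorted_obs)
qed

lemma distinct_index_bats: "distinct (map index (concat (map (\<lambda>v. concat (bat b v)) order)))"
  unfolding distinct_map
proof
  show "inj_on index (set (concat (map (\<lambda>v. concat (bat b v)) order)))"
    by (rule inj_on_subset[OF inj_on_index_objects[of ds]]) (use set_concat_bat in auto)
qed (rule distinct_bats)

lemma distinct_index_bat:
  assumes "v \<in> set order" shows "distinct (map index (concat (bat b v)))"
proof -
  obtain as bs where "order = as @ v # bs" using assms by (meson split_list)
  then show ?thesis using distinct_index_bats[of b] by simp
qed

lemma bat_valid:
  assumes "v \<in> set order" "c \<in> set (bat b v)"
  shows "valid_batch I c"
proof -
  have sub: "set c \<subseteq> set obs" using assms(2) set_concat_bat[of b v] by auto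
  obtain as bs where "bat b v = as @ c # bs" using assms(2) by (meson split_list)
  then have "distinct (map index c)" using distinct_index_bat[OF assms(1), of b] by simp
  moreover have "length c \<le> capacity I"
    using assms(2) chunks_mem(2)[OF k_pos] unfolding batches_def I by auto
  moreover have "index z < nobjects I \<and> endpoint True z < nverts I \<and> endpoint False z < nverts I \<and>
        endpoint True z = src I (index z) \<and> endpoint False z = dest I (index z)" if "z \<in> set obs" for z
    using that ds_less unfolding I by (auto simp: set_objects endpoint_def)
  ultimately show ?thesis unfolding valid_batch_def using sub by blast
qed

lemma acts_serve:
  assumes "v \<in> set order" "\<And>z. z \<in> set obs \<Longrightarrow> hub w order z = v \<Longrightarrow> loc (index z) = Some (src I (index z))"
    "\<And>j. j < nobjects I \<Longrightarrow> loc j \<noteq> None"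
  shows "acts I (u, loc) (serve w order k obs v) =
    Some (v, put (index ` {z \<in> set obs. hub w order z = v}) (\<lambda>j. Some (dest I j)) loc)"
proof -
  let ?S = "index ` {z \<in> set obs. hub w order z = v}"
  have v: "v < nverts I" using in_order_less[OF assms(1)] I by simp
  have 1: "acts I (v, loc) (concat (map (collect v) (bat True v))) = Some (v, put ?S (\<lambda>_. Some v) loc)"
    unfolding set_concat_bat[of True v, symmetric]
    by (rule acts_collects[OF bat_valid[OF assms(1)] distinct_index_bat[OF assms(1)] v])
      (use assms(2,3) in \<open>simp_all only: set_concat_bat mem_Collect_eq simp_thms\<close>)
  have 2: "acts I (v, put ?S (\<lambda>_. Some v) loc) (concat (map (deliver v) (bat False v))) =
      Some (v, put ?S (\<lambda>j. Some (dest I j)) (put ?S (\<lambda>_. Some v) loc))"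
    unfolding set_concat_bat[of False v, symmetric]
    by (rule acts_delivers[OF bat_valid[OF assms(1)] distinct_index_bat[OF assms(1)] v])
      (use assms(3) in \<open>auto simp: put_def\<close>)
  show ?thesis using v 1 2 by (simp add: serve_def acts_append put_override)
qed

lemma acts_serves:
  assumes "distinct vs" "set vs \<subseteq> set order"
    "\<And>z. z \<in> set obs \<Longrightarrow> hub w order z \<in> set vs \<Longrightarrow> loc (index z) = Some (src I (index z))"
    "\<And>j. j < nobjects I \<Longrightarrow> loc j \<noteq> None"
  shows "\<exists>u'. acts I (u, loc) (concat (map (serve w order k obs) vs)) =
    Some (u', put (index ` {z \<in> set obs. hub w order z \<in> set vs}) (\<lambda>j. Some (dest I j)) loc)"
  using assms
proof (induction vs arbitrary: u loc)
  case (Cons v vs)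
  let ?S = "\<lambda>V. index ` {z \<in> set obs. hub w order z \<in> V}"
  let ?loc = "put (?S {v}) (\<lambda>j. Some (dest I j)) loc"
  have 1: "acts I (u, loc) (serve w order k obs v) = Some (v, ?loc)"
    using acts_serve[of v loc u] Cons.prems by simp
  have "\<exists>u'. acts I (v, ?loc) (concat (map (serve w order k obs) vs)) =
    Some (u', put (?S (set vs)) (\<lambda>j. Some (dest I j)) ?loc)"
  proof (rule Cons.IH)
    fix z assume z: "z \<in> set obs" "hub w order z \<in> set vs"
    \<comment> \<open>Every object has one hub, so serving \<open>v\<close> leaves the objects of
      later hubs at their sources.\<close>
    have "index z \<notin> ?S {v}"
    proof
      assume "index z \<in> ?S {v}"
      then obtain y where "y \<in> set obs" "hub w order y = v" "index y = index z" by auto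
      then have "hub w order z = v" using z(1) inj_on_index_objects[of ds] by (auto dest: inj_onD)
      then show False using z(2) Cons.prems(1) by simp
    qed
    then show "?loc (index z) = Some (src I (index z))" using Cons.prems(3)[of z] z by (simp add: put_def)
  qed (use Cons.prems in \<open>auto simp: put_def\<close>)
  moreover have "?S {v} \<union> ?S (set vs) = ?S (set (v # vs))" by auto
  ultimately show ?case using 1 by (simp add: acts_append put_put)
qed simp

lemma drops_serves:
  "drops_from u (concat (map (serve w order k obs) vs)) =
    concat (map (\<lambda>v. map (\<lambda>z. (index z, v)) (concat (bat True v)) @
      map (\<lambda>z. (index z, endpoint False z)) (concat (bat False v))) vs)"
proof -
  have "drops_from u (serve w order k obs v) = map (\<lambda>z. (index z, v)) (concat (bat True v)) @
      map (\<lambda>z. (index z, endpoint False z)) (concat (bat False v))" for u v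
    by (simp add: serve_def drops_append drops_collects drops_delivers)
  then show ?thesis by (induction vs arbitrary: u) (simp_all add: drops_append)
qed

text \<open>Drops during deliveries happen at the destination and do not count. The drops during
  collections contain each object at most once, by \<open>distinct_index_bats\<close>.\<close>

lemma one_preemptive_route: "one_preemptive_tour I (route w k r ds)"
proof -
  let ?init = "\<lambda>i. Some (src I i)"
  let ?S = "index ` {z \<in> set obs. hub w order z \<in> set order}"
  let ?loc = "put ?S (\<lambda>j. Some (dest I j)) ?init"
  have route: "route w k r ds = concat (map (serve w order k obs) order) @ [Move r]"
    by (simp add: route_def order_def Let_def)
  have S: "?S = index ` set obs" using hub_in_order by auto
  obtain u' where "acts I (r, ?init) (concat (map (serve w order k obs) order)) = Some (u', ?loc)"
    using acts_serves[OF order(1) subset_refl, of ?init r] by auto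
  then have "acts I (root_vertex I, ?init) (route w k r ds) = Some (root_vertex I, ?loc)"
    unfolding route acts_append I using r_less I by simp
  moreover have "?loc i = Some (dest I i)" if "i < nobjects I" for i
  proof (cases "i \<in> index ` set obs")
    case True
    then show ?thesis unfolding S by (simp add: put_def)
  next
    case False
    \<comment> \<open>An object that the route never touches has equal ends.\<close>
    then have "src I i = dest I i" using that I by (force simp: set_objects)
    then show ?thesis using False unfolding S by (simp add: put_def)
  qed
  ultimately have "preemptive_tour I (route w k r ds)" unfolding preemptive_tour_def by blast
  moreover have "length (filter (\<lambda>(j, v). j = i \<and> v \<noteq> dest I i) (drops_from (root_vertex I) (route w k r ds))) \<le> 1"
    if "i < nobjects I" for i
  proof -
    let ?P = "\<lambda>(j, v). j = i \<and> v \<noteq> dest I i"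
    have dest: "filter ?P (map (\<lambda>z. (index z, endpoint False z)) zs) = []" if "set zs \<subseteq> set obs" for zs
    proof -
      have "\<not> ?P (index z, endpoint False z)" if "z \<in> set zs" for z
        using that \<open>set zs \<subseteq> set obs\<close> I by (auto simp: set_objects endpoint_def)
      then show ?thesis by (auto simp: filter_empty_conv)
    qed
    have col: "length (filter ?P (map (\<lambda>z. (index z, v)) zs)) \<le> length (filter (\<lambda>j. j = i) (map index zs))"
      for zs :: "object list" and v by (induction zs) auto
    have "length (filter ?P (concat (map (\<lambda>v. map (\<lambda>z. (index z, v)) (concat (bat True v)) @
        map (\<lambda>z. (index z, endpoint False z)) (concat (bat False v))) vs))) \<le>
      length (filter (\<lambda>j. j = i) (map index (concat (map (\<lambda>v. concat (bat True v)) vs))))" for vs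
    proof (induction vs)
      case (Cons v vs)
      have "set (concat (bat False v)) \<subseteq> set obs" using set_concat_bat by auto
      from dest[OF this] col[of v "concat (bat True v)"] Cons.IH show ?case
        by (simp del: concat_append)
    qed simp
    then have "length (filter ?P (drops_from r (concat (map (serve w order k obs) order)))) \<le>
        length (filter (\<lambda>j. j = i) (map index (concat (map (\<lambda>v. concat (bat True v)) order))))"
      unfolding drops_serves .
    also have "\<dots> \<le> 1"
    proof -
      have "length (filter (\<lambda>j. j = i) js) \<le> 1" if "distinct js" for js :: "nat list"
        using that distinct_card[of "filter (\<lambda>j. j = i) js"] card_mono[of "{i}" "set (filter (\<lambda>j. j = i) js)"]
        by auto
      then show ?thesis using distinct_index_bats by blast
    qed
    finally show ?thesis by (simp add: route drops_append I)
  qed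
  ultimately show ?thesis unfolding one_preemptive_tour_def by blast
qed

end

section \<open>The approximation guarantee\<close>

lemma length_from_bounds:
  fixes N :: real
  assumes "\<And>u v. u < n \<Longrightarrow> v < n \<Longrightarrow> N * dst I u v \<le> real (w u v) \<and> real (w u v) \<le> 2 * N * dst I u v"
    "set (u # stops \<sigma>) \<subseteq> {..<n}"
  shows "N * length_from I u \<sigma> \<le> real (plen w (u # stops \<sigma>)) \<and>
    real (plen w (u # stops \<sigma>)) \<le> 2 * N * length_from I u \<sigma>"
  using assms(2)
proof (induction \<sigma> arbitrary: u rule: stops.induct)
  case (2 v \<sigma>)
  then have "N * dst I u v \<le> real (w u v) \<and> real (w u v) \<le> 2 * N * dst I u v" by (intro assms(1)) auto
  then show ?case using 2(1)[of v] 2(2) by (simp add: distrib_left)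
qed auto

text \<open>From 2 on the logarithm is at least 1, which absorbs the rounding of the bit
  length.\<close>

lemma real_floorlog_le: "2 \<le> n \<Longrightarrow> real (floorlog 2 n) \<le> 2 * log 2 (real n)"
proof -
  assume n: "2 \<le> n"
  then have "1 \<le> log 2 (real n)" by simp
  moreover have "real (floorlog 2 n) \<le> log 2 (real n) + 1"
    using n by (simp add: floorlog_def)
  ultimately show ?thesis by linarith
qed

text \<open>The weights need to follow the distances only up to a factor 2, which leaves room for
  rounding. With the 378 of \<open>route_length\<close> and the 4 from passing from
  \<open>F\<^sup>2\<close> to the squared logarithm, this gives
  \<open>3024 = 2 * 4 * 378\<close>.\<close>

lemma route_approximates:
  fixes N :: real
  assumes I: "dar_instance I" and w: "weights w (nverts I)" and N: "0 < N"
    and bounds: "\<And>u v. u < nverts I \<Longrightarrow> v < nverts I \<Longrightarrow>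
      N * dst I u v \<le> real (w u v) \<and> real (w u v) \<le> 2 * N * dst I u v"
  defines "\<sigma> \<equiv> route w (capacity I) (root_vertex I) (demands I)"
  shows "one_preemptive_tour I \<sigma>"
    "tour_length I \<sigma> \<le> 3024 * (log 2 (real (nverts I)))\<^sup>2 * opt_pmt I"
proof -
  let ?n = "nverts I" and ?r = "root_vertex I"
  interpret M: Metric_space "{..<?n}" "dst I" using I by (simp add: dar_instance_def)
  interpret weights w ?n by (rule w)
  interpret ride_instance w ?n "capacity I" ?r "demands I" I
  proof unfold_locales
    fix u v assume uv: "u < ?n" "v < ?n" "u \<noteq> v"
    then have "0 < dst I u v" using M.mdist_pos_eq[of u v] by simp
    then have "0 < N * dst I u v" using N by simp
    then show "0 < w u v" using bounds[OF uv(1,2)] by simp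
  qed (use I in \<open>auto simp: dar_instance_def\<close>)
  show one: "one_preemptive_tour I \<sigma>" unfolding \<sigma>_def by (rule one_preemptive_route)
  have lower: "set (?r # stops \<tau>) \<subseteq> {..<?n}"
    "(\<Sum>i<nobjects I. w (src I i) (dest I i)) \<le> capacity I * plen w (?r # stops \<tau>)"
    "set (terminals ?r obs) \<subseteq> set (?r # stops \<tau>)"
    if "preemptive_tour I \<tau>" for \<tau>
    using tour_lower_bounds[OF that refl] r_less ds_less by auto
  have pre: "preemptive_tour I \<sigma>" using one by (simp add: one_preemptive_tour_def)
  have F2: "real (F\<^sup>2) \<le> 4 * (log 2 (real ?n))\<^sup>2" if "2 \<le> ?n"
  proof -
    have "(real F)\<^sup>2 \<le> (2 * log 2 (real ?n))\<^sup>2"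
      unfolding F_def by (rule power_mono[OF real_floorlog_le[OF that]]) simp
    then show ?thesis by (simp add: power_mult_distrib)
  qed
  have main: "tour_length I \<sigma> \<le> 3024 * (log 2 (real ?n))\<^sup>2 * tour_length I \<tau>"
    if \<tau>: "preemptive_tour I \<tau>" for \<tau>
  proof -
    have b\<sigma>: "N * tour_length I \<sigma> \<le> real (plen w (?r # stops \<sigma>))"
      unfolding tour_length_def using length_from_bounds[OF bounds lower(1)[OF pre]] by simp
    have b\<tau>: "real (plen w (?r # stops \<tau>)) \<le> 2 * N * tour_length I \<tau>"
      unfolding tour_length_def using length_from_bounds[OF bounds lower(1)[OF \<tau>]] by simp
    show ?thesis
    proof (cases "2 \<le> ?n")
      case True
      have D: "D \<le> capacity I * plen w (?r # stops \<tau>)"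
        using sum_objects_le lower(2)[OF \<tau>] by (rule order_trans)
      have "plen w (?r # stops \<sigma>) \<le> 378 * F\<^sup>2 * plen w (?r # stops \<tau>)"
        unfolding \<sigma>_def by (rule route_length[OF _ _ lower(3,1)[OF \<tau>] D]) simp_all
      then have "real (plen w (?r # stops \<sigma>)) \<le> real (378 * F\<^sup>2 * plen w (?r # stops \<tau>))"
        by (simp only: of_nat_le_iff)
      also have "\<dots> = 378 * real (F\<^sup>2) * real (plen w (?r # stops \<tau>))" by simp
      also have "\<dots> \<le> 378 * (4 * (log 2 (real ?n))\<^sup>2) * (2 * N * tour_length I \<tau>)"
        by (intro mult_mono mult_left_mono F2[OF True] b\<tau>) simp_all
      finally have "N * tour_length I \<sigma> \<le> N * (3024 * (log 2 (real ?n))\<^sup>2 * tour_length I \<tau>)"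
        using b\<sigma> by (simp add: mult_ac)
      then show ?thesis using N by simp
    next
      \<comment> \<open>With a single vertex the logarithm vanishes, so the tour has to have length
        0; indeed all weights along it are 0.\<close>
      case False
      have "plen w xs = 0" if "set xs \<subseteq> {..<?n}" for xs
        using that False w_refl by (induction xs rule: induct_list012) (auto simp: not_le less_2_cases_iff less_Suc_eq)
      then have "N * tour_length I \<sigma> \<le> 0" using b\<sigma> lower(1)[OF pre] by (metis of_nat_0)
      then have "tour_length I \<sigma> \<le> 0" using N by (simp add: mult_le_0_iff)
      moreover have "log 2 (real ?n) = 0" using False r_less by (simp add: not_le less_2_cases_iff)
      ultimately show ?thesis by simp
    qed
  qed
  let ?c = "3024 * (log 2 (real ?n))\<^sup>2"
  show "tour_length I \<sigma> \<le> ?c * opt_pmt I"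
  \<comment> \<open>The bound for every preemptive tour passes to the infimum after division by the
    factor; the case of a vanishing factor is settled by comparing the route with itself.\<close>
  proof (cases "?c = 0")
    case True
    then show ?thesis using main[OF pre] by simp
  next
    case False
    then have c: "0 < ?c" by (simp add: zero_less_mult_iff)
    have "tour_length I \<sigma> / ?c \<le> opt_pmt I"
      unfolding opt_pmt_def
    proof (rule cInf_greatest)
      show "{tour_length I \<sigma> |\<sigma>. preemptive_tour I \<sigma>} \<noteq> {}" using pre by auto
      fix x assume "x \<in> {tour_length I \<sigma> |\<sigma>. preemptive_tour I \<sigma>}"
      then obtain \<tau> where "x = tour_length I \<tau>" "preemptive_tour I \<tau>" by blast
      then show "tour_length I \<sigma> / ?c \<le> x" using main[of \<tau>] c by (simp add: pos_divide_le_eq mult.commute)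
    qed
    then show ?thesis using c by (simp add: pos_divide_le_eq mult.commute)
  qed
qed

text \<open>Real distances have no common denominator. They are scaled until the least positive one
  is at least 1 and then rounded up, which at most doubles them and preserves the triangle
  inequality, because the ceiling is subadditive.\<close>

lemma good_tour_exists:
  assumes I: "dar_instance I"
  shows "\<exists>\<sigma>. one_preemptive_tour I \<sigma> \<and>
    tour_length I \<sigma> \<le> 3024 * (log 2 (real (nverts I)))\<^sup>2 * opt_pmt I"
proof -
  let ?n = "nverts I" and ?d = "dst I"
  interpret M: Metric_space "{..<?n}" ?d using I by (simp add: dar_instance_def)
  \<comment> \<open>The element 1 keeps the minimum defined when there are no two distinct
    vertices.\<close>
  define P where "P = insert 1 ((\<lambda>(u, v). ?d u v) ` {(u, v) \<in> {..<?n} \<times> {..<?n}. u \<noteq> v})"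
  have "finite {(u, v) \<in> {..<?n} \<times> {..<?n}. u \<noteq> v}"
    by (rule finite_subset[of _ "{..<?n} \<times> {..<?n}"]) auto
  then have fin: "finite P" unfolding P_def by simp
  have "\<forall>x\<in>P. 0 < x" unfolding P_def using M.mdist_pos_eq by auto
  then have \<delta>: "0 < Min P" using fin by (subst Min_gr_iff) (auto simp: P_def)
  define N where "N = 1 / Min P"
  have N: "0 < N" using \<delta> by (simp add: N_def)
  have ge1: "1 \<le> N * ?d u v" if "u < ?n" "v < ?n" "u \<noteq> v" for u v
  proof -
    have "Min P \<le> ?d u v" using that by (intro Min_le[OF fin]) (auto simp: P_def)
    then show ?thesis using \<delta> by (simp add: N_def pos_le_divide_eq)
  qed
  define w where "w = (\<lambda>u v. nat \<lceil>N * ?d u v\<rceil>)"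
  have real_w: "real (w u v) = of_int \<lceil>N * ?d u v\<rceil>" for u v
    using N M.nonneg[of u v] by (simp add: w_def)
  show ?thesis
  proof (rule exI, rule conjI)
    have bounds: "N * ?d u v \<le> real (w u v) \<and> real (w u v) \<le> 2 * N * ?d u v" if "u < ?n" "v < ?n" for u v
    proof (cases "u = v")
      case True
      then show ?thesis using that M.zero[of u u] by (simp add: real_w)
    next
      case False
      \<comment> \<open>A number from 1 on is at most doubled by rounding up.\<close>
      then show ?thesis using ge1[OF that] unfolding real_w by linarith
    qed
    have "weights w ?n"
    proof
      show "w u u = 0" if "u < ?n" for u using that M.zero[of u u] by (simp add: w_def)
      show "w u v = w v u" for u v by (simp add: w_def M.commute)
      fix u v x assume uvx: "u < ?n" "v < ?n" "x < ?n"
      have "N * ?d u x \<le> N * ?d u v + N * ?d v x"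
        using M.triangle[of u v x] uvx N by (simp flip: distrib_left)
      then have "\<lceil>N * ?d u x\<rceil> \<le> \<lceil>N * ?d u v\<rceil> + \<lceil>N * ?d v x\<rceil>" by linarith
      then have "real (w u x) \<le> real (w u v) + real (w v x)"
        unfolding real_w by (simp only: of_int_le_iff flip: of_int_add)
      then show "w u x \<le> w u v + w v x" by linarith
    qed
    from route_approximates[OF I this N bounds]
    show "one_preemptive_tour I (route w (capacity I) (root_vertex I) (demands I))"
      "tour_length I (route w (capacity I) (root_vertex I) (demands I)) \<le>
        3024 * (log 2 (real ?n))\<^sup>2 * opt_pmt I" by auto
  qed
qed

section \<open>The polynomial-time algorithm\<close>

text \<open>The last component is always 0: it is the end mark of \<open>enc_list\<close>, so that
  the nested pairs have exactly the code prescribed by \<open>enc_instance\<close>.\<close>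

type_synonym input = "nat \<times> (nat \<times> nat) list list \<times> nat \<times> (nat \<times> nat) list \<times> nat \<times> nat"

definition fraction :: "real \<Rightarrow> nat \<times> nat" where
  "fraction x = (let (a, b) = quotient_of (the_inv (of_rat :: rat \<Rightarrow> real) x) in (nat a, nat b))"

lemma fraction:
  assumes "x \<in> \<rat>" "0 \<le> x"
  shows "0 < snd (fraction x)" "x = real (fst (fraction x)) / real (snd (fraction x))"
proof -
  obtain q where q: "x = of_rat q" using assms(1) by (auto simp: Rats_def)
  obtain a b where ab: "quotient_of q = (a, b)" by (cases "quotient_of q")
  have "inj (of_rat :: rat \<Rightarrow> real)" by (auto simp: inj_on_def)
  then have f: "fraction x = (nat a, nat b)" using q ab by (simp add: fraction_def the_inv_f_f)
  have b: "0 < b" using quotient_of_denom_pos[OF ab] .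
  have "q = of_int a / of_int b" using quotient_of_div[OF ab] .
  then have x: "x = of_int a / of_int b" by (simp add: q of_rat_divide)
  then have "0 \<le> a" using assms(2) b by (simp add: zero_le_divide_iff)
  then show "0 < snd (fraction x)" "x = real (fst (fraction x)) / real (snd (fraction x))"
    using f b x by simp_all
qed

definition input_of :: "dial_a_ride \<Rightarrow> input" where
  "input_of I = (nverts I, map (\<lambda>u. map (\<lambda>v. fraction (dst I u v)) [0..<nverts I]) [0..<nverts I],
     root_vertex I, demands I, capacity I, 0)"

lemma enc_input_of: "enc_instance I = enc (input_of I)"
proof -
  have "enc_distance x = enc (fraction x)" for x
    by (simp add: enc_distance_def fraction_def split: prod.split)
  moreover have "(\<lambda>(u, v). Pair (Num u) (Num v)) = (enc :: nat \<times> nat \<Rightarrow> val)" by (rule ext) auto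
  ultimately show ?thesis
    by (simp add: enc_instance_def input_of_def enc_list_def comp_def)
qed

text \<open>The product of all denominators, which unlike their least common multiple needs no gcd.
  Its bit length is at most the sum of theirs, hence polynomial in the size of the input.\<close>

definition common_denominator :: "(nat \<times> nat) list list \<Rightarrow> nat" where
  "common_denominator M = prod_list (map snd (concat M))"

definition integral_weights :: "(nat \<times> nat) list list \<Rightarrow> nat list list" where
  "integral_weights M = map (map (\<lambda>q. fst q * (common_denominator M div snd q))) M"

definition solve :: "input \<Rightarrow> action list" where
  "solve x = route (wt (integral_weights (fst (snd x)))) (fst (snd (snd (snd (snd x)))))
     (fst (snd (snd x))) (fst (snd (snd (snd x))))"

lemma pt_prod_list [pt_rule]:
  assumes "pt l" shows "pt (\<lambda>x. prod_list (l x) :: nat)"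
proof -
  have "pt (\<lambda>x. rec_list (1 :: nat) (\<lambda>y ys r. y * r) (l x))"
    by (rule pt_rec[OF assms]) (intro pt_rule additive_rule)+
  moreover have "rec_list (1 :: nat) (\<lambda>y ys r. y * r) ys = prod_list ys" for ys
    by (induction ys) auto
  ultimately show ?thesis by simp
qed

lemma pt_solve: "pt solve"
proof -
  have "pt (\<lambda>M. integral_weights M)"
    unfolding integral_weights_def common_denominator_def by (intro pt_rule)
  note [pt_rule] = pt_comp[OF this]
  have "pt (\<lambda>x. solve x)" unfolding solve_def by (intro pt_rule)
  then show ?thesis .
qed

lemma prod_list_dvd: "x \<in> set xs \<Longrightarrow> x dvd prod_list xs" for x :: nat
  by (induction xs) auto

text \<open>The scaling is exact: \<open>w\<close> is the distance times the common denominator, so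
  symmetry and the triangle inequality are inherited from the metric.\<close>

lemma solve_approximates:
  assumes I: "dar_instance I" and rat: "rational_distances I"
  shows "one_preemptive_tour I (solve (input_of I))"
    "tour_length I (solve (input_of I)) \<le> 3024 * (log 2 (real (nverts I)))\<^sup>2 * opt_pmt I"
proof -
  let ?n = "nverts I" and ?d = "dst I"
  interpret M: Metric_space "{..<?n}" ?d using I by (simp add: dar_instance_def)
  define A where "A = map (\<lambda>u. map (\<lambda>v. fraction (?d u v)) [0..<?n]) [0..<?n]"
  define N where "N = common_denominator A"
  define w where "w = wt (integral_weights A)"
  have frac: "0 < snd (fraction (?d u v))" "?d u v = real (fst (fraction (?d u v))) / real (snd (fraction (?d u v)))"
    if "u < ?n" "v < ?n" for u v
    using fraction[of "?d u v"] that rat M.nonneg by (simp_all add: rational_distances_def)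
  have "0 \<notin> set (map snd (concat A))" using frac(1) by (force simp: A_def)
  then have "N \<noteq> 0" unfolding N_def common_denominator_def prod_list_zero_iff .
  then have N: "0 < N" by simp
  have real_w: "real (w u v) = real N * ?d u v" if uv: "u < ?n" "v < ?n" for u v
  proof -
    let ?q = "fraction (?d u v)"
    have "?q \<in> set (concat A)" using uv by (auto simp: A_def intro!: bexI[of _ u])
    then have "snd ?q dvd N" unfolding N_def common_denominator_def by (intro prod_list_dvd) auto
    then have "real (N div snd ?q) = real N / real (snd ?q)" by (rule real_of_nat_div)
    moreover have "w u v = fst ?q * (N div snd ?q)"
      using uv by (simp add: w_def wt_def lookup_def integral_weights_def A_def N_def)
    ultimately show ?thesis by (subst frac(2)[OF uv]) simp
  qed
  have W: "weights w ?n"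
  proof
    fix u v x assume uv: "u < ?n" "v < ?n"
    show "w u v = w v u" using real_w[OF uv] real_w[OF uv(2,1)] M.commute[of u v] by simp
    assume x: "x < ?n"
    have "real N * ?d u x \<le> real N * (?d u v + ?d v x)"
      using M.triangle[of u v x] uv x by (intro mult_left_mono) auto
    then have "real (w u x) \<le> real (w u v) + real (w v x)"
      using real_w uv x by (simp add: distrib_left)
    then show "w u x \<le> w u v + w v x" by linarith
  next
    fix u assume "u < ?n"
    then show "w u u = 0" using real_w[of u u] M.zero[of u u] by simp
  qed
  have pos: "0 < real N" using N by simp
  have bounds: "real N * ?d u v \<le> real (w u v) \<and> real (w u v) \<le> 2 * real N * ?d u v"
    if "u < ?n" "v < ?n" for u v
    using real_w[OF that] M.nonneg[of u v] by simp
  have eq: "solve (input_of I) = route w (capacity I) (root_vertex I) (demands I)"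
    by (simp add: solve_def input_of_def w_def A_def)
  show "one_preemptive_tour I (solve (input_of I))"
    unfolding eq by (rule route_approximates(1)[OF I W pos bounds])
  show "tour_length I (solve (input_of I)) \<le> 3024 * (log 2 (real (nverts I)))\<^sup>2 * opt_pmt I"
    unfolding eq by (rule route_approximates(2)[OF I W pos bounds])
qed

text \<open>The program ignores its coins, so all runs have the same output and both probabilities
  are 1. It is placed at base register 0, which holds the input at the start and the output at the
  end.\<close>

lemma rand_poly_time_finds_by_pt:
  fixes f :: "'a::enc \<Rightarrow> 'b::enc"
  assumes "pt f" "\<And>I. I \<in> \<I> \<Longrightarrow> enc_in I = enc (inp I)" "\<And>\<sigma>. enc_out \<sigma> = enc \<sigma>"
    "\<And>I. I \<in> \<I> \<Longrightarrow> feasible I (f (inp I)) \<and> good I (f (inp I))"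
  shows "rand_poly_time_finds \<I> enc_in enc_out feasible good"
proof -
  obtain p c where c: "computes c p f"
    by (rule ptE[OF assms(1)]) (rule that)
  show ?thesis unfolding rand_poly_time_finds_def
  proof (intro exI[of _ "c 0"] exI[of _ p] ballI)
    fix I assume I: "I \<in> \<I>"
    define x T where "x = enc_in I" and "T = poly p (vsize x)"
    have x: "x = enc (inp I)" by (simp add: x_def assms(2)[OF I])
    obtain s where s: "steps (c 0) ((\<lambda>_. Num 0)(0 := x)) T s" "s 0 = enc (f (inp I))"
      using computesD[OF c, of "(\<lambda>_. Num 0)(0 := x)" 0 "inp I"] by (auto simp: x T_def)
    then obtain t where t: "t \<le> T" "outputs (c 0) x w t (enc (f (inp I)))" for w
      unfolding steps_def outputs_def by metis
    have "halts_within (c 0) x T" unfolding halts_within_def using t by blast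
    moreover have "output_prob (c 0) x T P = 1" if "P (enc (f (inp I)))" for P
    proof -
      have "{w. \<exists>t y. outputs (c 0) x w t y \<and> P y} = UNIV" using t(2) that by blast
      then show ?thesis by (simp add: output_prob_def)
    qed
    moreover have "\<exists>\<sigma>. enc (f (inp I)) = enc_out \<sigma> \<and> feasible I \<sigma>"
      "\<exists>\<sigma>. enc (f (inp I)) = enc_out \<sigma> \<and> feasible I \<sigma> \<and> good I \<sigma>"
      using assms(3)[of "f (inp I)"] assms(4)[OF I] by metis+
    ultimately show "let x = enc_in I; T = poly p (vsize x) in halts_within (c 0) x T \<and>
        output_prob (c 0) x T (\<lambda>y. \<exists>\<sigma>. y = enc_out \<sigma> \<and> feasible I \<sigma>) = 1 \<and>
        1 / 2 \<le> output_prob (c 0) x T (\<lambda>y. \<exists>\<sigma>. y = enc_out \<sigma> \<and> feasible I \<sigma> \<and> good I \<sigma>)"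
      unfolding Let_def x_def[symmetric] T_def[symmetric] by simp
  qed
qed

theorem mainTheorem8:
  "\<exists>C::real. C > 0 \<and>
     (\<forall>I. dar_instance I \<longrightarrow>
        (\<exists>\<sigma>. one_preemptive_tour I \<sigma> \<and>
             tour_length I \<sigma> \<le> C * (log 2 (real (nverts I)))\<^sup>2 * opt_pmt I)) \<and>
     rand_poly_time_finds {I. dar_instance I \<and> rational_distances I} enc_instance enc_tour
       one_preemptive_tour
       (\<lambda>I \<sigma>. tour_length I \<sigma> \<le> C * (log 2 (real (nverts I)))\<^sup>2 * opt_pmt I)"
proof (intro exI[of _ 3024] conjI allI impI good_tour_exists)
  have "enc_tour \<sigma> = enc \<sigma>" for \<sigma>
    by (simp add: enc_tour_def enc_list_def enc_action_def[abs_def])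
  then show "rand_poly_time_finds {I. dar_instance I \<and> rational_distances I} enc_instance enc_tour
       one_preemptive_tour
       (\<lambda>I \<sigma>. tour_length I \<sigma> \<le> 3024 * (log 2 (real (nverts I)))\<^sup>2 * opt_pmt I)"
    using enc_input_of solve_approximates by (intro rand_poly_time_finds_by_pt[OF pt_solve]) auto
qed simp_all

end
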